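(* Let $-1<q\le1$ and let $\rho_1,\rho_2$ be real with $|\rho_1|,|\rho_2|<1$. Then for all $x,y,z\in S(q)$, $$\phi(x|y,\rho_1,z,\rho_2,q)=f_N(x|q)\sum_{i=0}^\infty\frac1{[i]_q!}H_i(x|q)\,C_i(y,z|\rho_1,\rho_2,q),$$ where convergence is absolute and almost uniform on compact sets.
   Context: Notation: $(\alpha)_n=(\alpha;q)_n=\prod_{i=0}^{n-1}(1-\alpha q^i)$, $(\alpha)_0=1$, $(\alpha)_\infty=\prod_{i\ge0}(1-\alpha q^i)$, with $0^0=1$; $[n]_q=1+q+\dots+q^{n-1}$, $[0]_q=0$, $[n]_q!=\prod_{i=1}^n[i]_q$, $[0]_q!=1$. $S(q)=[-2/\sqrt{1-q},2/\sqrt{1-q}]$ for $|q|<1$ and $S(1)=\mathbb R$. $q$-Hermite polynomials: $H_{-1}(x|q)=0$, $H_0(x|q)=1$, $H_{n+1}(x|q)=xH_n(x|q)-[n]_qH_{n-1}(x|q)$ for $n\ge0$. For $|q|<1$ and $x\in S(q)$, $$f_N(x|q)=\frac{\sqrt{1-q}\,(q)_\infty}{2\pi\sqrt{4-(1-q)x^2}}\prod_{k=0}^\infty\big((1+q^k)^2-(1-q)x^2q^k\big)$$ (the $k=0$ factor is $4-(1-q)x^2$, so the value at the endpoints is understood as $0$), and $f_N(x|1)=\frac1{\sqrt{2\pi}}e^{-x^2/2}$. For $k\ge0$, $w_k(x,y|\rho,q)=(1-\rho^2q^{2k})^2-(1-q)\rho q^k(1+\rho^2q^{2k})xy+(1-q)\rho^2(x^2+y^2)q^{2k}$.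 For $|q|<1$ and $x,y,z\in S(q)$, $$\phi(x|y,\rho_1,z,\rho_2,q)=f_N(x|q)\,\frac{(\rho_1^2)_\infty(\rho_2^2)_\infty}{(\rho_1^2\rho_2^2)_\infty}\prod_{k=0}^\infty\frac{w_k(y,z|\rho_1\rho_2,q)}{w_k(x,y|\rho_1,q)\,w_k(x,z|\rho_2,q)},$$ and for $q=1$, $\phi(\cdot|y,\rho_1,z,\rho_2,1)$ is the density of the normal distribution on $\mathbb R$ with mean $\frac{y\rho_1(1-\rho_2^2)+z\rho_2(1-\rho_1^2)}{1-\rho_1^2\rho_2^2}$ and variance $\frac{(1-\rho_1^2)(1-\rho_2^2)}{1-\rho_1^2\rho_2^2}$. For $n\ge0$, $C_n(y,z|\rho_1,\rho_2,q)=\int_{S(q)}H_n(x|q)\,\phi(x|y,\rho_1,z,\rho_2,q)\,dx$ (so $C_0=1$). *)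

theory Defs
  imports "HOL-Probability.Probability"
begin

definition q_pochhammer_inf :: "real \<Rightarrow> real \<Rightarrow> real" where
  "q_pochhammer_inf a q = (\<Prod>i. 1 - a * q ^ i)"

definition q_bracket :: "real \<Rightarrow> nat \<Rightarrow> real" where
  "q_bracket q n = (\<Sum>i<n. q ^ i)"

definition q_fact :: "real \<Rightarrow> nat \<Rightarrow> real" where
  "q_fact q n = (\<Prod>i=1..n. q_bracket q i)"

definition S :: "real \<Rightarrow> real set" where
  "S q = (if q = 1 then UNIV else {- (2 / sqrt (1 - q)) .. 2 / sqrt (1 - q)})"

text \<open>The second equation is the general recurrence at index 0, where the preceding
  polynomial (index -1) is zero.\<close>

fun q_Hermite :: "real \<Rightarrow> nat \<Rightarrow> real \<Rightarrow> real" where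
  "q_Hermite q 0 x = 1"
| "q_Hermite q (Suc 0) x = x"
| "q_Hermite q (Suc (Suc n)) x =
     x * q_Hermite q (Suc n) x - q_bracket q (Suc n) * q_Hermite q n x"

text \<open>At the endpoints of \<open>S q\<close> with \<open>\<bar>q\<bar> < 1\<close> the square root in the denominator vanishes;
  since division by zero yields zero, the value there is 0, as intended.\<close>

definition f_N :: "real \<Rightarrow> real \<Rightarrow> real" where
  "f_N q x =
    (if q = 1 then exp (- x\<^sup>2 / 2) / sqrt (2 * pi)
     else sqrt (1 - q) * q_pochhammer_inf q q / (2 * pi * sqrt (4 - (1 - q) * x\<^sup>2)) *
       (\<Prod>k. (1 + q ^ k)\<^sup>2 - (1 - q) * x\<^sup>2 * q ^ k))"

definition w :: "real \<Rightarrow> nat \<Rightarrow> real \<Rightarrow> real \<Rightarrow> real \<Rightarrow> real" where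
  "w q k x y \<rho> =
     (1 - \<rho>\<^sup>2 * q ^ (2 * k))\<^sup>2
     - (1 - q) * \<rho> * q ^ k * (1 + \<rho>\<^sup>2 * q ^ (2 * k)) * x * y
     + (1 - q) * \<rho>\<^sup>2 * (x\<^sup>2 + y\<^sup>2) * q ^ (2 * k)"

text \<open>The second argument of \<^const>\<open>normal_density\<close> is the standard deviation, hence the
  square root of the variance.\<close>

definition \<phi> :: "real \<Rightarrow> real \<Rightarrow> real \<Rightarrow> real \<Rightarrow> real \<Rightarrow> real \<Rightarrow> real" where
  "\<phi> q x y \<rho>1 z \<rho>2 =
    (if q = 1 then
       normal_density
         ((y * \<rho>1 * (1 - \<rho>2\<^sup>2) + z * \<rho>2 * (1 - \<rho>1\<^sup>2)) / (1 - \<rho>1\<^sup>2 * \<rho>2\<^sup>2))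
         (sqrt ((1 - \<rho>1\<^sup>2) * (1 - \<rho>2\<^sup>2) / (1 - \<rho>1\<^sup>2 * \<rho>2\<^sup>2))) x
     else f_N q x *
       (q_pochhammer_inf (\<rho>1\<^sup>2) q * q_pochhammer_inf (\<rho>2\<^sup>2) q
         / q_pochhammer_inf (\<rho>1\<^sup>2 * \<rho>2\<^sup>2) q) *
       (\<Prod>k. w q k y z (\<rho>1 * \<rho>2) / (w q k x y \<rho>1 * w q k x z \<rho>2)))"

definition C :: "real \<Rightarrow> nat \<Rightarrow> real \<Rightarrow> real \<Rightarrow> real \<Rightarrow> real \<Rightarrow> real" where
  "C q n y z \<rho>1 \<rho>2 = (LINT x:S q|lborel. q_Hermite q n x * \<phi> q x y \<rho>1 z \<rho>2)"

end

theory Submission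
  imports Defs
begin

text \<open>
  For \<open>\<bar>q\<bar> < 1\<close> rescale to \<open>t = sqrt (1 - q) * x\<close>. The series
  \<open>F(r) = \<Sum>n. h\<^sub>n(t) h\<^sub>n(s) r ^ n / (q; q)\<^sub>n\<close> satisfies a functional equation linking
  \<open>F(r)\<close> and \<open>F(q r)\<close>, because its coefficients obey a recurrence of order four; iterating it gives
  the q-Mehler product formula. Hence \<open>\<phi> / f_N\<close> is \<open>F(x, y, \<rho>1) F(x, z, \<rho>2) / F(y, z, \<rho>1 \<rho>2)\<close>, a function of
  \<open>x\<close> which polynomials of degree below \<open>2 M\<close> approximate with geometrically small error, uniformly
  in \<open>y\<close> and \<open>z\<close>. Since the \<open>H\<^sub>n\<close> are orthogonal for \<open>f_N\<close>, its expansion coefficients, which are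
  the \<open>C\<^sub>i\<close>, decay geometrically and the expansion converges to it. Orthogonality reduces to
  \<open>\<integral> H\<^sub>n f_N = 0\<close> for \<open>n > 0\<close>; this follows from \<open>x = 2 cos \<theta> / sqrt (1 - q)\<close>, a finite Jacobi
  triple product for the partial products of the weight, and a limit of Fourier coefficients.
  For \<open>q = 1\<close>, Gaussian integration by parts yields \<open>C\<^sub>n = s ^ n H\<^sub>n(m / s)\<close>, where \<open>m\<close> is the mean and
  \<open>1 - s\<^sup>2\<close> the variance of \<open>\<phi>\<close>, and the claim is Mehler's formula.\<close>

section \<open>Infinite products and shifted factorials\<close>

text \<open>For |q| < 1 the \<open>C\<close> enter only as integrals against \<open>\<phi>\<close>,
  so the expansion is proved from the side of the function: the error of one approximant of
  \<open>\<phi> / f_N\<close> bounds both the coefficients and the remainder, which yields uniform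
  rather than mean convergence. Two Mehler series cut after M terms multiply to degree below 2 M;
  the denominator does not contain x, so a lower bound for it is enough. One parameter balances the
  margins: the polynomials grow at most like \<sigma>^n, with \<sigma> > 1 as close to 1 as desired,
  the truncation error decays like (\<sigma>^2 \<rho>)^M = r^(2 M), and a coefficient times a
  polynomial costs a further \<sigma>^(2 n). Hence the condition \<sigma>^2 r < 1. As q may be
  negative or 0, estimates are made in |q| and identities avoid dividing by q. At q = 1 the set
  \<open>S q\<close> is not compact and the polynomials are bounded by multiples of sqrt (n!)
  \<sigma>^n on bounded sets only; there the two conditioning values collapse to the single value m
  / s.\<close>

lemma prodinf_eqI:
  fixes f :: "nat \<Rightarrow> real"
  assumes "\<And>k. f k \<noteq> 0" and "(\<lambda>n. \<Prod>k<n. f k) \<longlonglongrightarrow> L" and "L \<noteq> 0"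
  shows "prodinf f = L"
proof -
  have "(\<lambda>n. \<Prod>k\<le>n. f k) \<longlonglongrightarrow> L"
    using LIMSEQ_Suc[OF assms(2)] by (simp add: lessThan_Suc_atMost)
  \<comment> \<open>A limit 0 of nonvanishing factors counts as divergence for
    \<open>has_prod\<close>; this is where \<open>L \<noteq> 0\<close> enters.\<close>
  then have "f has_prod L"
    using assms(3) by (simp add: has_prod_def raw_has_prod_def)
  then show ?thesis by (rule has_prod_unique[symmetric])
qed

lemma prod_tendsto_prodinf:
  fixes f :: "nat \<Rightarrow> real"
  assumes "\<And>k. f k \<noteq> 0" and "summable (\<lambda>k. \<bar>f k - 1\<bar>)"
  shows "(\<lambda>n. \<Prod>k<n. f k) \<longlonglongrightarrow> prodinf f" and "prodinf f \<noteq> 0"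
proof -
  have conv: "convergent_prod f"
    using assms(2) by (intro abs_convergent_prod_imp_convergent_prod summable_imp_abs_convergent_prod) simp
  show "(\<lambda>n. \<Prod>k<n. f k) \<longlonglongrightarrow> prodinf f"
    using convergent_prod_LIMSEQ[OF conv] by (simp add: LIMSEQ_lessThan_iff_atMost)
  show "prodinf f \<noteq> 0"
    using conv assms(1) by (rule prodinf_nonzero)
qed

lemma q_pochhammer_tendsto:
  fixes q a :: real
  assumes "\<bar>q\<bar> < 1" and "\<bar>a\<bar> < 1"
  shows "(\<lambda>n. \<Prod>i<n. 1 - a * q ^ i) \<longlonglongrightarrow> q_pochhammer_inf a q" and "q_pochhammer_inf a q \<noteq> 0"
proof -
  have nz: "1 - a * q ^ i \<noteq> 0" for i
  proof -
    have "\<bar>a * q ^ i\<bar> \<le> \<bar>a\<bar>"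
      using assms by (simp add: abs_mult power_abs mult_left_le power_le_one)
    then show ?thesis using assms by linarith
  qed
  have sm: "summable (\<lambda>i. \<bar>(1 - a * q ^ i) - 1\<bar>)"
    using assms by (auto simp: abs_mult power_abs intro!: summable_mult summable_geometric)
  show "(\<lambda>n. \<Prod>i<n. 1 - a * q ^ i) \<longlonglongrightarrow> q_pochhammer_inf a q" and "q_pochhammer_inf a q \<noteq> 0"
    unfolding q_pochhammer_inf_def using prod_tendsto_prodinf[OF nz sm] by auto
qed

text \<open>The finite shifted factorial (q; q)_n, whose first factor is 1 - q and not 1 -
  q^0.\<close>

definition qpoch :: "real \<Rightarrow> nat \<Rightarrow> real" where
  "qpoch q n = (\<Prod>i<n. 1 - q ^ Suc i)"

lemma qpoch_0 [simp]: "qpoch q 0 = 1"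
  by (simp add: qpoch_def)

lemma qpoch_Suc: "qpoch q (Suc n) = (1 - q ^ Suc n) * qpoch q n"
  by (simp add: qpoch_def)

lemma abs_power_Suc_less_one: "\<bar>q\<bar> < 1 \<Longrightarrow> \<bar>q ^ Suc n\<bar> < (1::real)"
  by (metis abs_ge_zero power_Suc_less_one power_abs zero_less_Suc power_less_one_iff)

lemma qpoch_pos: "\<bar>q\<bar> < 1 \<Longrightarrow> 0 < qpoch q n"
  unfolding qpoch_def using abs_power_Suc_less_one[of q]
  by (intro prod_pos) (smt (verit))

lemma qpoch_tendsto: "\<bar>q\<bar> < 1 \<Longrightarrow> qpoch q \<longlonglongrightarrow> q_pochhammer_inf q q"
  using q_pochhammer_tendsto(1)[of q q] by (simp add: qpoch_def[abs_def])

text \<open>The sequence converges to a nonzero limit, so it and its inverse are bounded; positivity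
  of the terms turns the second bound into a positive lower one.\<close>

lemma qpoch_bounds:
  assumes "\<bar>q\<bar> < 1"
  obtains c B where "0 < c" and "\<And>n. c \<le> qpoch q n" and "\<And>n. qpoch q n \<le> B"
proof -
  have "Bseq (\<lambda>n. inverse (qpoch q n))" "Bseq (qpoch q)"
    using tendsto_inverse[OF qpoch_tendsto[OF assms] q_pochhammer_tendsto(2)[OF assms assms]]
      qpoch_tendsto[OF assms] by (meson convergentI convergent_imp_Bseq)+
  then obtain K B where K: "0 < K" "\<And>n. \<bar>inverse (qpoch q n)\<bar> \<le> K" and B: "\<And>n. \<bar>qpoch q n\<bar> \<le> B"
    unfolding Bseq_def by (metis real_norm_def)
  show thesis
  proof (rule that[of "inverse K" B])
    fix n
    have "inverse (qpoch q n) \<le> K"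
      using K(2)[of n] by linarith
    then show "inverse K \<le> qpoch q n"
      using qpoch_pos[OF assms, of n] K(1) by (simp add: inverse_le_iff field_simps)
    show "qpoch q n \<le> B"
      using B[of n] by linarith
  qed (use K(1) in simp)
qed

section \<open>The rescaled q-Hermite polynomials\<close>

text \<open>The continuous q-Hermite polynomials in t = sqrt (1 - q) * x = 2 cos \<theta>. The
  scaling turns [n]_q into 1 - q^n and \<open>S q\<close> into [-2, 2], independent of q.\<close>

fun cqH :: "real \<Rightarrow> nat \<Rightarrow> real \<Rightarrow> real" where
  "cqH q 0 t = 1"
| "cqH q (Suc 0) t = t"
| "cqH q (Suc (Suc n)) t = t * cqH q (Suc n) t - (1 - q ^ Suc n) * cqH q n t"

lemma q_bracket_eq: "q \<noteq> 1 \<Longrightarrow> q_bracket q n = (1 - q ^ n) / (1 - q)"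
  by (simp add: q_bracket_def sum_gp_strict)

lemma cqH_scale:
  assumes "q < 1"
  shows "cqH q n (sqrt (1 - q) * x) = sqrt (1 - q) ^ n * q_Hermite q n x"
proof (induction n rule: induct_nat_012)
  case (ge2 n)
  have s: "sqrt (1 - q) * sqrt (1 - q) = 1 - q"
    using assms by simp
  have "sqrt (1 - q) ^ Suc (Suc n) * q_Hermite q (Suc (Suc n)) x =
     sqrt (1 - q) * x * (sqrt (1 - q) ^ Suc n * q_Hermite q (Suc n) x)
     - (sqrt (1 - q) * sqrt (1 - q)) * q_bracket q (Suc n) * (sqrt (1 - q) ^ n * q_Hermite q n x)"
    by (simp add: algebra_simps)
  also have "\<dots> = cqH q (Suc (Suc n)) (sqrt (1 - q) * x)"
    unfolding s using ge2 assms by (simp add: q_bracket_eq)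
  finally show ?case by simp
qed simp_all

lemma q_fact_eq:
  assumes "q \<noteq> 1"
  shows "q_fact q n = qpoch q n / (1 - q) ^ n"
proof (induction n)
  case 0
  then show ?case by (simp add: q_fact_def)
next
  case (Suc n)
  have "q_fact q (Suc n) = q_fact q n * q_bracket q (Suc n)"
    by (simp add: q_fact_def)
  then show ?case
    using Suc assms by (simp add: qpoch_Suc q_bracket_eq mult_ac)
qed

section \<open>Generating function of the rescaled polynomials and their growth on [-2, 2]\<close>

definition qexp_fps :: "real \<Rightarrow> complex \<Rightarrow> complex fps" where
  "qexp_fps q z = Abs_fps (\<lambda>k. z ^ k / of_real (qpoch q k))"

text \<open>\<open>qexp_fps q z\<close> is Euler's expansion of 1 / ((1 - z X)(1 - q z X)(1 - q^2 z
  X)...), and multiplication by 1 - z X removes the first factor. Formal series spare all questions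
  of convergence.\<close>

lemma qexp_fps_mult:
  assumes "\<bar>q\<bar> < 1"
  shows "qexp_fps q z * (1 - fps_const z * fps_X) = qexp_fps q (of_real q * z)"
proof (rule fps_ext)
  fix n
  have nz: "qpoch q n \<noteq> 0" for n
    using qpoch_pos[OF assms, of n] by simp
  have E: "qexp_fps q z * (1 - fps_const z * fps_X) = qexp_fps q z - fps_const z * (fps_X * qexp_fps q z)"
    by (simp add: algebra_simps)
  show "fps_nth (qexp_fps q z * (1 - fps_const z * fps_X)) n = fps_nth (qexp_fps q (of_real q * z)) n"
  proof (cases n)
    case 0
    then show ?thesis by (simp add: E qexp_fps_def)
  next
    case (Suc m)
    have n1: "1 - (of_real q ^ Suc m :: complex) \<noteq> 0"
      using abs_power_Suc_less_one[OF assms, of m]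
      by (metis abs_1 eq_iff_diff_eq_0 less_irrefl of_real_1 of_real_eq_iff of_real_power)
    have "z ^ Suc m / of_real (qpoch q (Suc m)) - z * (z ^ m / of_real (qpoch q m))
        = (of_real q * z) ^ Suc m / of_real (qpoch q (Suc m))"
      using nz[of m] n1 by (simp add: qpoch_Suc divide_simps) (simp add: power_mult_distrib algebra_simps)
    then show ?thesis unfolding Suc E by (simp add: qexp_fps_def)
  qed
qed

text \<open>Rogers' formula. \<open>R\<close> is the product of two Euler series, and (1 - z X)(1 -
  w X) = 1 - t X + X^2 because z w = 1 and z + w = t. Removing the two first factors replaces X by q
  X; comparing coefficients gives the three-term recurrence of \<open>cqH\<close> divided by (q;
  q)_n.\<close>

lemma cqH_eq_sum:
  fixes z w :: complex
  assumes q: "\<bar>q\<bar> < 1" and zw: "z * w = 1" and t: "of_real t = z + w"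
  shows "of_real (cqH q n t) =
    of_real (qpoch q n) * (\<Sum>k\<le>n. z ^ k * w ^ (n - k) / of_real (qpoch q k * qpoch q (n - k)))"
proof -
  define R where "R = qexp_fps q z * qexp_fps q w"
  have R_nth: "fps_nth R n = (\<Sum>k\<le>n. z ^ k * w ^ (n - k) / of_real (qpoch q k * qpoch q (n - k)))" for n
    by (simp add: R_def fps_mult_nth qexp_fps_def atLeast0AtMost)
  have "R * (1 - fps_const (of_real t) * fps_X + fps_X * fps_X) =
      (qexp_fps q z * (1 - fps_const z * fps_X)) * (qexp_fps q w * (1 - fps_const w * fps_X))"
  proof -
    have 1: "fps_const z * fps_const w = 1"
      using zw by simp
    have "(1 - fps_const z * fps_X) * (1 - fps_const w * fps_X) =
       1 - (fps_const z + fps_const w) * fps_X + (fps_const z * fps_const w) * (fps_X * fps_X)"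
      by (simp only: algebra_simps mult_1_left mult_1_right)
    also have "\<dots> = 1 - fps_const (of_real t) * fps_X + fps_X * fps_X"
      by (simp add: 1 t del: fps_const_mult)
    finally show ?thesis
      by (simp only: R_def mult_ac)
  qed
  also have "\<dots> = qexp_fps q (of_real q * z) * qexp_fps q (of_real q * w)"
    by (simp only: qexp_fps_mult[OF q])
  finally have E: "R - fps_const (of_real t) * (fps_X * R) + fps_X * (fps_X * R) =
      qexp_fps q (of_real q * z) * qexp_fps q (of_real q * w)" (is "?L = ?R")
    by (simp add: algebra_simps)
  have R': "fps_nth ?R n = of_real q ^ n * fps_nth R n" for n
  proof -
    have "fps_nth ?R n = (\<Sum>k\<le>n. of_real q ^ n * (z ^ k * w ^ (n - k) / of_real (qpoch q k * qpoch q (n - k))))"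
      unfolding fps_mult_nth qexp_fps_def atLeast0AtMost fps_nth_Abs_fps
    proof (rule sum.cong)
      fix k assume "k \<in> {..n}"
      then have "(of_real q :: complex) ^ n = of_real q ^ k * of_real q ^ (n - k)"
        by (simp flip: power_add)
      then show "(of_real q * z) ^ k / of_real (qpoch q k) * ((of_real q * w) ^ (n - k) / of_real (qpoch q (n - k)))
         = of_real q ^ n * (z ^ k * w ^ (n - k) / of_real (qpoch q k * qpoch q (n - k)))"
        by (simp add: power_mult_distrib)
    qed simp
    then show ?thesis
      by (simp add: R_nth sum_distrib_left)
  qed
  have rec: "(1 - of_real q ^ Suc (Suc n)) * fps_nth R (Suc (Suc n)) = of_real t * fps_nth R (Suc n) - fps_nth R n" for n
    using arg_cong[OF E, of "\<lambda>f. fps_nth f (Suc (Suc n))"] R'[of "Suc (Suc n)"] by (simp add: algebra_simps)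
  have nz: "of_real (qpoch q n) \<noteq> (0::complex)" for n
    using qpoch_pos[OF q, of n] by simp
  have "of_real (cqH q n t) = of_real (qpoch q n) * fps_nth R n"
  proof (induction n rule: induct_nat_012)
    case 0
    then show ?case by (simp add: R_nth)
  next
    case 1
    have "1 - complex_of_real q \<noteq> 0" using q
      by (metis abs_1 eq_iff_diff_eq_0 less_irrefl of_real_1 of_real_eq_iff)
    moreover have "fps_nth R (Suc 0) = (z + w) / (1 - of_real q)"
      by (simp add: R_nth qpoch_Suc add_divide_distrib add.commute)
    ultimately show ?case
      by (simp add: t qpoch_Suc)
  next
    case (ge2 n)
    have "complex_of_real (cqH q (Suc (Suc n)) t) =
        of_real t * of_real (cqH q (Suc n) t) - (1 - of_real q ^ Suc n) * of_real (cqH q n t)"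
      by simp
    also have "\<dots> = of_real (qpoch q (Suc n)) * (of_real t * fps_nth R (Suc n) - fps_nth R n)"
      by (simp only: ge2) (simp add: qpoch_Suc algebra_simps)
    also have "\<dots> = of_real (qpoch q (Suc (Suc n))) * fps_nth R (Suc (Suc n))"
      unfolding rec[symmetric] by (simp add: qpoch_Suc[of q "Suc n"] del: power_Suc)
    finally show ?case .
  qed
  then show ?thesis
    by (simp add: R_nth)
qed

text \<open>At t = 2 cos \<theta> the numbers z and w lie on the unit circle, so the formula has n +
  1 terms bounded by a constant.\<close>

lemma cqH_bound:
  assumes q: "\<bar>q\<bar> < 1"
  obtains K where "K > 0" and "\<And>n t. \<bar>t\<bar> \<le> 2 \<Longrightarrow> \<bar>cqH q n t\<bar> \<le> K * (real n + 1)"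
proof -
  obtain c B where c: "0 < c" "\<And>n. c \<le> qpoch q n" and B: "\<And>n. qpoch q n \<le> B"
    using qpoch_bounds[OF q] by metis
  have B0: "B > 0"
    using c B by (metis less_le_trans)
  have "\<bar>cqH q n t\<bar> \<le> B / c\<^sup>2 * (real n + 1)" if "\<bar>t\<bar> \<le> 2" for n t
  proof -
    define \<theta> where "\<theta> = arccos (t / 2)"
    have t: "of_real t = cis \<theta> + cis (-\<theta>)"
      using that by (simp add: complex_eq_iff \<theta>_def cos_arccos_abs)
    have "\<bar>cqH q n t\<bar> = norm (complex_of_real (cqH q n t))"
      by simp
    also have "\<dots> = qpoch q n * norm (\<Sum>k\<le>n. cis \<theta> ^ k * cis (-\<theta>) ^ (n - k) / of_real (qpoch q k * qpoch q (n - k)))"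
      unfolding cqH_eq_sum[OF q _ t, simplified cis_mult, simplified]
      using qpoch_pos[OF q, of n] by (simp add: norm_mult)
    also have "\<dots> \<le> B * (\<Sum>k\<le>n. 1 / c\<^sup>2)"
    proof (intro mult_mono B order_trans[OF norm_sum] sum_mono)
      fix k
      have "c\<^sup>2 \<le> qpoch q k * qpoch q (n - k)"
        unfolding power2_eq_square using c by (intro mult_mono) (auto intro: order_trans less_imp_le)
      then show "norm (cis \<theta> ^ k * cis (-\<theta>) ^ (n - k) / of_real (qpoch q k * qpoch q (n - k))) \<le> 1 / c\<^sup>2"
        using c(1) qpoch_pos[OF q] by (simp add: norm_mult norm_divide norm_power frac_le abs_mult order_less_imp_le)
    qed (use B0 in auto)
    also have "\<dots> = B / c\<^sup>2 * (real n + 1)"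
      by simp
    finally show ?thesis .
  qed
  then show thesis
    using B0 c(1) by (intro that[of "B / c\<^sup>2"]) auto
qed

lemma continuous_on_cqH [continuous_intros]:
  "continuous_on A f \<Longrightarrow> continuous_on A (\<lambda>x. cqH q n (f x))"
  by (induction q n "0::real" rule: cqH.induct) (auto intro!: continuous_intros)

section \<open>The q-Mehler formula\<close>

lemma linear_le_geometric:
  fixes \<sigma> :: real
  assumes "1 < \<sigma>"
  obtains K where "0 < K" and "\<And>n. real n + 1 \<le> K * \<sigma> ^ n"
proof -
  have "(\<lambda>n. real n * (1 / \<sigma>) ^ n) \<longlonglongrightarrow> 0"
    using assms by (intro powser_times_n_limit_0) simp
  then have "Bseq (\<lambda>n. real n * (1 / \<sigma>) ^ n)"
    by (intro convergent_imp_Bseq convergentI)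
  then obtain B where B: "0 < B" "\<And>n. \<bar>real n * (1 / \<sigma>) ^ n\<bar> \<le> B"
    unfolding Bseq_def real_norm_def by blast
  show thesis
  proof (rule that[of "B + 1"])
    fix n
    have "real n / \<sigma> ^ n \<le> B"
      using B(2)[of n] assms by (simp add: power_one_over)
    then have "real n \<le> B * \<sigma> ^ n"
      using assms by (simp add: pos_divide_le_eq)
    moreover have "1 \<le> \<sigma> ^ n"
      using assms by (simp add: one_le_power)
    ultimately show "real n + 1 \<le> (B + 1) * \<sigma> ^ n"
      by (simp add: algebra_simps)
  qed (use B in simp)
qed

text \<open>Linear growth is weakened to geometric growth so that all later estimates are geometric
  series.\<close>

lemma cqH_geometric_bound:
  assumes q: "\<bar>q\<bar> < 1" and \<sigma>: "1 < \<sigma>"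
  obtains K where "0 < K" and "\<And>n t. \<bar>t\<bar> \<le> 2 \<Longrightarrow> \<bar>cqH q n t\<bar> \<le> K * \<sigma> ^ n"
proof -
  obtain K where K: "K > 0" "\<And>n t. \<bar>t\<bar> \<le> 2 \<Longrightarrow> \<bar>cqH q n t\<bar> \<le> K * (real n + 1)"
    using cqH_bound[OF q] by metis
  obtain K' where K': "0 < K'" "\<And>n. real n + 1 \<le> K' * \<sigma> ^ n"
    using linear_le_geometric[OF \<sigma>] by metis
  show thesis
  proof (rule that[of "K * K'"])
    fix n and t :: real assume "\<bar>t\<bar> \<le> 2"
    then have "\<bar>cqH q n t\<bar> \<le> K * (real n + 1)" by (rule K)
    also have "\<dots> \<le> K * (K' * \<sigma> ^ n)"
      using K K' by (intro mult_left_mono) auto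
    finally show "\<bar>cqH q n t\<bar> \<le> K * K' * \<sigma> ^ n" by (simp add: mult.assoc)
  qed (use K K' in simp)
qed

definition mehler_coeff :: "real \<Rightarrow> real \<Rightarrow> real \<Rightarrow> nat \<Rightarrow> real" where
  "mehler_coeff q t s n = cqH q n t * cqH q n s / qpoch q n"

definition mehler :: "real \<Rightarrow> real \<Rightarrow> real \<Rightarrow> real \<Rightarrow> real" where
  "mehler q t s r = (\<Sum>n. mehler_coeff q t s n * r ^ n)"

text \<open>With t = 2 cos a and s = 2 cos b this is the product of 1 - r e^(i (+-a +- b)) over the
  four choices of signs. At r q^k it is \<open>w\<close> in the scaled variables.\<close>

definition mehler_factor :: "real \<Rightarrow> real \<Rightarrow> real \<Rightarrow> real" where
  "mehler_factor t s r = (1 - r\<^sup>2)\<^sup>2 - r * (1 + r\<^sup>2) * (t * s) + r\<^sup>2 * (t\<^sup>2 + s\<^sup>2)"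

lemma mehler_coeff_bound:
  assumes q: "\<bar>q\<bar> < 1" and \<sigma>: "1 < \<sigma>"
  obtains K where "0 < K"
    and "\<And>n t s. \<bar>t\<bar> \<le> 2 \<Longrightarrow> \<bar>s\<bar> \<le> 2 \<Longrightarrow> \<bar>mehler_coeff q t s n\<bar> \<le> K * (\<sigma>\<^sup>2) ^ n"
proof -
  obtain K where K: "K > 0" "\<And>n t. \<bar>t\<bar> \<le> 2 \<Longrightarrow> \<bar>cqH q n t\<bar> \<le> K * \<sigma> ^ n"
    using cqH_geometric_bound[OF q \<sigma>] by metis
  obtain c where c: "0 < c" "\<And>n. c \<le> qpoch q n"
    using qpoch_bounds[OF q] by metis
  show thesis
  proof (rule that[of "K\<^sup>2 / c"])
    fix n and t s :: real assume "\<bar>t\<bar> \<le> 2" "\<bar>s\<bar> \<le> 2"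
    then have "\<bar>cqH q n t\<bar> * \<bar>cqH q n s\<bar> / qpoch q n \<le> (K * \<sigma> ^ n) * (K * \<sigma> ^ n) / c"
      using K c \<sigma> by (intro frac_le mult_mono) auto
    then show "\<bar>mehler_coeff q t s n\<bar> \<le> K\<^sup>2 / c * (\<sigma>\<^sup>2) ^ n"
      using qpoch_pos[OF q, of n]
      by (simp add: mehler_coeff_def abs_mult power2_eq_square power_mult_distrib mult_ac)
  qed (use K c in simp)
qed

lemma summable_mehler:
  assumes "\<bar>q\<bar> < 1" "\<bar>t\<bar> \<le> 2" "\<bar>s\<bar> \<le> 2" "\<bar>r\<bar> < 1"
  shows "summable (\<lambda>n. mehler_coeff q t s n * r ^ n)"
proof -
  obtain \<rho> where \<rho>: "\<bar>r\<bar> < \<rho>" "\<rho> < 1"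
    using assms(4) dense by blast
  then have "0 < \<rho>" by linarith
  \<comment> \<open>With this choice \<sigma>^2 |r| = |r| / \<rho> < 1.\<close>
  define \<sigma> where "\<sigma> = sqrt (1 / \<rho>)"
  have \<sigma>: "1 < \<sigma>" "\<sigma>\<^sup>2 = 1 / \<rho>"
    using \<rho> \<open>0 < \<rho>\<close> by (auto simp: \<sigma>_def)
  obtain K where K: "0 < K" "\<And>n. \<bar>mehler_coeff q t s n\<bar> \<le> K * (\<sigma>\<^sup>2) ^ n"
    using mehler_coeff_bound[OF assms(1) \<sigma>(1)] assms(2,3) by metis
  show ?thesis
  proof (rule summable_comparison_test')
    show "summable (\<lambda>n. K * (\<bar>r\<bar> / \<rho>) ^ n)"
      using \<rho> \<open>0 < \<rho>\<close> by (intro summable_mult summable_geometric) auto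
    fix n
    have "norm (mehler_coeff q t s n * r ^ n) = \<bar>mehler_coeff q t s n\<bar> * \<bar>r\<bar> ^ n"
      by (simp only: real_norm_def abs_mult power_abs)
    also have "\<dots> \<le> (K * (\<sigma>\<^sup>2) ^ n) * \<bar>r\<bar> ^ n"
      using K(2)[of n] by (rule mult_right_mono) simp
    also have "\<dots> = K * (\<bar>r\<bar> / \<rho>) ^ n"
      unfolding \<sigma>(2) by (simp only: power_divide power_one mult.assoc times_divide_eq_left mult_1_left)
    finally show "norm (mehler_coeff q t s n * r ^ n) \<le> K * (\<bar>r\<bar> / \<rho>) ^ n" .
  qed
qed

text \<open>The products of two solutions of three-term recurrences span a four-dimensional space, hence
  they satisfy a recurrence of order four.\<close>

lemma three_term_product_recurrence:
  fixes d h k p :: "nat \<Rightarrow> real"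
  assumes hS: "\<And>n. h (Suc (Suc n)) = t * h (Suc n) - d (Suc n) * h n"
    and kS: "\<And>n. k (Suc (Suc n)) = s * k (Suc n) - d (Suc n) * k n"
    and pS: "\<And>n. p (Suc n) = d (Suc n) * p n" and p0: "p 0 \<noteq> 0" and dS: "\<And>n. d (Suc n) \<noteq> 0"
  defines "a \<equiv> \<lambda>n. h n * k n / p n"
  shows "d (n + 4) * a (n + 4) - t * s * a (n + 3) + (t\<^sup>2 + s\<^sup>2 - d (n + 2) - d (n + 3)) * a (n + 2)
     - t * s * a (n + 1) + d (n + 1) * a n = 0"
proof -
  define d1 d2 d3 d4 where "d1 = d (n + 1)" and "d2 = d (n + 2)" and "d3 = d (n + 3)" and "d4 = d (n + 4)"
  have d: "d1 \<noteq> 0" "d2 \<noteq> 0" "d3 \<noteq> 0" "d4 \<noteq> 0"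
    using dS by (simp_all add: d1_def d2_def d3_def d4_def eval_nat_numeral)
  define P where "P = p n"
  have P: "P \<noteq> 0"
    unfolding P_def by (induction n) (simp_all add: p0 pS dS)
  have p1: "p (n + 1) = d1 * P" "p (n + 2) = d2 * d1 * P" "p (n + 3) = d3 * d2 * d1 * P"
     "p (n + 4) = d4 * d3 * d2 * d1 * P"
    by (simp_all add: P_def d1_def d2_def d3_def d4_def eval_nat_numeral pS)
  define h0 h1 h2 h3 h4 where "h0 = h n" and "h1 = h (n + 1)" and "h2 = h (n + 2)" and "h3 = h (n + 3)"
    and "h4 = h (n + 4)"
  define k0 k1 k2 k3 k4 where "k0 = k n" and "k1 = k (n + 1)" and "k2 = k (n + 2)" and "k3 = k (n + 3)"
    and "k4 = k (n + 4)"
  have h: "h2 = t * h1 - d1 * h0" "h3 = t * h2 - d2 * h1" "h4 = t * h3 - d3 * h2"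
    by (simp_all add: h0_def h1_def h2_def h3_def h4_def d1_def d2_def d3_def eval_nat_numeral hS)
  have k: "k2 = s * k1 - d1 * k0" "k3 = s * k2 - d2 * k1" "k4 = s * k3 - d3 * k2"
    by (simp_all add: k0_def k1_def k2_def k3_def k4_def d1_def d2_def d3_def eval_nat_numeral kS)
  have key: "h4 * k4 - t * s * h3 * k3 + (t\<^sup>2 + s\<^sup>2 - d2 - d3) * d3 * h2 * k2
      - t * s * d3 * d2 * h1 * k1 + d1 * d1 * d2 * d3 * h0 * k0 = 0"
    unfolding h k by algebra
  have "d4 * (h4 * k4 / (d4 * d3 * d2 * d1 * P)) - t * s * (h3 * k3 / (d3 * d2 * d1 * P))
     + (t\<^sup>2 + s\<^sup>2 - d2 - d3) * (h2 * k2 / (d2 * d1 * P)) - t * s * (h1 * k1 / (d1 * P)) + d1 * (h0 * k0 / P)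
   = (h4 * k4 - t * s * h3 * k3 + (t\<^sup>2 + s\<^sup>2 - d2 - d3) * d3 * h2 * k2
      - t * s * d3 * d2 * h1 * k1 + d1 * d1 * d2 * d3 * h0 * k0) / (d3 * d2 * d1 * P)"
    using d P by (simp add: divide_simps)
  also have "\<dots> = 0"
    unfolding key by simp
  finally show ?thesis
    unfolding a_def p1
    by (fold d1_def d2_def d3_def d4_def P_def h0_def h1_def h2_def h3_def h4_def k0_def k1_def k2_def k3_def k4_def)
qed

text \<open>The order-four recurrence at n = -3, -2, -1, with terms of negative index and d 0 read
  as 0. The sequence \<open>d\<close> is abstract to serve both 1 - q^n and, at q = 1, n.\<close>

lemma three_term_product_recurrence_init:
  fixes d h k p :: "nat \<Rightarrow> real"
  assumes hS: "\<And>n. h (Suc (Suc n)) = t * h (Suc n) - d (Suc n) * h n" and h0: "h 0 = 1" "h (Suc 0) = t"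
    and kS: "\<And>n. k (Suc (Suc n)) = s * k (Suc n) - d (Suc n) * k n" and k0: "k 0 = 1" "k (Suc 0) = s"
    and pS: "\<And>n. p (Suc n) = d (Suc n) * p n" and p0: "p 0 = 1" and dS: "\<And>n. d (Suc n) \<noteq> 0"
  defines "a \<equiv> \<lambda>n. h n * k n / p n"
  shows "d 1 * a 1 - t * s * a 0 = 0"
    and "d 2 * a 2 - t * s * a 1 + (t\<^sup>2 + s\<^sup>2 - d 1) * a 0 = 0"
    and "d 3 * a 3 - t * s * a 2 + (t\<^sup>2 + s\<^sup>2 - d 1 - d 2) * a 1 - t * s * a 0 = 0"
proof -
  define d1 d2 d3 where "d1 = d 1" and "d2 = d 2" and "d3 = d 3"
  have d: "d1 \<noteq> 0" "d2 \<noteq> 0" "d3 \<noteq> 0"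
    using dS by (simp_all add: d1_def d2_def d3_def eval_nat_numeral)
  have p: "p 1 = d1" "p 2 = d2 * d1" "p 3 = d3 * d2 * d1"
    by (simp_all add: d1_def d2_def d3_def eval_nat_numeral pS p0)
  have h: "h 1 = t" "h 2 = t\<^sup>2 - d1" "h 3 = t * (t\<^sup>2 - d1) - d2 * t"
    by (simp_all add: d1_def d2_def eval_nat_numeral hS h0)
  have k: "k 1 = s" "k 2 = s\<^sup>2 - d1" "k 3 = s * (s\<^sup>2 - d1) - d2 * s"
    by (simp_all add: d1_def d2_def eval_nat_numeral kS k0)
  have a: "a 0 = 1" "a 1 = t * s / d1" "a 2 = (t\<^sup>2 - d1) * (s\<^sup>2 - d1) / (d2 * d1)"
    "a 3 = (t * (t\<^sup>2 - d1) - d2 * t) * (s * (s\<^sup>2 - d1) - d2 * s) / (d3 * d2 * d1)"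
    unfolding a_def h k p by (simp_all add: h0 k0 p0)
  show "d 1 * a 1 - t * s * a 0 = 0"
    unfolding a d1_def[symmetric] using d by simp
  show "d 2 * a 2 - t * s * a 1 + (t\<^sup>2 + s\<^sup>2 - d 1) * a 0 = 0"
    unfolding a d1_def[symmetric] d2_def[symmetric] using d by (simp add: divide_simps) algebra
  show "d 3 * a 3 - t * s * a 2 + (t\<^sup>2 + s\<^sup>2 - d 1 - d 2) * a 1 - t * s * a 0 = 0"
    unfolding a d1_def[symmetric] d2_def[symmetric] d3_def[symmetric] using d by (simp add: divide_simps) algebra
qed

lemma sums_shift_powser:
  fixes a :: "nat \<Rightarrow> real"
  assumes "(\<lambda>n. a n * r ^ n) sums F"
  shows "(\<lambda>n. (if n < k then 0 else a (n - k)) * r ^ n) sums (r ^ k * F)"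
proof -
  have "(\<lambda>n. (if n + k < k then 0 else a (n + k - k)) * r ^ (n + k)) sums (r ^ k * F)"
    using sums_mult[OF assms, of "r ^ k"] by (simp add: power_add mult_ac)
  then show ?thesis
    using sums_iff_shift[of "\<lambda>n. (if n < k then 0 else a (n - k)) * r ^ n" k "r ^ k * F"]
    by simp
qed

text \<open>In the recurrence with d n = 1 - q^n the parts free of powers of q collect to
  \<open>mehler_factor\<close> times F(r), the others to 1 - (1 + q) r^2 + q r^4 = (1 - r^2)(1 - q
  r^2) times F(q r).\<close>

lemma mehler_q_shift:
  assumes q: "\<bar>q\<bar> < 1" and "\<bar>t\<bar> \<le> 2" "\<bar>s\<bar> \<le> 2" and r: "\<bar>r\<bar> < 1"
  shows "mehler_factor t s r * mehler q t s r = (1 - r\<^sup>2) * (1 - q * r\<^sup>2) * mehler q t s (q * r)"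
proof -
  let ?a = "mehler_coeff q t s"
  \<comment> \<open>\<open>b k\<close> and \<open>c k\<close> are the coefficients of r^k F(r) and
    r^k F(q r), padded with zeros.\<close>
  define b where "b k n = (if n < k then 0 else ?a (n - k))" for k n :: nat
  define c where "c k n = (if n < k then 0 else q ^ (n - k) * ?a (n - k))" for k n :: nat
  have qr: "\<bar>q * r\<bar> < 1"
    using q r by (simp add: abs_mult) (metis abs_ge_zero abs_mult abs_mult_less mult.right_neutral)
  have b: "(\<lambda>n. b k n * r ^ n) sums (r ^ k * mehler q t s r)" for k
    unfolding b_def mehler_def using assms
    by (intro sums_shift_powser summable_sums summable_mehler)
  have "(\<lambda>n. (q ^ n * ?a n) * r ^ n) sums mehler q t s (q * r)"
    unfolding mehler_def using summable_sums[OF summable_mehler[OF assms(1-3) qr]]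
    by (simp add: power_mult_distrib mult_ac)
  then have c: "(\<lambda>n. c k n * r ^ n) sums (r ^ k * mehler q t s (q * r))" for k
    unfolding c_def using sums_shift_powser[of "\<lambda>n. q ^ n * ?a n"] by blast
  have d: "1 - q ^ Suc n \<noteq> 0" for n
    using abs_power_Suc_less_one[OF q, of n] by auto
  note rec = three_term_product_recurrence[where d = "\<lambda>n. 1 - q ^ n" and p = "qpoch q" and h = "\<lambda>n. cqH q n t"
      and k = "\<lambda>n. cqH q n s", OF cqH.simps(3) cqH.simps(3) qpoch_Suc _ d, folded mehler_coeff_def]
  note init = three_term_product_recurrence_init[where d = "\<lambda>n. 1 - q ^ n" and p = "qpoch q" and h = "\<lambda>n. cqH q n t"
      and k = "\<lambda>n. cqH q n s", OF cqH.simps(3,1,2) cqH.simps(3,1,2) qpoch_Suc qpoch_0 d, folded mehler_coeff_def]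
  have lhs: "(\<lambda>n. b 0 n * r ^ n - t * s * (b 1 n * r ^ n) + (t\<^sup>2 + s\<^sup>2 - 2) * (b 2 n * r ^ n)
      - t * s * (b 3 n * r ^ n) + b 4 n * r ^ n) sums
      (r ^ 0 * mehler q t s r - t * s * (r ^ 1 * mehler q t s r) + (t\<^sup>2 + s\<^sup>2 - 2) * (r ^ 2 * mehler q t s r)
      - t * s * (r ^ 3 * mehler q t s r) + r ^ 4 * mehler q t s r)"
    by (intro sums_add sums_diff sums_mult b)
  have rhs: "(\<lambda>n. c 0 n * r ^ n - (1 + q) * (c 2 n * r ^ n) + q * (c 4 n * r ^ n)) sums
      (r ^ 0 * mehler q t s (q * r) - (1 + q) * (r ^ 2 * mehler q t s (q * r)) + q * (r ^ 4 * mehler q t s (q * r)))"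
    by (intro sums_add sums_diff sums_mult c)
  have eq: "b 0 n - t * s * b 1 n + (t\<^sup>2 + s\<^sup>2 - 2) * b 2 n - t * s * b 3 n + b 4 n
     = c 0 n - (1 + q) * c 2 n + q * c 4 n" for n
  proof -
    consider "n = 0" | "n = 1" | "n = 2" | "n = 3" | "4 \<le> n"
      by linarith
    then show ?thesis
    proof cases
      case 1 then show ?thesis by (simp add: b_def c_def)
    next
      case 2 then show ?thesis
        using init(1) by (simp add: b_def c_def power2_eq_square algebra_simps)
    next
      case 3 then show ?thesis
        using init(2) by (simp add: b_def c_def power2_eq_square algebra_simps)
    next
      case 4 then show ?thesis
        using init(3) by (simp add: b_def c_def power2_eq_square algebra_simps)
    next
      case 5
      define m where "m = n - 4"
      have n: "n = m + 4" using 5 by (simp add: m_def)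
      have "b 0 n = ?a (m + 4)" "b 1 n = ?a (m + 3)" "b 2 n = ?a (m + 2)" "b 3 n = ?a (m + 1)" "b 4 n = ?a m"
        "c 0 n = q ^ (m + 4) * ?a (m + 4)" "c 2 n = q ^ (m + 2) * ?a (m + 2)" "c 4 n = q ^ m * ?a m"
        unfolding n b_def c_def by (simp_all add: eval_nat_numeral)
      then show ?thesis
        using rec[of m] by (simp add: eval_nat_numeral algebra_simps)
    qed
  qed
  have "(\<lambda>n. b 0 n * r ^ n - t * s * (b 1 n * r ^ n) + (t\<^sup>2 + s\<^sup>2 - 2) * (b 2 n * r ^ n)
      - t * s * (b 3 n * r ^ n) + b 4 n * r ^ n) =
     (\<lambda>n. (b 0 n - t * s * b 1 n + (t\<^sup>2 + s\<^sup>2 - 2) * b 2 n - t * s * b 3 n + b 4 n) * r ^ n)"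
    by (simp add: algebra_simps)
  also have "\<dots> = (\<lambda>n. c 0 n * r ^ n - (1 + q) * (c 2 n * r ^ n) + q * (c 4 n * r ^ n))"
    unfolding eq by (simp add: algebra_simps)
  finally have eqf: "(\<lambda>n. b 0 n * r ^ n - t * s * (b 1 n * r ^ n) + (t\<^sup>2 + s\<^sup>2 - 2) * (b 2 n * r ^ n)
      - t * s * (b 3 n * r ^ n) + b 4 n * r ^ n) =
      (\<lambda>n. c 0 n * r ^ n - (1 + q) * (c 2 n * r ^ n) + q * (c 4 n * r ^ n))" .
  have "r ^ 0 * mehler q t s r - t * s * (r ^ 1 * mehler q t s r) + (t\<^sup>2 + s\<^sup>2 - 2) * (r ^ 2 * mehler q t s r)
      - t * s * (r ^ 3 * mehler q t s r) + r ^ 4 * mehler q t s r =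
     r ^ 0 * mehler q t s (q * r) - (1 + q) * (r ^ 2 * mehler q t s (q * r)) + q * (r ^ 4 * mehler q t s (q * r))"
    by (rule sums_unique2[OF lhs[unfolded eqf] rhs])
  moreover have "r ^ 0 * M - t * s * (r ^ 1 * M) + (t\<^sup>2 + s\<^sup>2 - 2) * (r ^ 2 * M)
      - t * s * (r ^ 3 * M) + r ^ 4 * M = mehler_factor t s r * M" for M
    unfolding mehler_factor_def by algebra
  moreover have "r ^ 0 * M - (1 + q) * (r ^ 2 * M) + q * (r ^ 4 * M) = (1 - r\<^sup>2) * (1 - q * r\<^sup>2) * M" for M
    by algebra
  ultimately show ?thesis
    by simp
qed

text \<open>Passing from r q^N to r q^(N+1) releases two consecutive factors, 1 - r^2 q^(2N) and 1 -
  r^2 q^(2N+1), hence the range \<open>2 * N\<close> on the right.\<close>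

lemma mehler_iterate:
  assumes q: "\<bar>q\<bar> < 1" and "\<bar>t\<bar> \<le> 2" "\<bar>s\<bar> \<le> 2" and r: "\<bar>r\<bar> < 1"
  shows "(\<Prod>k<N. mehler_factor t s (r * q ^ k)) * mehler q t s r =
    (\<Prod>i<2 * N. 1 - r\<^sup>2 * q ^ i) * mehler q t s (r * q ^ N)"
proof (induction N)
  case (Suc N)
  have "\<bar>r * q ^ N\<bar> \<le> \<bar>r\<bar>"
    using q by (simp add: abs_mult power_abs mult_left_le power_le_one)
  then have rN: "\<bar>r * q ^ N\<bar> < 1"
    using r by linarith
  have step: "mehler_factor t s (r * q ^ N) * mehler q t s (r * q ^ N) =
     (1 - r\<^sup>2 * q ^ (2 * N)) * (1 - r\<^sup>2 * q ^ Suc (2 * N)) * mehler q t s (r * q ^ Suc N)"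
  proof -
    have 1: "(r * q ^ N)\<^sup>2 = r\<^sup>2 * q ^ (2 * N)"
      by (simp add: power_mult_distrib power_even_eq)
    have 2: "q * (r * q ^ N) = r * q ^ Suc N" and 3: "q * (r\<^sup>2 * q ^ (2 * N)) = r\<^sup>2 * q ^ Suc (2 * N)"
      by simp_all
    show ?thesis
      using mehler_q_shift[OF assms(1-3) rN] unfolding 1 2 3 .
  qed
  have "(\<Prod>k<Suc N. mehler_factor t s (r * q ^ k)) * mehler q t s r =
     (\<Prod>k<N. mehler_factor t s (r * q ^ k)) * mehler q t s r * mehler_factor t s (r * q ^ N)"
    by simp
  also have "\<dots> = (\<Prod>i<2 * N. 1 - r\<^sup>2 * q ^ i) * (mehler_factor t s (r * q ^ N) * mehler q t s (r * q ^ N))"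
    unfolding Suc by simp
  also have "\<dots> = (\<Prod>i<2 * Suc N. 1 - r\<^sup>2 * q ^ i) * mehler q t s (r * q ^ Suc N)"
    unfolding step by simp
  finally show ?case .
qed simp

lemma mehler_tendsto_0:
  assumes "\<bar>q\<bar> < 1" "\<bar>t\<bar> \<le> 2" "\<bar>s\<bar> \<le> 2" and X: "X \<longlonglongrightarrow> 0"
  shows "(\<lambda>n. mehler q t s (X n)) \<longlonglongrightarrow> 1"
proof -
  have c0: "mehler_coeff q t s 0 = 1"
    by (simp add: mehler_coeff_def)
  have "(mehler q t s \<longlongrightarrow> mehler_coeff q t s 0) (at 0)"
    using assms by (intro powser_limit_0[of 1]) (auto simp: mehler_def intro!: summable_sums summable_mehler)
  moreover have "mehler q t s 0 = 1"
    using powser_zero[of "mehler_coeff q t s"] by (simp add: mehler_def c0)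
  ultimately have "isCont (mehler q t s) 0"
    by (simp add: isCont_def c0)
  then show ?thesis
    using isCont_tendsto_compose[OF _ X, of "mehler q t s"] \<open>mehler q t s 0 = 1\<close> by simp
qed

text \<open>As F(r q^N) tends to F(0) = 1, the iterated equation has the nonzero limit
  \<open>q_pochhammer_inf\<close>. So F(r) cannot vanish, and neither can any factor, since a zero
  factor would make all later partial products 0.\<close>

theorem q_Mehler:
  assumes q: "\<bar>q\<bar> < 1" and ts: "\<bar>t\<bar> \<le> 2" "\<bar>s\<bar> \<le> 2" and r: "\<bar>r\<bar> < 1"
  shows "mehler q t s r \<noteq> 0"
    and "(\<lambda>N. \<Prod>k<N. mehler_factor t s (r * q ^ k)) \<longlonglongrightarrow> q_pochhammer_inf (r\<^sup>2) q / mehler q t s r"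
    and "mehler_factor t s (r * q ^ k) \<noteq> 0"
proof -
  have r2: "\<bar>r\<^sup>2\<bar> < 1"
    using r by (simp add: abs_square_less_1)
  have lim: "(\<lambda>N. (\<Prod>k<N. mehler_factor t s (r * q ^ k)) * mehler q t s r) \<longlonglongrightarrow> q_pochhammer_inf (r\<^sup>2) q * 1"
    unfolding mehler_iterate[OF assms]
  proof (intro tendsto_mult mehler_tendsto_0 assms)
    show "(\<lambda>N. \<Prod>i<2 * N. 1 - r\<^sup>2 * q ^ i) \<longlonglongrightarrow> q_pochhammer_inf (r\<^sup>2) q"
      using LIMSEQ_subseq_LIMSEQ[OF q_pochhammer_tendsto(1)[OF q r2], of "\<lambda>N. 2 * N"]
      by (simp add: strict_mono_def o_def)
    show "(\<lambda>N. r * q ^ N) \<longlonglongrightarrow> 0"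
      using q by (intro tendsto_mult_right_zero LIMSEQ_power_zero) simp
  qed
  have nz: "q_pochhammer_inf (r\<^sup>2) q \<noteq> 0"
    using q_pochhammer_tendsto(2)[OF q r2] .
  show F: "mehler q t s r \<noteq> 0"
    using lim nz LIMSEQ_unique[OF lim, of 0] by auto
  show lim': "(\<lambda>N. \<Prod>k<N. mehler_factor t s (r * q ^ k)) \<longlonglongrightarrow> q_pochhammer_inf (r\<^sup>2) q / mehler q t s r"
    using tendsto_divide[OF lim tendsto_const F] F by simp
  show "mehler_factor t s (r * q ^ k) \<noteq> 0"
  proof
    assume "mehler_factor t s (r * q ^ k) = 0"
    then have "(\<Prod>k<N. mehler_factor t s (r * q ^ k)) = 0" if "N > k" for N
      using that by (intro prod_zero) auto
    then have "(\<lambda>N. \<Prod>k<N. mehler_factor t s (r * q ^ k)) \<longlonglongrightarrow> 0"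
      by (intro tendsto_eventually eventually_mono[OF eventually_gt_at_top[of k]]) auto
    then show False
      using LIMSEQ_unique[OF lim'] nz F by force
  qed
qed

text \<open>By the product formula |F| is a fixed positive number over the modulus of an infinite
  product that is bounded above uniformly in t and s. This permits the later division by F(y, z,
  \<rho>1 \<rho>2).\<close>

lemma mehler_lower_bound:
  assumes q: "\<bar>q\<bar> < 1" and r: "\<bar>r\<bar> < 1"
  obtains c where "0 < c" and "\<And>t s. \<bar>t\<bar> \<le> 2 \<Longrightarrow> \<bar>s\<bar> \<le> 2 \<Longrightarrow> c \<le> \<bar>mehler q t s r\<bar>"
proof -
  \<comment> \<open>Each factor is at most 1 + 16 u with u = |r q^k| \<le> |q|^k; 19 leaves room.
    The exponents of the bounds sum to a geometric series.\<close>
  define B where "B = exp (19 * (1 / (1 - \<bar>q\<bar>)))"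
  have B: "B > 0" by (simp add: B_def)
  let ?L = "\<bar>q_pochhammer_inf (r\<^sup>2) q\<bar>"
  have r2: "\<bar>r\<^sup>2\<bar> < 1"
    using r by (simp add: abs_square_less_1)
  have L: "?L > 0"
    using q_pochhammer_tendsto(2)[OF q r2] by simp
  have "?L / B \<le> \<bar>mehler q t s r\<bar>" if ts: "\<bar>t\<bar> \<le> 2" "\<bar>s\<bar> \<le> 2" for t s
  proof -
    have fac: "\<bar>mehler_factor t s (r * q ^ k)\<bar> \<le> exp (19 * \<bar>q\<bar> ^ k)" for k
    proof -
      define u where "u = \<bar>r * q ^ k\<bar>"
      have u: "0 \<le> u" "u \<le> \<bar>q\<bar> ^ k" "u \<le> 1"
      proof -
        show "u \<le> \<bar>q\<bar> ^ k"
          using r by (simp add: u_def abs_mult power_abs mult_left_le_one_le)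
        also have "\<dots> \<le> 1" using q by (simp add: power_le_one)
        finally show "u \<le> 1" .
      qed (simp add: u_def)
      have u2: "u\<^sup>2 \<le> u"
        using u by (simp add: power2_eq_square mult_left_le)
      have u22: "(1 - u\<^sup>2)\<^sup>2 \<le> 1"
        using u u2 by (simp add: power_le_one)
      have tsb: "\<bar>t * s\<bar> \<le> 4" "t\<^sup>2 \<le> 4" "s\<^sup>2 \<le> 4"
        using mult_mono[OF ts] power_mono[OF ts(1), of 2] power_mono[OF ts(2), of 2] by (auto simp: abs_mult)
      have "\<bar>mehler_factor t s (r * q ^ k)\<bar> \<le> (1 - u\<^sup>2)\<^sup>2 + u * (1 + u\<^sup>2) * \<bar>t * s\<bar> + u\<^sup>2 * (t\<^sup>2 + s\<^sup>2)"
      proof -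
        have *: "(r * q ^ k)\<^sup>2 = u\<^sup>2" by (simp add: u_def)
        have "\<bar>r * q ^ k * (1 + u\<^sup>2) * (t * s)\<bar> = u * (1 + u\<^sup>2) * \<bar>t * s\<bar>"
          by (simp add: u_def abs_mult)
        then show ?thesis
          unfolding mehler_factor_def * 
          using zero_le_power2[of "1 - u\<^sup>2"] mult_nonneg_nonneg[OF zero_le_power2 add_nonneg_nonneg[OF zero_le_power2 zero_le_power2], of u t s]
          by linarith
      qed
      also have "\<dots> \<le> 1 + u * 2 * 4 + u * (4 + 4)"
        using u u2 u22 tsb by (intro add_mono mult_mono) auto
      also have "\<dots> \<le> 1 + 19 * \<bar>q\<bar> ^ k"
        using u by simp
      also have "\<dots> \<le> exp (19 * \<bar>q\<bar> ^ k)"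
        by (rule exp_ge_add_one_self)
      finally show ?thesis .
    qed
    have "\<bar>\<Prod>k<N. mehler_factor t s (r * q ^ k)\<bar> \<le> B" for N
    proof -
      have "\<bar>\<Prod>k<N. mehler_factor t s (r * q ^ k)\<bar> \<le> (\<Prod>k<N. exp (19 * \<bar>q\<bar> ^ k))"
        unfolding abs_prod using fac by (intro prod_mono) auto
      also have "\<dots> = exp (19 * (\<Sum>k<N. \<bar>q\<bar> ^ k))"
        by (simp add: exp_sum sum_distrib_left)
      also have "(\<Sum>k<N. \<bar>q\<bar> ^ k) \<le> 1 / (1 - \<bar>q\<bar>)"
        using sum_le_suminf[of "\<lambda>k. \<bar>q\<bar> ^ k" "{..<N}"] q by (simp add: suminf_geometric summable_geometric)
      finally show ?thesis
        unfolding B_def by simp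
    qed
    then have "\<bar>q_pochhammer_inf (r\<^sup>2) q / mehler q t s r\<bar> \<le> B"
      using q_Mehler(2)[OF q ts r] by (intro Lim_bounded[OF tendsto_rabs]) auto
    then show ?thesis
      using q_Mehler(1)[OF q ts r] B by (simp add: field_simps)
  qed
  then show thesis
    using that[of "?L / B"] L B by simp
qed

section \<open>A finite form of the Jacobi triple product\<close>

text \<open>The coefficients (-1)^j q^(j (j - 1) / 2) of Jacobi's theta series for all integers j;
  the exponent is never negative, so \<open>nat\<close> loses nothing.\<close>

definition theta_coeff :: "real \<Rightarrow> int \<Rightarrow> real" where
  "theta_coeff q j = (- 1) ^ nat \<bar>j\<bar> * q ^ nat (j * (j - 1) div 2)"

lemma theta_coeff_0 [simp]: "theta_coeff q 0 = 1"
  by (simp add: theta_coeff_def)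

lemma theta_coeff_1 [simp]: "theta_coeff q 1 = - 1"
  by (simp add: theta_coeff_def)

lemma theta_coeff_add_one:
  assumes "0 \<le> j"
  shows "theta_coeff q (j + 1) = - (q ^ nat j * theta_coeff q j)"
proof -
  have "(j + 1) * (j + 1 - 1) div 2 = j + j * (j - 1) div 2"
  proof -
    have "(j + 1) * (j + 1 - 1) = j * 2 + j * (j - 1)" by (simp add: algebra_simps)
    then show ?thesis by simp
  qed
  moreover have "0 \<le> j * (j - 1) div 2"
    using assms by (cases "j = 0") auto
  ultimately have e: "nat ((j + 1) * (j + 1 - 1) div 2) = nat j + nat (j * (j - 1) div 2)"
    using assms by (simp add: nat_add_distrib)
  have a: "nat \<bar>j + 1\<bar> = Suc (nat \<bar>j\<bar>)"
    using assms by simp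
  show ?thesis
    unfolding theta_coeff_def e a by (simp add: power_add)
qed

text \<open>The exponent is invariant under the reflection while the parity of j changes; this
  reduces indices j \<le> 0 to positive ones.\<close>

lemma theta_coeff_reflect: "theta_coeff q (1 - j) = - theta_coeff q j"
proof -
  have "(1 - j) * (1 - j - 1) = j * (j - 1)"
    by (simp add: algebra_simps)
  moreover have "(- 1 :: real) ^ nat \<bar>1 - j\<bar> = - ((- 1) ^ nat \<bar>j\<bar>)"
    by (cases "even j") (auto simp: minus_one_power_iff even_nat_iff)
  ultimately show ?thesis
    by (simp add: theta_coeff_def)
qed

lemma theta_coeff_nonpos:
  assumes "j \<le> 0"
  shows "theta_coeff q j = - (q ^ nat (- j) * theta_coeff q (j + 1))"
  using theta_coeff_add_one[of "- j" q] theta_coeff_reflect[of q j] theta_coeff_reflect[of q "j + 1"] assms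
  by (simp add: algebra_simps)

lemma power_theta_coeff:
  assumes "0 \<le> s" and "j + s \<ge> 0"
  shows "q ^ nat (j + s) * theta_coeff q j = - (q ^ nat s * theta_coeff q (j + 1))"
proof (cases "0 \<le> j")
  case True
  then show ?thesis
    using assms by (simp add: theta_coeff_add_one nat_add_distrib power_add)
next
  case False
  then have "nat s = nat (j + s) + nat (- j)"
    using assms by simp
  moreover have "theta_coeff q j = - (q ^ nat (- j) * theta_coeff q (j + 1))"
    using False by (intro theta_coeff_nonpos) simp
  ultimately show ?thesis
    by (simp add: power_add)
qed

text \<open>The convention 1 / (q; q)_j = 0 for j < 0 makes the step rule below valid for every
  integer and lets summation ranges be enlarged freely.\<close>

definition inv_qpoch :: "real \<Rightarrow> int \<Rightarrow> real" where
  "inv_qpoch q j = (if j < 0 then 0 else 1 / qpoch q (nat j))"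

lemma inv_qpoch_diff_one:
  assumes "\<bar>q\<bar> < 1"
  shows "inv_qpoch q (j - 1) = (1 - q ^ nat j) * inv_qpoch q j"
proof (cases "j \<ge> 1")
  case True
  then have j: "nat j = Suc (nat (j - 1))" by simp
  have "1 - q ^ Suc (nat (j - 1)) \<noteq> 0"
    using abs_power_Suc_less_one[OF assms, of "nat (j - 1)"] by auto
  then show ?thesis
    using True unfolding inv_qpoch_def j by (simp add: qpoch_Suc del: power_Suc)
next
  case False
  then show ?thesis by (auto simp: inv_qpoch_def)
qed

text \<open>Up to the factor (q; q)_n, a sign and a power of q, this is the sum that the q-binomial
  theorem evaluates to (z; q)_n at z = q^(-s); the normalisation keeps all exponents
  nonnegative.\<close>

definition theta_binomial_sum :: "real \<Rightarrow> nat \<Rightarrow> int \<Rightarrow> real" where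
  "theta_binomial_sum q n s = (\<Sum>k\<le>n. inv_qpoch q (int k) * inv_qpoch q (int n - int k) * theta_coeff q (int k - s))"

text \<open>The q-Pascal splitting 1 - q^(n+1) = q^k (1 - q^(n+1-k)) + (1 - q^k): each summand
  lowers one of the two factorials. After an index shift both sums have the same terms, with weights
  -q^s and 1.\<close>

lemma theta_binomial_sum_Suc:
  assumes q: "\<bar>q\<bar> < 1" and s: "0 \<le> s"
  shows "(1 - q ^ Suc n) * theta_binomial_sum q (Suc n) s = (1 - q ^ nat s) * theta_binomial_sum q n (s - 1)"
proof -
  let ?a = "\<lambda>k. inv_qpoch q (int k)" and ?b = "\<lambda>n k. inv_qpoch q (int n - int k)" and ?t = "theta_coeff q"
  have a: "(1 - q ^ k) * ?a k = inv_qpoch q (int k - 1)" for k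
    using inv_qpoch_diff_one[OF q, of "int k"] by simp
  have b: "(1 - q ^ (Suc n - k)) * ?b (Suc n) k = ?b n k" if "k \<le> Suc n" for k
  proof -
    have "nat (int (Suc n) - int k) = Suc n - k" by simp
    then show ?thesis
      using inv_qpoch_diff_one[OF q, of "int (Suc n) - int k"] by (simp add: algebra_simps)
  qed
  have "(1 - q ^ Suc n) * theta_binomial_sum q (Suc n) s =
     (\<Sum>k\<le>Suc n. q ^ k * ?a k * ?b n k * ?t (int k - s) + inv_qpoch q (int k - 1) * ?b (Suc n) k * ?t (int k - s))"
    unfolding theta_binomial_sum_def sum_distrib_left
  proof (rule sum.cong)
    fix k assume "k \<in> {..Suc n}"
    then have k: "k \<le> Suc n" by simp
    then have "q ^ Suc n = q ^ k * q ^ (Suc n - k)"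
      by (simp flip: power_add)
    then have e: "1 - q ^ Suc n = q ^ k * (1 - q ^ (Suc n - k)) + (1 - q ^ k)"
      by (simp add: algebra_simps)
    show "(1 - q ^ Suc n) * (?a k * ?b (Suc n) k * ?t (int k - s)) =
       q ^ k * ?a k * ?b n k * ?t (int k - s) + inv_qpoch q (int k - 1) * ?b (Suc n) k * ?t (int k - s)"
      unfolding e b[OF k, symmetric] a[symmetric] by (simp only: algebra_simps)
  qed simp
  also have "\<dots> = (\<Sum>k\<le>Suc n. q ^ k * ?a k * ?b n k * ?t (int k - s))
      + (\<Sum>k\<le>Suc n. inv_qpoch q (int k - 1) * ?b (Suc n) k * ?t (int k - s))"
    by (rule sum.distrib)
  also have "(\<Sum>k\<le>Suc n. q ^ k * ?a k * ?b n k * ?t (int k - s)) = (\<Sum>k\<le>n. ?a k * ?b n k * (q ^ k * ?t (int k - s)))"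
    by (simp add: inv_qpoch_def mult_ac)
  also have "(\<Sum>k\<le>Suc n. inv_qpoch q (int k - 1) * ?b (Suc n) k * ?t (int k - s))
     = (\<Sum>k\<le>n. ?a k * ?b n k * ?t (int k - s + 1))"
    by (subst sum.atMost_Suc_shift) (simp add: inv_qpoch_def algebra_simps)
  also have "(\<Sum>k\<le>n. ?a k * ?b n k * (q ^ k * ?t (int k - s))) = (\<Sum>k\<le>n. ?a k * ?b n k * (- (q ^ nat s * ?t (int k - s + 1))))"
    using power_theta_coeff[OF s, of "int _ - s"] by simp
  also have "\<dots> + (\<Sum>k\<le>n. ?a k * ?b n k * ?t (int k - s + 1)) = (1 - q ^ nat s) * theta_binomial_sum q n (s - 1)"
    unfolding theta_binomial_sum_def sum_distrib_left sum.distrib[symmetric]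
    by (rule sum.cong) (simp_all add: algebra_simps)
  finally show ?thesis .
qed

text \<open>(q^(-s); q)_n contains the factor 1 - q^0 when 0 \<le> s < n. In the induction this is
  the factor 1 - q^s at s = 0; for s > 0 the pair (n, s - 1) is again admissible.\<close>

lemma theta_binomial_sum_eq_0:
  assumes q: "\<bar>q\<bar> < 1" and "0 \<le> s" and "s < int n"
  shows "theta_binomial_sum q n s = 0"
  using assms(2,3)
proof (induction n arbitrary: s)
  case (Suc n)
  have "1 - q ^ Suc n \<noteq> 0"
    using abs_power_Suc_less_one[OF q, of n] by auto
  moreover have "(1 - q ^ nat s) * theta_binomial_sum q n (s - 1) = 0"
    using Suc by (cases "s = 0") auto
  ultimately show ?case
    using theta_binomial_sum_Suc[OF q Suc.prems(1), of n] by (metis mult_eq_0_iff)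
qed simp

text \<open>Theta coefficient times the q-binomial coefficient of 2 N over N + j; it is 0 for |j| >
  N.\<close>

definition jacobi_coeff :: "real \<Rightarrow> nat \<Rightarrow> int \<Rightarrow> real" where
  "jacobi_coeff q N j = theta_coeff q j * qpoch q (2 * N) * inv_qpoch q (int N + j) * inv_qpoch q (int N - j)"

text \<open>Coefficient of u^j after multiplication by the next pair of factors, 1 + q^(2N+1) - q^N
  u - q^(N+1) / u. The ends |j| = N + 1 are separate because N + j or N - j is negative
  there.\<close>

lemma jacobi_coeff_Suc:
  assumes q: "\<bar>q\<bar> < 1"
  shows "jacobi_coeff q (Suc N) j =
    (1 + q ^ Suc (2 * N)) * jacobi_coeff q N j - q ^ N * jacobi_coeff q N (j - 1) - q ^ Suc N * jacobi_coeff q N (j + 1)"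
proof -
  let ?a = "inv_qpoch q" and ?t = "theta_coeff q" and ?i = "int N + j" and ?l = "int N - j"
  have aD: "?a (m - 1) = (1 - q ^ nat m) * ?a m" for m
    by (rule inv_qpoch_diff_one[OF q])
  have ends: "?a (int m) = 1 / qpoch q m" for m
    by (simp add: inv_qpoch_def)
  have nz: "qpoch q m \<noteq> 0" for m
    using qpoch_pos[OF q, of m] by simp
  consider "j < - int N - 1 \<or> int N + 1 < j" | "j = - int N - 1" | "j = int N + 1" | "- int N \<le> j" "j \<le> int N"
    by linarith
  then show ?thesis
  proof cases
    case 1
    then show ?thesis by (auto simp: jacobi_coeff_def inv_qpoch_def)
  next
    case 2
    have t: "q ^ Suc N * ?t (j + 1) = - ?t j"
      using power_theta_coeff[of "int N + 1" j q] 2 by (simp add: nat_add_distrib)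
    have "jacobi_coeff q (Suc N) j = ?t j" 
      unfolding jacobi_coeff_def 2 using nz ends[of "2 * Suc N"] by (simp add: inv_qpoch_def nat_add_distrib)
    moreover have "jacobi_coeff q N (j + 1) = ?t (j + 1)"
      unfolding jacobi_coeff_def 2 using nz ends[of "2 * N"] by (simp add: inv_qpoch_def)
    moreover have "jacobi_coeff q N j = 0" "jacobi_coeff q N (j - 1) = 0"
      unfolding jacobi_coeff_def 2 by (simp_all add: inv_qpoch_def)
    ultimately show ?thesis using t by simp
  next
    case 3
    have t: "?t j = - (q ^ N * ?t (j - 1))"
      using theta_coeff_add_one[of "j - 1" q] 3 by simp
    have "jacobi_coeff q (Suc N) j = ?t j" 
      unfolding jacobi_coeff_def 3 using nz by (simp add: inv_qpoch_def nat_add_distrib nat_mult_distrib)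
    moreover have "jacobi_coeff q N (j - 1) = ?t (j - 1)"
      unfolding jacobi_coeff_def 3 using nz by (simp add: inv_qpoch_def nat_mult_distrib)
    moreover have "jacobi_coeff q N j = 0" "jacobi_coeff q N (j + 1) = 0"
      unfolding jacobi_coeff_def 3 by (simp_all add: inv_qpoch_def)
    ultimately show ?thesis using t by simp
  next
    case 4
    \<comment> \<open>In the interior every term is a multiple of the same \<open>A * B\<close>, and
      the claim becomes a polynomial identity in q, x = q^(N+j) and y = q^(N-j).\<close>
    define x y where "x = q ^ nat ?i" and "y = q ^ nat ?l"
    have xy: "x * y = q ^ (2 * N)"
      unfolding x_def y_def power_add[symmetric] using 4 by (intro arg_cong[of _ _ "(^) q"]) linarith
    have xS: "q ^ nat (?i + 1) = q * x" "q ^ nat (?l + 1) = q * y"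
      unfolding x_def y_def using 4 by (simp_all add: nat_add_distrib)
    define A B where "A = ?a (?i + 1)" and "B = ?a (?l + 1)"
    have A: "?a ?i = (1 - q * x) * A" "?a (?i - 1) = (1 - x) * (1 - q * x) * A"
      using aD[of "?i + 1"] aD[of ?i] by (simp_all add: A_def xS x_def)
    have B: "?a ?l = (1 - q * y) * B" "?a (?l - 1) = (1 - y) * (1 - q * y) * B"
      using aD[of "?l + 1"] aD[of ?l] by (simp_all add: B_def xS y_def)
    have t1: "q ^ Suc N * ?t (j + 1) = - (q * x * ?t j)"
    proof -
      have e: "j + (int N + 1) = ?i + 1" "nat (int N + 1) = Suc N" by simp_all
      have "q ^ nat (j + (int N + 1)) * ?t j = - (q ^ nat (int N + 1) * ?t (j + 1))"
        using 4 by (intro power_theta_coeff) auto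
      then show ?thesis
        unfolding e xS(1) by linarith
    qed
    have t2: "q ^ N * ?t (j - 1) = - (q * y * ?t j)"
    proof -
      have "0 \<le> int N + 1 - j" using 4 by simp
      have "?t (j - 1) = - ?t (2 - j)" "?t j = - ?t (1 - j)"
        using theta_coeff_reflect[of q "j - 1"] theta_coeff_reflect[of q j] by simp_all
      moreover have "q ^ nat (1 - j + int N) * ?t (1 - j) = - (q ^ nat (int N) * ?t (1 - j + 1))"
        using 4 by (intro power_theta_coeff) auto
      moreover have "1 - j + int N = ?l + 1" by simp
      ultimately show ?thesis
        using xS(2) by simp
    qed
    have e: "jacobi_coeff q (Suc N) j = ?t j * qpoch q (2 * N) * ((1 - q * (x * y)) * (1 - q\<^sup>2 * (x * y))) * A * B"
      unfolding jacobi_coeff_def A_def B_def xy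
      by (simp add: qpoch_Suc power2_eq_square algebra_simps)
    have e0: "jacobi_coeff q N j = ?t j * qpoch q (2 * N) * ((1 - q * x) * A) * ((1 - q * y) * B)"
      unfolding jacobi_coeff_def A(1) B(1) ..
    have ix: "int N + (j - 1) = ?i - 1" "int N - (j - 1) = ?l + 1" "int N + (j + 1) = ?i + 1" "int N - (j + 1) = ?l - 1"
      by simp_all
    have e1: "q ^ N * jacobi_coeff q N (j - 1) = - (q * y * ?t j) * qpoch q (2 * N) * ((1 - x) * (1 - q * x) * A) * B"
      unfolding jacobi_coeff_def ix A(2) B_def[symmetric] t2[symmetric] by (simp only: mult_ac)
    have e2: "q ^ Suc N * jacobi_coeff q N (j + 1) = - (q * x * ?t j) * qpoch q (2 * N) * A * ((1 - y) * (1 - q * y) * B)"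
      unfolding jacobi_coeff_def ix B(2) A_def[symmetric] t1[symmetric] by (simp only: mult_ac)
    have qq: "q ^ Suc (2 * N) = q * (x * y)"
      by (simp add: xy)
    show ?thesis
      unfolding e e0 e1 e2 qq by algebra
  qed
qed

text \<open>The finite form keeps both sides Laurent polynomials in u, so the Fourier coefficients
  of the partial weights are finite sums and the limit is taken only after integration.\<close>

lemma finite_Jacobi_triple_product:
  fixes u :: complex
  assumes q: "\<bar>q\<bar> < 1" and u: "u \<noteq> 0"
  shows "(\<Prod>k<N. (1 - of_real q ^ k * u) * (1 - of_real q ^ Suc k / u)) =
    (\<Sum>j=- int N..int N. of_real (jacobi_coeff q N j) * u powi j)"
proof (induction N)
  case 0
  then show ?case by (simp add: jacobi_coeff_def inv_qpoch_def)
next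
  case (Suc N)
  let ?p = "\<lambda>j. of_real (jacobi_coeff q N j) :: complex" and ?I = "{- int N..int N}" and ?J = "{- int (Suc N)..int (Suc N)}"
  have z: "jacobi_coeff q N j = 0" if "j \<notin> ?I" for j
    using that by (auto simp: jacobi_coeff_def inv_qpoch_def)
  have s0: "(\<Sum>j\<in>?I. ?p j * u powi j) = (\<Sum>j\<in>?J. ?p j * u powi j)"
    using z by (intro sum.mono_neutral_left) auto
  have s1: "(\<Sum>j\<in>?I. ?p j * u powi j) * u = (\<Sum>j\<in>?J. ?p (j - 1) * u powi j)"
  proof -
    have "(\<Sum>j\<in>?I. ?p j * u powi j) * u = (\<Sum>j\<in>{- int N + 1..int N + 1}. ?p (j - 1) * u powi j)"
      unfolding sum_distrib_right
      by (rule sum.reindex_bij_witness[of _ "\<lambda>j. j - 1" "\<lambda>j. j + 1"]) (auto simp: power_int_add u)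
    also have "\<dots> = (\<Sum>j\<in>?J. ?p (j - 1) * u powi j)"
      using z by (intro sum.mono_neutral_left) auto
    finally show ?thesis .
  qed
  have s2: "(\<Sum>j\<in>?I. ?p j * u powi j) / u = (\<Sum>j\<in>?J. ?p (j + 1) * u powi j)"
  proof -
    have "(\<Sum>j\<in>?I. ?p j * u powi j) / u = (\<Sum>j\<in>{- int N - 1..int N - 1}. ?p (j + 1) * u powi j)"
      unfolding sum_divide_distrib
      by (rule sum.reindex_bij_witness[of _ "\<lambda>j. j + 1" "\<lambda>j. j - 1"]) (auto simp: power_int_diff u)
    also have "\<dots> = (\<Sum>j\<in>?J. ?p (j + 1) * u powi j)"
      using z by (intro sum.mono_neutral_left) auto
    finally show ?thesis .
  qed
  have f: "(1 - of_real q ^ N * u) * (1 - of_real q ^ Suc N / u) =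
     (1 + of_real q ^ Suc (2 * N)) - of_real q ^ N * u - of_real q ^ Suc N / u"
    using u by (simp add: field_simps mult_2_right power_add)
  have "(\<Prod>k<Suc N. (1 - of_real q ^ k * u) * (1 - of_real q ^ Suc k / u)) =
     (\<Sum>j\<in>?I. ?p j * u powi j) * ((1 + of_real q ^ Suc (2 * N)) - of_real q ^ N * u - of_real q ^ Suc N / u)"
    unfolding f[symmetric] Suc[symmetric] by simp
  also have "\<dots> = (1 + of_real q ^ Suc (2 * N)) * (\<Sum>j\<in>?I. ?p j * u powi j)
      - of_real q ^ N * ((\<Sum>j\<in>?I. ?p j * u powi j) * u) - of_real q ^ Suc N * ((\<Sum>j\<in>?I. ?p j * u powi j) / u)"
    by (simp add: algebra_simps)
  also have "\<dots> = (\<Sum>j\<in>?J. of_real (jacobi_coeff q (Suc N) j) * u powi j)"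
    unfolding s1 s2 unfolding s0 sum_distrib_left sum_subtractf[symmetric]
    by (rule sum.cong) (simp_all add: jacobi_coeff_Suc[OF q, of N] algebra_simps)
  finally show ?case .
qed

text \<open>The q-binomial coefficient tends to the reciprocal of the infinite product (q; q), which
  the factor \<open>qpoch q N\<close> cancels.\<close>

lemma jacobi_coeff_tendsto:
  assumes q: "\<bar>q\<bar> < 1"
  shows "(\<lambda>N. qpoch q N * jacobi_coeff q N j) \<longlonglongrightarrow> theta_coeff q j"
proof -
  let ?L = "q_pochhammer_inf q q"
  have L: "?L \<noteq> 0" "qpoch q \<longlonglongrightarrow> ?L"
    using q_pochhammer_tendsto(2)[OF q q] qpoch_tendsto[OF q] by auto
  have a: "(\<lambda>N. inv_qpoch q (int N + m)) \<longlonglongrightarrow> 1 / ?L" for m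
  proof -
    have *: "filterlim (\<lambda>N. nat (int N + m)) sequentially sequentially"
      unfolding filterlim_at_top
    proof
      fix Z
      show "eventually (\<lambda>N. Z \<le> nat (int N + m)) sequentially"
        by (rule eventually_sequentiallyI[of "Z + nat \<bar>m\<bar>"]) linarith
    qed
    have "(\<lambda>N. 1 / qpoch q (nat (int N + m))) \<longlonglongrightarrow> 1 / ?L"
      using L filterlim_compose[OF L(2) *] by (intro tendsto_divide) auto
    then show ?thesis
      by (rule Lim_transform_eventually)
         (auto simp: inv_qpoch_def intro!: eventually_sequentiallyI[of "nat \<bar>m\<bar>"])
  qed
  have q2: "(\<lambda>N. qpoch q (2 * N)) \<longlonglongrightarrow> ?L"
    using LIMSEQ_subseq_LIMSEQ[OF L(2), of "\<lambda>N. 2 * N"] by (simp add: strict_mono_def o_def)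
  have "(\<lambda>N. qpoch q N * (theta_coeff q j * qpoch q (2 * N) * inv_qpoch q (int N + j) * inv_qpoch q (int N + (- j))))
      \<longlonglongrightarrow> ?L * (theta_coeff q j * ?L * (1 / ?L) * (1 / ?L))"
    by (intro tendsto_mult tendsto_const a q2 L)
  then show ?thesis
    using L(1) by (simp add: jacobi_coeff_def)
qed

section \<open>Orthogonality of the q-Hermite polynomials\<close>

definition weight_factor :: "real \<Rightarrow> real \<Rightarrow> nat \<Rightarrow> real" where
  "weight_factor q t k = (1 + q ^ k)\<^sup>2 - t\<^sup>2 * q ^ k"

text \<open>The product starts at index 1: the factor of index 0 is 4 - t^2, which vanishes at the
  endpoints and is treated apart, while the others are positive on [-2, 2].\<close>

definition weight_prod :: "real \<Rightarrow> real \<Rightarrow> real" where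
  "weight_prod q t = (\<Prod>k. weight_factor q t (Suc k))"

lemma weight_factor_minus_one_le:
  assumes "\<bar>q\<bar> < 1" and "\<bar>t\<bar> \<le> 2"
  shows "\<bar>weight_factor q t k - 1\<bar> \<le> 7 * \<bar>q\<bar> ^ k"
proof -
  define x where "x = q ^ k"
  have x: "\<bar>x\<bar> = \<bar>q\<bar> ^ k" "\<bar>x\<bar> \<le> 1"
    using assms by (simp_all add: x_def power_abs power_le_one)
  have t: "t\<^sup>2 \<le> 4"
    using power_mono[OF assms(2), of 2] by simp
  have "weight_factor q t k - 1 = x * (2 + x - t\<^sup>2)"
    by (simp add: weight_factor_def x_def power2_eq_square algebra_simps)
  also have "\<bar>\<dots>\<bar> = \<bar>x\<bar> * \<bar>2 + x - t\<^sup>2\<bar>"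
    by (rule abs_mult)
  also have "\<dots> \<le> \<bar>x\<bar> * 7"
  proof (rule mult_left_mono)
    show "\<bar>2 + x - t\<^sup>2\<bar> \<le> 7"
      using x(2) t zero_le_power2[of t] by linarith
  qed simp
  finally show ?thesis
    by (simp add: x(1))
qed

text \<open>With x = q^(k+1) the value is at least (1 - x)^2 for x \<ge> 0 and at least (1 + x)^2
  for x < 0; both signs occur, as q may be negative.\<close>

lemma weight_factor_pos:
  assumes "\<bar>q\<bar> < 1" and "\<bar>t\<bar> \<le> 2"
  shows "0 < weight_factor q t (Suc k)"
proof -
  define x where "x = q ^ Suc k"
  have x: "\<bar>x\<bar> < 1"
    using abs_power_Suc_less_one[OF assms(1), of k] by (simp add: x_def)
  have t: "t\<^sup>2 \<le> 4"
    using power_mono[OF assms(2), of 2] by simp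
  have "0 < (1 + x)\<^sup>2 - t\<^sup>2 * x"
  proof (cases "0 \<le> x")
    case True
    have "(1 + x)\<^sup>2 - t\<^sup>2 * x \<ge> (1 + x)\<^sup>2 - 4 * x"
      using mult_right_mono[OF t True] by simp
    moreover have "(1 + x)\<^sup>2 - 4 * x = (1 - x)\<^sup>2"
      by (simp add: power2_eq_square algebra_simps)
    moreover have "0 < (1 - x)\<^sup>2"
      using x by (intro zero_less_power) auto
    ultimately show ?thesis by linarith
  next
    case False
    then have "t\<^sup>2 * x \<le> 0"
      by (simp add: mult_nonneg_nonpos)
    moreover have "0 < (1 + x)\<^sup>2"
      using x by (intro zero_less_power) auto
    ultimately show ?thesis by linarith
  qed
  then show ?thesis
    by (simp only: weight_factor_def x_def)
qed

lemma weight_prod_tendsto: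
  assumes "\<bar>q\<bar> < 1" and "\<bar>t\<bar> \<le> 2"
  shows "(\<lambda>N. \<Prod>k<N. weight_factor q t (Suc k)) \<longlonglongrightarrow> weight_prod q t" and "weight_prod q t \<noteq> 0"
proof -
  have nz: "weight_factor q t (Suc k) \<noteq> 0" for k
    using weight_factor_pos[OF assms, of k] by simp
  have sm: "summable (\<lambda>k. \<bar>weight_factor q t (Suc k) - 1\<bar>)"
  proof (rule summable_comparison_test')
    show "summable (\<lambda>k. 7 * \<bar>q\<bar> * \<bar>q\<bar> ^ k)"
      using assms by (intro summable_mult summable_geometric) simp
    show "norm \<bar>weight_factor q t (Suc k) - 1\<bar> \<le> 7 * \<bar>q\<bar> * \<bar>q\<bar> ^ k" for k
      using weight_factor_minus_one_le[OF assms, of "Suc k"] by (simp add: mult.assoc)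
  qed
  show "(\<lambda>N. \<Prod>k<N. weight_factor q t (Suc k)) \<longlonglongrightarrow> weight_prod q t" "weight_prod q t \<noteq> 0"
    unfolding weight_prod_def by (rule prod_tendsto_prodinf[OF nz sm])+
qed

text \<open>Uniform in \<open>N\<close> and \<open>t\<close>, hence usable as a dominating constant
  for the integrals of the partial products.\<close>

lemma weight_prod_partial_bound:
  assumes "\<bar>q\<bar> < 1" and "\<bar>t\<bar> \<le> 2"
  shows "\<bar>\<Prod>k<N. weight_factor q t k\<bar> \<le> exp (7 / (1 - \<bar>q\<bar>))"
proof -
  have "\<bar>weight_factor q t k\<bar> \<le> exp (7 * \<bar>q\<bar> ^ k)" for k
    using weight_factor_minus_one_le[OF assms, of k] exp_ge_add_one_self[of "7 * \<bar>q\<bar> ^ k"] by linarith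
  then have "\<bar>\<Prod>k<N. weight_factor q t k\<bar> \<le> (\<Prod>k<N. exp (7 * \<bar>q\<bar> ^ k))"
    unfolding abs_prod by (intro prod_mono) auto
  also have "\<dots> = exp (7 * (\<Sum>k<N. \<bar>q\<bar> ^ k))"
    by (simp add: exp_sum sum_distrib_left)
  also have "(\<Sum>k<N. \<bar>q\<bar> ^ k) \<le> 1 / (1 - \<bar>q\<bar>)"
    using sum_le_suminf[of "\<lambda>k. \<bar>q\<bar> ^ k" "{..<N}"] assms by (simp add: suminf_geometric summable_geometric)
  finally show ?thesis
    by simp
qed

lemma continuous_on_weight_prod:
  assumes "\<bar>q\<bar> < 1"
  shows "continuous_on {-2..2} (weight_prod q)"
proof -
  have "uniformly_convergent_on {-2..2} (\<lambda>N t. \<Prod>k<N. weight_factor q t (Suc k))"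
  proof (rule uniformly_convergent_on_prod')
    show "continuous_on {-2..2} (\<lambda>t. weight_factor q t (Suc n))" for n
      unfolding weight_factor_def by (intro continuous_intros)
    show "uniformly_convergent_on {-2..2} (\<lambda>N t. \<Sum>k<N. norm (weight_factor q t (Suc k) - 1))"
    proof (rule Weierstrass_m_test')
      show "summable (\<lambda>k. 7 * \<bar>q\<bar> * \<bar>q\<bar> ^ k)"
        using assms by (intro summable_mult summable_geometric) simp
      fix n and t :: real assume "t \<in> {-2..2}"
      then have "\<bar>t\<bar> \<le> 2" by auto
      from weight_factor_minus_one_le[OF assms this, of "Suc n"]
      show "norm (norm (weight_factor q t (Suc n) - 1)) \<le> 7 * \<bar>q\<bar> * \<bar>q\<bar> ^ n"
        by (simp add: mult.assoc)
    qed
  qed simp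
  then obtain l where l: "uniform_limit {-2..2} (\<lambda>N t. \<Prod>k<N. weight_factor q t (Suc k)) l sequentially"
    by (auto simp: uniformly_convergent_on_def)
  have "continuous_on {-2..2} l"
    by (rule uniform_limit_theorem[OF _ l]) (auto simp: weight_factor_def intro!: always_eventually continuous_intros)
  moreover have "l t = weight_prod q t" if t: "t \<in> {-2..2}" for t
  proof -
    have "\<bar>t\<bar> \<le> 2" using t by auto
    then show ?thesis
      using tendsto_uniform_limitI[OF l t] weight_prod_tendsto(1)[OF assms] LIMSEQ_unique by blast
  qed
  ultimately show ?thesis
    by (rule continuous_on_eq)
qed

lemma S_eq: "\<bar>q\<bar> < 1 \<Longrightarrow> S q = {- (2 / sqrt (1 - q)) .. 2 / sqrt (1 - q)}"
  by (auto simp: S_def)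

lemma scaled_mem_S:
  assumes "\<bar>q\<bar> < 1" and "x \<in> S q"
  shows "\<bar>sqrt (1 - q) * x\<bar> \<le> 2"
proof -
  have c: "0 < sqrt (1 - q)"
    using assms by simp
  have "\<bar>x\<bar> \<le> 2 / sqrt (1 - q)"
    using assms S_eq[of q] by (simp add: abs_le_iff)
  then show ?thesis
    using c by (simp add: abs_mult field_simps)
qed

text \<open>The factor 4 - t^2 of index 0 moves the square root from the denominator to the
  numerator, which makes continuity visible. At the endpoints both sides are 0, on the left by
  division by zero.\<close>

lemma f_N_eq:
  assumes q: "\<bar>q\<bar> < 1" and x: "x \<in> S q"
  defines "t \<equiv> sqrt (1 - q) * x"
  shows "f_N q x = sqrt (1 - q) * q_pochhammer_inf q q / (2 * pi) * sqrt (4 - t\<^sup>2) * weight_prod q t"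
proof -
  have t: "\<bar>t\<bar> \<le> 2"
    unfolding t_def using q x by (rule scaled_mem_S)
  have t2: "t\<^sup>2 = (1 - q) * x\<^sup>2"
    using q by (simp add: t_def power_mult_distrib)
  have f: "f_N q x = sqrt (1 - q) * q_pochhammer_inf q q / (2 * pi * sqrt (4 - t\<^sup>2)) * (\<Prod>k. weight_factor q t k)"
    using q by (auto simp: f_N_def weight_factor_def t2)
  show ?thesis
  proof (cases "t\<^sup>2 = 4")
    case True
    then show ?thesis by (simp add: f)
  next
    case False
    then have lt: "t\<^sup>2 < 4"
      using power_mono[OF t, of 2] by simp
    have w0: "weight_factor q t 0 = 4 - t\<^sup>2"
      by (simp add: weight_factor_def)
    have "weight_factor q t k \<noteq> 0" for k
      using weight_factor_pos[OF q t, of "k - 1"] w0 lt by (cases k) simp_all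
    moreover have "(\<lambda>N. \<Prod>k<N. weight_factor q t k) \<longlonglongrightarrow> (4 - t\<^sup>2) * weight_prod q t"
    proof -
      have "(\<lambda>N. weight_factor q t 0 * (\<Prod>k<N. weight_factor q t (Suc k))) \<longlonglongrightarrow> (4 - t\<^sup>2) * weight_prod q t"
        unfolding w0 by (intro tendsto_mult tendsto_const weight_prod_tendsto(1) q t)
      then show ?thesis
        unfolding prod.lessThan_Suc_shift[symmetric] by (rule LIMSEQ_imp_Suc)
    qed
    moreover have "weight_prod q t \<noteq> 0"
      using q t by (rule weight_prod_tendsto)
    ultimately have "(\<Prod>k. weight_factor q t k) = (4 - t\<^sup>2) * weight_prod q t"
      using lt by (intro prodinf_eqI) auto
    moreover define r where "r = sqrt (4 - t\<^sup>2)"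
    then have "4 - t\<^sup>2 = r * r" "r \<noteq> 0"
      using lt by auto
    ultimately show ?thesis
      unfolding f r_def[symmetric] by simp
  qed
qed

lemma continuous_on_f_N:
  assumes q: "\<bar>q\<bar> < 1"
  shows "continuous_on (S q) (f_N q)"
proof -
  have "sqrt (1 - q) * x \<in> {-2..2}" if "x \<in> S q" for x
    using scaled_mem_S[OF q that] unfolding abs_le_iff by simp
  then have "continuous_on (S q) (\<lambda>x. sqrt (1 - q) * q_pochhammer_inf q q / (2 * pi) * sqrt (4 - (sqrt (1 - q) * x)\<^sup>2)
      * weight_prod q (sqrt (1 - q) * x))"
    by (intro continuous_intros continuous_on_compose2[OF continuous_on_weight_prod[OF q]]) auto
  then show ?thesis
    using f_N_eq[OF q] by (simp cong: continuous_on_cong)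
qed

section \<open>Fourier coefficients of the weighted polynomials\<close>

lemma has_integral_cos_int:
  "((\<lambda>\<theta>. cos (of_int m * \<theta>)) has_integral (if m = 0 then pi else 0)) {0..pi}"
proof (cases "m = 0")
  case True
  then show ?thesis
    using has_integral_const_real[of "1 :: real" 0 pi] by simp
next
  case False
  have "((\<lambda>\<theta>. cos (of_int m * \<theta>)) has_integral (sin (of_int m * pi) / of_int m - sin (of_int m * 0) / of_int m)) {0..pi}"
    using False
    by (intro fundamental_theorem_of_calculus)
       (auto intro!: derivative_eq_intros simp flip: has_real_derivative_iff_has_vector_derivative)
  moreover have "sin (of_int m * pi) = 0"
    using sin_zero_iff_int2[of "of_int m * pi"] by auto
  ultimately show ?thesis
    using False by simp
qed

text \<open>The extra factor 1 - 1/u shifts the second half of the product by one index: (1 - q^k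
  u)(1 - q^k / u) is the weight factor, as u + 1/u = t^2 - 2, and 1 - q^N / u is left over.\<close>

lemma theta_product_eq_weight:
  fixes q :: real
  defines "u \<equiv> \<lambda>\<theta>. cis (2 * \<theta>)"
  shows "(1 - 1 / u \<theta>) * (\<Prod>k<N. (1 - of_real q ^ k * u \<theta>) * (1 - of_real q ^ Suc k / u \<theta>)) =
    of_real (\<Prod>k<N. weight_factor q (2 * cos \<theta>) k) * (1 - of_real (q ^ N) / u \<theta>)"
proof (induction N)
  case (Suc N)
  let ?Q = "of_real q ^ N :: complex"
  have nz: "u \<theta> \<noteq> 0"
    by (simp add: u_def)
  have uu: "u \<theta> + 1 / u \<theta> = of_real ((2 * cos \<theta>)\<^sup>2 - 2)"
  proof -
    have "1 / u \<theta> = cis (- (2 * \<theta>))"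
      unfolding u_def by (simp add: divide_inverse)
    then show ?thesis
      by (simp add: u_def complex_eq_iff cos_double_cos power2_eq_square)
  qed
  have f: "(1 - ?Q * u \<theta>) * (1 - ?Q / u \<theta>) = of_real (weight_factor q (2 * cos \<theta>) N)"
  proof -
    have "(1 - ?Q * u \<theta>) * (1 - ?Q / u \<theta>) = 1 + ?Q * ?Q - ?Q * (u \<theta> + 1 / u \<theta>)"
      using nz by (simp add: field_simps)
    also have "\<dots> = of_real (weight_factor q (2 * cos \<theta>) N)"
      unfolding uu weight_factor_def by (simp add: power2_eq_square algebra_simps)
    finally show ?thesis .
  qed
  have "(1 - 1 / u \<theta>) * (\<Prod>k<Suc N. (1 - of_real q ^ k * u \<theta>) * (1 - of_real q ^ Suc k / u \<theta>)) =
    ((1 - 1 / u \<theta>) * (\<Prod>k<N. (1 - of_real q ^ k * u \<theta>) * (1 - of_real q ^ Suc k / u \<theta>))) *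
      ((1 - ?Q * u \<theta>) * (1 - of_real q ^ Suc N / u \<theta>))"
    by simp
  also have "\<dots> = of_real (\<Prod>k<N. weight_factor q (2 * cos \<theta>) k) * ((1 - ?Q * u \<theta>) * (1 - ?Q / u \<theta>)) *
      (1 - of_real q ^ Suc N / u \<theta>)"
    unfolding Suc by simp
  also have "\<dots> = of_real (\<Prod>k<Suc N. weight_factor q (2 * cos \<theta>) k) * (1 - of_real (q ^ Suc N) / u \<theta>)"
    unfolding f by simp
  finally show ?case .
qed simp

text \<open>Real part of a product of two Laurent polynomials in e^(i \<theta>), that of
  \<open>cqH\<close> and that of the triple product. The leftover factor of the weight contributes 1
  - q^N cos (2 \<theta>), which tends to 1.\<close>

lemma cqH_weight_Fourier:
  assumes q: "\<bar>q\<bar> < 1"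
  shows "cqH q n (2 * cos \<theta>) * (\<Prod>k<N. weight_factor q (2 * cos \<theta>) k) * (1 - q ^ N * cos (2 * \<theta>)) =
    (\<Sum>k\<le>n. \<Sum>j=- int N..int N. qpoch q n * inv_qpoch q (int k) * inv_qpoch q (int n - int k) * jacobi_coeff q N j *
      (cos (of_int (2 * int k - int n + 2 * j) * \<theta>) - cos (of_int (2 * int k - int n + 2 * j - 2) * \<theta>)))"
proof -
  let ?h = "cqH q n (2 * cos \<theta>)" and ?P = "\<Prod>k<N. weight_factor q (2 * cos \<theta>) k"
  have t: "of_real (2 * cos \<theta>) = cis \<theta> + cis (-\<theta>)"
    by (simp add: complex_eq_iff)
  have h: "of_real ?h = (\<Sum>k\<le>n. of_real (qpoch q n * inv_qpoch q (int k) * inv_qpoch q (int n - int k)) *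
      cis (of_int (2 * int k - int n) * \<theta>))"
  proof -
    have "of_real ?h = of_real (qpoch q n) *
        (\<Sum>k\<le>n. cis \<theta> ^ k * cis (-\<theta>) ^ (n - k) / of_real (qpoch q k * qpoch q (n - k)))"
      by (rule cqH_eq_sum[OF q _ t]) (simp add: cis_mult)
    also have "\<dots> = (\<Sum>k\<le>n. of_real (qpoch q n * inv_qpoch q (int k) * inv_qpoch q (int n - int k)) *
      cis (of_int (2 * int k - int n) * \<theta>))"
      unfolding sum_distrib_left
    proof (rule sum.cong)
      fix k assume "k \<in> {..n}"
      then have k: "k \<le> n" by simp
      have "cis \<theta> ^ k * cis (-\<theta>) ^ (n - k) = cis (of_int (2 * int k - int n) * \<theta>)"
        using k by (simp add: Complex.DeMoivre cis_mult of_nat_diff algebra_simps)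
      moreover have "inv_qpoch q (int k) * inv_qpoch q (int n - int k) = 1 / (qpoch q k * qpoch q (n - k))"
        using k by (simp add: inv_qpoch_def nat_diff_distrib)
      ultimately show "of_real (qpoch q n) * (cis \<theta> ^ k * cis (-\<theta>) ^ (n - k) / of_real (qpoch q k * qpoch q (n - k))) =
         of_real (qpoch q n * inv_qpoch q (int k) * inv_qpoch q (int n - int k)) * cis (of_int (2 * int k - int n) * \<theta>)"
        by (simp add: mult.assoc)
    qed simp
    finally show ?thesis .
  qed
  have w: "of_real ?P * (1 - of_real (q ^ N) / cis (2 * \<theta>)) =
      (\<Sum>j=- int N..int N. of_real (jacobi_coeff q N j) * (cis (of_int (2 * j) * \<theta>) - cis (of_int (2 * j - 2) * \<theta>)))"
  proof -
    have e: "(1 - 1 / cis (2 * \<theta>)) * cis (2 * \<theta>) powi j = cis (of_int (2 * j) * \<theta>) - cis (of_int (2 * j - 2) * \<theta>)" for j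
      by (simp add: cis_power_int divide_inverse cis_mult algebra_simps)
    have "of_real ?P * (1 - of_real (q ^ N) / cis (2 * \<theta>)) =
       (1 - 1 / cis (2 * \<theta>)) * (\<Sum>j=- int N..int N. of_real (jacobi_coeff q N j) * cis (2 * \<theta>) powi j)"
      unfolding theta_product_eq_weight[symmetric] by (subst finite_Jacobi_triple_product[OF q]) simp_all
    also have "\<dots> = (\<Sum>j=- int N..int N. of_real (jacobi_coeff q N j) * ((1 - 1 / cis (2 * \<theta>)) * cis (2 * \<theta>) powi j))"
      by (simp add: sum_distrib_left mult_ac)
    finally show ?thesis unfolding e .
  qed
  have "of_real ?h * (of_real ?P * (1 - of_real (q ^ N) / cis (2 * \<theta>))) =
    (\<Sum>k\<le>n. \<Sum>j=- int N..int N. of_real (qpoch q n * inv_qpoch q (int k) * inv_qpoch q (int n - int k) * jacobi_coeff q N j) *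
      (cis (of_int (2 * int k - int n + 2 * j) * \<theta>) - cis (of_int (2 * int k - int n + 2 * j - 2) * \<theta>)))"
    unfolding h w sum_product
  proof (intro sum.cong refl)
    fix k and j :: int
    have "cis (of_int (2 * int k - int n) * \<theta>) * (cis (of_int (2 * j) * \<theta>) - cis (of_int (2 * j - 2) * \<theta>))
      = cis (of_int (2 * int k - int n + 2 * j) * \<theta>) - cis (of_int (2 * int k - int n + 2 * j - 2) * \<theta>)"
      unfolding right_diff_distrib cis_mult by (simp add: algebra_simps)
    then show "of_real (qpoch q n * inv_qpoch q (int k) * inv_qpoch q (int n - int k)) *
       cis (of_int (2 * int k - int n) * \<theta>) *
       (of_real (jacobi_coeff q N j) * (cis (of_int (2 * j) * \<theta>) - cis (of_int (2 * j - 2) * \<theta>))) =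
       of_real (qpoch q n * inv_qpoch q (int k) * inv_qpoch q (int n - int k) * jacobi_coeff q N j) *
       (cis (of_int (2 * int k - int n + 2 * j) * \<theta>) - cis (of_int (2 * int k - int n + 2 * j - 2) * \<theta>))"
      by (simp only: of_real_mult mult_ac)
  qed
  then have "Re (of_real ?h * (of_real ?P * (1 - of_real (q ^ N) / cis (2 * \<theta>)))) =
    Re (\<Sum>k\<le>n. \<Sum>j=- int N..int N. of_real (qpoch q n * inv_qpoch q (int k) * inv_qpoch q (int n - int k) * jacobi_coeff q N j) *
      (cis (of_int (2 * int k - int n + 2 * j) * \<theta>) - cis (of_int (2 * int k - int n + 2 * j - 2) * \<theta>)))"
    by (rule arg_cong)
  moreover have "Re (of_real ?h * (of_real ?P * (1 - of_real (q ^ N) / cis (2 * \<theta>)))) = ?h * ?P * (1 - q ^ N * cos (2 * \<theta>))"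
    by (simp add: divide_inverse del: of_real_power of_real_prod)
  moreover have "Re (of_real c * z) = c * Re z" for c z
    by simp
  ultimately show ?thesis
    by (simp only: Re_sum minus_complex.simps cis.simps)
qed

text \<open>Only frequency 0 survives integration, that is 2 k - n + 2 j = 0 or 2; this forces n to
  be even and fixes j for each k and each of the two cases.\<close>

lemma integral_cqH_partial_weight:
  assumes q: "\<bar>q\<bar> < 1"
  shows "integral {0..pi} (\<lambda>\<theta>. cqH q n (2 * cos \<theta>) * (\<Prod>k<N. weight_factor q (2 * cos \<theta>) k) * (1 - q ^ N * cos (2 * \<theta>))) =
    (if even n then \<Sum>k\<le>n. qpoch q n * inv_qpoch q (int k) * inv_qpoch q (int n - int k) * pi *
      (jacobi_coeff q N (int (n div 2) - int k) - jacobi_coeff q N (int (n div 2) - int k + 1)) else 0)"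
proof -
  let ?I = "\<lambda>m::int. if m = 0 then pi else 0"
  let ?c = "\<lambda>k. qpoch q n * inv_qpoch q (int k) * inv_qpoch q (int n - int k)"
  have "((\<lambda>\<theta>. cqH q n (2 * cos \<theta>) * (\<Prod>k<N. weight_factor q (2 * cos \<theta>) k) * (1 - q ^ N * cos (2 * \<theta>)))
     has_integral (\<Sum>k\<le>n. \<Sum>j=- int N..int N. ?c k * jacobi_coeff q N j *
       (?I (2 * int k - int n + 2 * j) - ?I (2 * int k - int n + 2 * j - 2)))) {0..pi}"
    unfolding cqH_weight_Fourier[OF q]
    by (intro has_integral_sum has_integral_mult_right has_integral_diff has_integral_cos_int) auto
  then have "integral {0..pi} (\<lambda>\<theta>. cqH q n (2 * cos \<theta>) * (\<Prod>k<N. weight_factor q (2 * cos \<theta>) k) * (1 - q ^ N * cos (2 * \<theta>)))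
     = (\<Sum>k\<le>n. \<Sum>j=- int N..int N. ?c k * jacobi_coeff q N j *
       (?I (2 * int k - int n + 2 * j) - ?I (2 * int k - int n + 2 * j - 2)))"
    by (rule integral_unique)
  also have "\<dots> = (if even n then \<Sum>k\<le>n. ?c k * pi *
      (jacobi_coeff q N (int (n div 2) - int k) - jacobi_coeff q N (int (n div 2) - int k + 1)) else 0)"
  proof (cases "even n")
    case False
    then have "2 * int k - int n + 2 * j \<noteq> 0" "2 * int k - int n + 2 * j - 2 \<noteq> 0" for k j
      by presburger+
    then show ?thesis
      using False by simp
  next
    case True
    then obtain m where m: "n = 2 * m" by (rule evenE)
    \<comment> \<open>The selected index may lie outside the range of summation; the coefficient is
      0 there.\<close>
    have z: "jacobi_coeff q N j = 0" if "j \<notin> {- int N..int N}" for j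
      using that by (auto simp: jacobi_coeff_def inv_qpoch_def)
    have "(\<Sum>j=- int N..int N. ?c k * jacobi_coeff q N j *
       (?I (2 * int k - int n + 2 * j) - ?I (2 * int k - int n + 2 * j - 2))) =
       ?c k * pi * (jacobi_coeff q N (int m - int k) - jacobi_coeff q N (int m - int k + 1))" for k
    proof -
      have "(\<Sum>j=- int N..int N. ?c k * jacobi_coeff q N j *
         (?I (2 * int k - int n + 2 * j) - ?I (2 * int k - int n + 2 * j - 2))) =
        (\<Sum>j=- int N..int N. (if j = int m - int k then ?c k * jacobi_coeff q N j * pi else 0)
           - (if j = int m - int k + 1 then ?c k * jacobi_coeff q N j * pi else 0))"
      proof (rule sum.cong)
        fix j
        have "2 * int k - int n + 2 * j = 0 \<longleftrightarrow> j = int m - int k"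
          "2 * int k - int n + 2 * j - 2 = 0 \<longleftrightarrow> j = int m - int k + 1"
          unfolding m by presburger+
        then show "?c k * jacobi_coeff q N j * (?I (2 * int k - int n + 2 * j) - ?I (2 * int k - int n + 2 * j - 2))
          = (if j = int m - int k then ?c k * jacobi_coeff q N j * pi else 0)
           - (if j = int m - int k + 1 then ?c k * jacobi_coeff q N j * pi else 0)"
          by (simp only: right_diff_distrib if_distrib[of "(*) _"] mult_zero_right)
      qed simp
      also have "\<dots> = ?c k * pi * (jacobi_coeff q N (int m - int k) - jacobi_coeff q N (int m - int k + 1))"
        unfolding sum_subtractf sum.delta[OF finite_atLeastAtMost_int]
        using z[of "int m - int k"] z[of "int m - int k + 1"] by (auto simp: algebra_simps)
      finally show ?thesis .
    qed
    then show ?thesis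
      using m by simp
  qed
  finally show ?thesis .
qed

text \<open>For n = 2 m the limit is a multiple of the difference of the theta sums at s = m and s =
  m - 1, which both vanish as soon as m > 0. For m = 0 the difference is \<theta>_0 - \<theta>_1 =
  2.\<close>

lemma integral_cqH_weight:
  assumes q: "\<bar>q\<bar> < 1"
  shows "q_pochhammer_inf q q *
      integral {0..pi} (\<lambda>\<theta>. cqH q n (2 * cos \<theta>) * ((4 - (2 * cos \<theta>)\<^sup>2) * weight_prod q (2 * cos \<theta>)))
    = (if n = 0 then 2 * pi else 0)"
proof -
  let ?f = "\<lambda>N \<theta>. cqH q n (2 * cos \<theta>) * (\<Prod>k<N. weight_factor q (2 * cos \<theta>) k) * (1 - q ^ N * cos (2 * \<theta>))"
  let ?g = "\<lambda>\<theta>. cqH q n (2 * cos \<theta>) * ((4 - (2 * cos \<theta>)\<^sup>2) * weight_prod q (2 * cos \<theta>))"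
  have c2: "\<bar>2 * cos \<theta>\<bar> \<le> 2" for \<theta> :: real
    by (simp add: abs_mult)
  obtain K where K: "K > 0" "\<And>n t. \<bar>t\<bar> \<le> 2 \<Longrightarrow> \<bar>cqH q n t\<bar> \<le> K * (real n + 1)"
    using cqH_bound[OF q] by metis
  have "(\<lambda>N. integral {0..pi} (?f N)) \<longlonglongrightarrow> integral {0..pi} ?g"
  proof (rule dominated_convergence(2))
    show "?f N integrable_on {0..pi}" for N
      unfolding weight_factor_def by (intro integrable_continuous_real continuous_intros)
    show "(\<lambda>_. K * (real n + 1) * exp (7 / (1 - \<bar>q\<bar>)) * 2) integrable_on {0..pi}"
      by (intro integrable_continuous_real continuous_intros)
    show "norm (?f N \<theta>) \<le> K * (real n + 1) * exp (7 / (1 - \<bar>q\<bar>)) * 2" for N \<theta>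
    proof -
      have "\<bar>q ^ N * cos (2 * \<theta>)\<bar> \<le> 1"
        unfolding abs_mult power_abs using q by (intro mult_le_one power_le_one) auto
      then have "\<bar>1 - q ^ N * cos (2 * \<theta>)\<bar> \<le> 2" by linarith
      then show ?thesis
        unfolding real_norm_def abs_mult using K(1)
        by (intro mult_mono K(2) c2 weight_prod_partial_bound[OF q c2, unfolded abs_prod] order_refl)
           (use weight_prod_partial_bound[OF q c2] K(2)[OF c2] in \<open>auto simp: abs_prod intro!: prod_nonneg\<close>)
    qed
    show "(\<lambda>N. ?f N \<theta>) \<longlonglongrightarrow> ?g \<theta>" for \<theta>
    proof -
      have "(\<lambda>N. weight_factor q (2 * cos \<theta>) 0 * (\<Prod>k<N. weight_factor q (2 * cos \<theta>) (Suc k)))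
          \<longlonglongrightarrow> (4 - (2 * cos \<theta>)\<^sup>2) * weight_prod q (2 * cos \<theta>)"
        by (intro tendsto_mult weight_prod_tendsto q c2) (simp add: weight_factor_def)
      then have 1: "(\<lambda>N. \<Prod>k<N. weight_factor q (2 * cos \<theta>) k) \<longlonglongrightarrow> (4 - (2 * cos \<theta>)\<^sup>2) * weight_prod q (2 * cos \<theta>)"
        unfolding prod.lessThan_Suc_shift[symmetric] by (rule LIMSEQ_imp_Suc)
      have "(\<lambda>N. 1 - q ^ N * cos (2 * \<theta>)) \<longlonglongrightarrow> 1 - 0 * cos (2 * \<theta>)"
        using q by (intro tendsto_intros LIMSEQ_power_zero) simp
      then have "(\<lambda>N. ?f N \<theta>) \<longlonglongrightarrow>
          cqH q n (2 * cos \<theta>) * ((4 - (2 * cos \<theta>)\<^sup>2) * weight_prod q (2 * cos \<theta>)) * (1 - 0 * cos (2 * \<theta>))"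
        by (intro tendsto_mult 1 tendsto_const)
      then show ?thesis by simp
    qed
  qed
  then have "(\<lambda>N. qpoch q N * integral {0..pi} (?f N)) \<longlonglongrightarrow> q_pochhammer_inf q q * integral {0..pi} ?g"
    by (intro tendsto_mult qpoch_tendsto q)
  moreover have "(\<lambda>N. qpoch q N * integral {0..pi} (?f N)) \<longlonglongrightarrow> (if n = 0 then 2 * pi else 0)"
  proof (cases "even n")
    case False
    then show ?thesis
      unfolding integral_cqH_partial_weight[OF q] by auto
  next
    case True
    then obtain m where m: "n = 2 * m" by (rule evenE)
    let ?c = "\<lambda>k. inv_qpoch q (int k) * inv_qpoch q (int n - int k)"
    \<comment> \<open>The reversal of k to n - k turns the index m - k + i into k - (m - i).\<close>
    have refl: "(\<Sum>k\<le>n. ?c k * theta_coeff q (int m - int k + i)) = theta_binomial_sum q n (int m - i)" for i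
    proof -
      have "(\<Sum>k\<le>n. ?c k * theta_coeff q (int m - int k + i)) =
          (\<Sum>k\<le>n. ?c (n - k) * theta_coeff q (int m - int (n - k) + i))"
        by (rule sum.reindex_bij_witness[of _ "\<lambda>k. n - k" "\<lambda>k. n - k"]) auto
      also have "\<dots> = theta_binomial_sum q n (int m - i)"
        unfolding theta_binomial_sum_def by (rule sum.cong) (auto simp: m of_nat_diff algebra_simps)
      finally show ?thesis .
    qed
    have "(\<lambda>N. qpoch q N * integral {0..pi} (?f N)) =
      (\<lambda>N. \<Sum>k\<le>n. qpoch q n * pi * ?c k *
        (qpoch q N * jacobi_coeff q N (int m - int k) - qpoch q N * jacobi_coeff q N (int m - int k + 1)))"
      unfolding integral_cqH_partial_weight[OF q] using m
      by (simp add: sum_distrib_left algebra_simps)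
    also have "\<dots> \<longlonglongrightarrow> (\<Sum>k\<le>n. qpoch q n * pi * ?c k * (theta_coeff q (int m - int k) - theta_coeff q (int m - int k + 1)))"
      by (intro tendsto_sum tendsto_mult tendsto_diff tendsto_const jacobi_coeff_tendsto q)
    also have "(\<Sum>k\<le>n. qpoch q n * pi * ?c k * (theta_coeff q (int m - int k) - theta_coeff q (int m - int k + 1))) =
       qpoch q n * pi * ((\<Sum>k\<le>n. ?c k * theta_coeff q (int m - int k + 0)) - (\<Sum>k\<le>n. ?c k * theta_coeff q (int m - int k + 1)))"
      unfolding sum_subtractf[symmetric] sum_distrib_left by (rule sum.cong) (simp_all add: algebra_simps)
    also have "\<dots> = qpoch q n * pi * (theta_binomial_sum q n (int m) - theta_binomial_sum q n (int m - 1))"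
      unfolding refl by simp
    also have "\<dots> = (if n = 0 then 2 * pi else 0)"
    proof (cases "m = 0")
      case True
      then show ?thesis by (simp add: m theta_binomial_sum_def inv_qpoch_def)
    next
      case False
      then show ?thesis
        using theta_binomial_sum_eq_0[OF q, of "int m" n] theta_binomial_sum_eq_0[OF q, of "int m - 1" n]
        by (simp add: m)
    qed
    finally show ?thesis .
  qed
  ultimately show ?thesis
    by (rule LIMSEQ_unique)
qed

text \<open>Under x = 2 cos \<theta> / sqrt (1 - q) the sine from dx and the one from sqrt (4 - t^2)
  = 2 sin \<theta> together restore the factor 4 - t^2.\<close>

theorem integral_cqH_f_N:
  assumes q: "\<bar>q\<bar> < 1"
  shows "integral (S q) (\<lambda>x. cqH q n (sqrt (1 - q) * x) * f_N q x) = (if n = 0 then 1 else 0)"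
proof -
  define c where "c = sqrt (1 - q)"
  have c: "c > 0"
    using q by (simp add: c_def)
  let ?F = "\<lambda>x. cqH q n (c * x) * f_N q x"
  let ?g = "\<lambda>\<theta>. 2 * cos \<theta> / c" and ?g' = "\<lambda>\<theta>. - 2 * sin \<theta> / c"
  let ?G = "\<lambda>\<theta>. cqH q n (2 * cos \<theta>) * ((4 - (2 * cos \<theta>)\<^sup>2) * weight_prod q (2 * cos \<theta>))"
  have S: "S q = {- (2 / c)..2 / c}"
    using q by (simp add: S_eq c_def)
  have gS: "?g \<theta> \<in> S q" for \<theta>
  proof -
    have "2 * cos \<theta> \<le> 2" "- 2 \<le> 2 * cos \<theta>"
      using cos_le_one[of \<theta>] cos_ge_minus_one[of \<theta>] by linarith+
    then show ?thesis
      using c by (simp add: S divide_simps)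
  qed
  \<comment> \<open>The substitution is decreasing, so the interval from \<open>?g 0\<close> to
    \<open>?g pi\<close> is empty and only the second integral, with its minus sign, counts.\<close>
  have "((\<lambda>\<theta>. ?g' \<theta> *\<^sub>R ?F (?g \<theta>)) has_integral (integral {?g 0..?g pi} ?F - integral {?g pi..?g 0} ?F)) {0..pi}"
  proof (rule has_integral_substitution_general[of "{}" 0 pi ?g "- (2 / c)" "2 / c"])
    show "?g ` {0..pi} \<subseteq> {- (2 / c)..2 / c}"
      using gS S by blast
    show "continuous_on {- (2 / c)..2 / c} ?F"
      unfolding S[symmetric] by (intro continuous_intros continuous_on_f_N q)
    show "continuous_on {0..pi} ?g"
      using c by (intro continuous_intros) auto
    show "(?g has_field_derivative ?g' \<theta>) (at \<theta> within {0..pi})" for \<theta>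
      using c by (auto intro!: derivative_eq_intros)
  qed auto
  moreover have "integral {?g 0..?g pi} ?F = 0"
    using c by simp
  moreover have "integral {?g pi..?g 0} ?F = integral (S q) ?F"
    by (simp add: S)
  ultimately have "((\<lambda>\<theta>. ?g' \<theta> *\<^sub>R ?F (?g \<theta>)) has_integral (- integral (S q) ?F)) {0..pi}"
    by simp
  then have "integral {0..pi} (\<lambda>\<theta>. ?g' \<theta> *\<^sub>R ?F (?g \<theta>)) = - integral (S q) ?F"
    by (rule integral_unique)
  then have "integral (S q) ?F = - integral {0..pi} (\<lambda>\<theta>. ?g' \<theta> *\<^sub>R ?F (?g \<theta>))"
    by linarith
  also have "integral {0..pi} (\<lambda>\<theta>. ?g' \<theta> *\<^sub>R ?F (?g \<theta>)) =
      integral {0..pi} (\<lambda>\<theta>. - (q_pochhammer_inf q q / (2 * pi)) * ?G \<theta>)"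
  proof (rule integral_cong)
    fix \<theta> assume \<theta>: "\<theta> \<in> {0..pi}"
    then have s0: "0 \<le> sin \<theta>"
      by (simp add: sin_ge_zero)
    have t: "sqrt (1 - q) * ?g \<theta> = 2 * cos \<theta>"
      using c by (simp add: c_def)
    have s2: "4 - (2 * cos \<theta>)\<^sup>2 = (2 * sin \<theta>)\<^sup>2"
      by (simp add: sin_squared_eq power_mult_distrib)
    have f: "f_N q (?g \<theta>) = c * q_pochhammer_inf q q / (2 * pi) * (2 * sin \<theta>) * weight_prod q (2 * cos \<theta>)"
      using f_N_eq[OF q gS[of \<theta>]] s0 unfolding t s2 by (simp add: c_def real_sqrt_mult)
    show "?g' \<theta> *\<^sub>R ?F (?g \<theta>) = - (q_pochhammer_inf q q / (2 * pi)) * ?G \<theta>"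
      unfolding f s2 using c by (simp add: power2_eq_square)
  qed
  also have "\<dots> = - (q_pochhammer_inf q q * integral {0..pi} ?G) / (2 * pi)"
    by simp
  finally show ?thesis
    unfolding integral_cqH_weight[OF q] c_def by simp
qed

section \<open>Expansions in q-Hermite polynomials\<close>

text \<open>Polynomials of degree below \<open>d\<close>, in the coordinates that orthogonality
  reads off.\<close>

definition cqH_span :: "real \<Rightarrow> nat \<Rightarrow> (real \<Rightarrow> real) set" where
  "cqH_span q d = {p. \<exists>a. \<forall>t. p t = (\<Sum>i<d. a i * cqH q i t)}"

lemma cqH_spanI: "(\<And>t. p t = (\<Sum>i<d. a i * cqH q i t)) \<Longrightarrow> p \<in> cqH_span q d"
  by (auto simp: cqH_span_def)

lemma cqH_span_mono:
  assumes "p \<in> cqH_span q d" and "d \<le> e"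
  shows "p \<in> cqH_span q e"
proof -
  obtain a where a: "\<And>t. p t = (\<Sum>i<d. a i * cqH q i t)"
    using assms(1) by (auto simp: cqH_span_def)
  have "(\<Sum>i<d. a i * cqH q i t) = (\<Sum>i<e. (if i < d then a i else 0) * cqH q i t)" for t
    using assms(2) by (intro sum.mono_neutral_cong_left) auto
  then show ?thesis
    using a by (intro cqH_spanI) simp
qed

lemma cqH_span_scale:
  assumes "p \<in> cqH_span q d"
  shows "(\<lambda>t. c * p t) \<in> cqH_span q d"
proof -
  obtain a where a: "\<And>t. p t = (\<Sum>i<d. a i * cqH q i t)"
    using assms by (auto simp: cqH_span_def)
  show ?thesis
    by (rule cqH_spanI[where a = "\<lambda>i. c * a i"]) (simp add: a sum_distrib_left mult.assoc)
qed

lemma cqH_span_add: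
  assumes "p \<in> cqH_span q d" and "r \<in> cqH_span q d"
  shows "(\<lambda>t. p t + r t) \<in> cqH_span q d"
proof -
  obtain a b where a: "\<And>t. p t = (\<Sum>i<d. a i * cqH q i t)" and b: "\<And>t. r t = (\<Sum>i<d. b i * cqH q i t)"
    using assms by (auto simp: cqH_span_def)
  show ?thesis
    by (rule cqH_spanI[where a = "\<lambda>i. a i + b i"]) (simp add: a b sum.distrib algebra_simps)
qed

lemma cqH_span_sum:
  assumes "\<And>i. i < (n::nat) \<Longrightarrow> p i \<in> cqH_span q d"
  shows "(\<lambda>t. \<Sum>i<n. c i * p i t) \<in> cqH_span q d"
  using assms
proof (induction n)
  case 0
  then show ?case by (intro cqH_spanI[where a = "\<lambda>_. 0"]) simp
next
  case (Suc n)
  have "(\<lambda>t. (\<Sum>i<n. c i * p i t) + c n * p n t) \<in> cqH_span q d"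
    using Suc by (intro cqH_span_add cqH_span_scale) auto
  then show ?case by simp
qed

lemma cqH_in_span: "i < d \<Longrightarrow> cqH q i \<in> cqH_span q d"
  by (rule cqH_spanI[where a = "\<lambda>j. if j = i then 1 else 0"]) (simp add: if_distrib[of "\<lambda>x. x * _"] cong: if_cong)

text \<open>At n = 0 the factor 1 - q^0 disposes of the truncated index n - 1.\<close>

lemma mult_cqH: "t * cqH q n t = cqH q (Suc n) t + (1 - q ^ n) * cqH q (n - 1) t"
  by (cases n) simp_all

lemma cqH_span_times:
  assumes "p \<in> cqH_span q d"
  shows "(\<lambda>t. t * p t) \<in> cqH_span q (Suc d)"
proof -
  obtain a where a: "\<And>t. p t = (\<Sum>i<d. a i * cqH q i t)"
    using assms by (auto simp: cqH_span_def)
  have "(\<lambda>t. \<Sum>i<d. a i * (t * cqH q i t)) \<in> cqH_span q (Suc d)"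
  proof (rule cqH_span_sum)
    fix i assume "i < d"
    then show "(\<lambda>t. t * cqH q i t) \<in> cqH_span q (Suc d)"
      unfolding mult_cqH by (intro cqH_span_add cqH_span_scale cqH_in_span) auto
  qed
  then show ?thesis
    by (simp add: a sum_distrib_left mult_ac)
qed

lemma cqH_span_mult_cqH:
  assumes "p \<in> cqH_span q d"
  shows "(\<lambda>t. cqH q n t * p t) \<in> cqH_span q (n + d)"
  using assms
proof (induction n rule: induct_nat_012)
  case 1
  then show ?case using cqH_span_times[of p q d] by simp
next
  case (ge2 n)
  have "(\<lambda>t. t * (cqH q (Suc n) t * p t) + (- (1 - q ^ Suc n)) * (cqH q n t * p t)) \<in> cqH_span q (Suc (Suc n) + d)"
    using cqH_span_times[OF ge2.IH(2)[OF ge2.prems]] cqH_span_mono[OF ge2.IH(1)[OF ge2.prems], of "Suc (Suc n) + d"]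
    by (intro cqH_span_add cqH_span_scale) auto
  then show ?case by (simp add: algebra_simps)
qed simp

lemma cqH_span_mult:
  assumes "p \<in> cqH_span q d" and "r \<in> cqH_span q e"
  shows "(\<lambda>t. p t * r t) \<in> cqH_span q (d + e)"
proof -
  obtain a where a: "\<And>t. p t = (\<Sum>i<d. a i * cqH q i t)"
    using assms(1) by (auto simp: cqH_span_def)
  have "(\<lambda>t. \<Sum>i<d. a i * (cqH q i t * r t)) \<in> cqH_span q (d + e)"
    using cqH_span_mono[OF cqH_span_mult_cqH[OF assms(2)]] by (intro cqH_span_sum) auto
  then show ?thesis
    by (simp add: a sum_distrib_left mult_ac)
qed

section \<open>Integration against the weight, and orthogonality\<close>

definition f_N_integral :: "real \<Rightarrow> (real \<Rightarrow> real) \<Rightarrow> real" where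
  "f_N_integral q F = integral (S q) (\<lambda>x. F x * f_N q x)"

lemma integrable_times_f_N:
  assumes "\<bar>q\<bar> < 1" and "continuous_on (S q) F"
  shows "(\<lambda>x. F x * f_N q x) integrable_on S q"
proof -
  have "continuous_on (S q) (\<lambda>x. F x * f_N q x)"
    using assms by (intro continuous_intros continuous_on_f_N)
  then show ?thesis
    unfolding S_eq[OF assms(1)] by (rule integrable_continuous_real)
qed

lemma f_N_integral_add:
  assumes "\<bar>q\<bar> < 1" and "continuous_on (S q) F" and "continuous_on (S q) G"
  shows "f_N_integral q (\<lambda>x. F x + G x) = f_N_integral q F + f_N_integral q G"
  unfolding f_N_integral_def distrib_right by (intro integral_add integrable_times_f_N assms)

lemma f_N_integral_diff:
  assumes "\<bar>q\<bar> < 1" and "continuous_on (S q) F" and "continuous_on (S q) G"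
  shows "f_N_integral q (\<lambda>x. F x - G x) = f_N_integral q F - f_N_integral q G"
  unfolding f_N_integral_def left_diff_distrib by (intro integral_diff integrable_times_f_N assms)

lemma f_N_integral_scale: "f_N_integral q (\<lambda>x. c * F x) = c * f_N_integral q F"
  unfolding f_N_integral_def mult.assoc by (rule integral_mult_right)

lemma f_N_integral_sum:
  assumes "\<bar>q\<bar> < 1" and "\<And>i. i < (n::nat) \<Longrightarrow> continuous_on (S q) (F i)"
  shows "f_N_integral q (\<lambda>x. \<Sum>i<n. F i x) = (\<Sum>i<n. f_N_integral q (F i))"
  unfolding f_N_integral_def sum_distrib_right using assms
  by (intro integral_sum integrable_times_f_N) auto

lemma f_N_integral_bound:
  assumes "\<bar>q\<bar> < 1"
  obtains \<Lambda> where "0 < \<Lambda>"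
    and "\<And>F B. continuous_on (S q) F \<Longrightarrow> (\<And>x. x \<in> S q \<Longrightarrow> \<bar>F x\<bar> \<le> B) \<Longrightarrow> \<bar>f_N_integral q F\<bar> \<le> \<Lambda> * B"
proof -
  \<comment> \<open>The L1 norm of f_N; 1 is added below to obtain a positive constant, and 0 in
    \<open>S q\<close> shows that B is nonnegative.\<close>
  define \<Lambda> where "\<Lambda> = integral (S q) (\<lambda>x. \<bar>f_N q x\<bar>)"
  have int: "(\<lambda>x. \<bar>f_N q x\<bar>) integrable_on S q"
    unfolding S_eq[OF assms]
    by (intro integrable_continuous_real continuous_intros continuous_on_f_N[OF assms, unfolded S_eq[OF assms]])
  have \<Lambda>: "0 \<le> \<Lambda>"
    unfolding \<Lambda>_def using int by (rule integral_nonneg) simp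
  have 0: "0 \<in> S q"
    using assms by (simp add: S_eq)
  show thesis
  proof (rule that[of "\<Lambda> + 1"])
    fix F :: "real \<Rightarrow> real" and B assume F: "continuous_on (S q) F" and B: "\<And>x. x \<in> S q \<Longrightarrow> \<bar>F x\<bar> \<le> B"
    have "norm (f_N_integral q F) \<le> integral (S q) (\<lambda>x. B * \<bar>f_N q x\<bar>)"
      unfolding f_N_integral_def using B
      by (intro integral_norm_bound_integral integrable_times_f_N[OF assms F] integrable_on_mult_right int)
         (simp add: abs_mult mult_right_mono)
    also have "\<dots> = \<Lambda> * B"
      by (simp add: \<Lambda>_def)
    also have "\<dots> \<le> (\<Lambda> + 1) * B"
      using B[OF 0] by (simp add: algebra_simps)
    finally show "\<bar>f_N_integral q F\<bar> \<le> (\<Lambda> + 1) * B" by simp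
  qed (use \<Lambda> in simp)
qed

text \<open>Multiplication by t can be moved from one factor to the other, so the recurrence
  expresses column m + 1 of the Gram matrix \<open>M\<close> by columns m and m - 1. Column 0 is the
  integral of a single polynomial against f_N.\<close>

theorem cqH_orthogonal:
  assumes q: "\<bar>q\<bar> < 1"
  shows "f_N_integral q (\<lambda>x. cqH q n (sqrt (1 - q) * x) * cqH q m (sqrt (1 - q) * x)) = (if n = m then qpoch q n else 0)"
proof -
  let ?t = "\<lambda>x. sqrt (1 - q) * x"
  define M where "M n m = f_N_integral q (\<lambda>x. cqH q n (?t x) * cqH q m (?t x))" for n m
  have M0: "M n 0 = (if n = 0 then 1 else 0)" for n
    using integral_cqH_f_N[OF q, of n] by (simp add: M_def f_N_integral_def)
  have cont: "continuous_on (S q) (\<lambda>x. cqH q n (?t x) * cqH q m (?t x))" for n m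
    by (intro continuous_intros)
  have rec: "M n (Suc m) = M (Suc n) m + (1 - q ^ n) * M (n - 1) m - (1 - q ^ m) * M n (m - 1)" for n m
  proof -
    have "cqH q n (?t x) * cqH q (Suc m) (?t x) = cqH q (Suc n) (?t x) * cqH q m (?t x)
      + (1 - q ^ n) * (cqH q (n - 1) (?t x) * cqH q m (?t x)) - (1 - q ^ m) * (cqH q n (?t x) * cqH q (m - 1) (?t x))" for x
    proof -
      have "cqH q n (?t x) * (?t x * cqH q m (?t x)) = (?t x * cqH q n (?t x)) * cqH q m (?t x)"
        by simp
      then show ?thesis
        unfolding mult_cqH by (simp add: algebra_simps)
    qed
    then show ?thesis
      unfolding M_def
      by (simp only: f_N_integral_diff[OF q continuous_on_add[OF cont continuous_on_mult_left[OF cont]] continuous_on_mult_left[OF cont]]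
            f_N_integral_add[OF q cont continuous_on_mult_left[OF cont]] f_N_integral_scale)
  qed
  have "\<forall>n. M n m = (if n = m then qpoch q n else 0)"
  proof (induction m rule: induct_nat_012)
    case 0
    then show ?case by (simp add: M0)
  next
    case 1
    then show ?case
    proof
      fix n show "M n (Suc 0) = (if n = Suc 0 then qpoch q n else 0)"
        using rec[of n 0] M0[of "Suc n"] M0[of "n - 1"] by (cases n) (auto simp: qpoch_Suc)
    qed
  next
    case (ge2 m)
    show ?case
    proof
      fix n
      show "M n (Suc (Suc m)) = (if n = Suc (Suc m) then qpoch q n else 0)"
        using rec[of n "Suc m"] ge2 by (cases n) (auto simp: qpoch_Suc)
    qed
  qed
  then show ?thesis
    by (simp add: M_def)
qed

lemma f_N_integral_cqH_span:
  assumes q: "\<bar>q\<bar> < 1" and p: "p \<in> cqH_span q d"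
  defines "c \<equiv> \<lambda>i. f_N_integral q (\<lambda>x. cqH q i (sqrt (1 - q) * x) * p (sqrt (1 - q) * x))"
  shows "d \<le> i \<Longrightarrow> c i = 0" and "p t = (\<Sum>i<d. c i / qpoch q i * cqH q i t)"
proof -
  obtain a where a: "\<And>t. p t = (\<Sum>i<d. a i * cqH q i t)"
    using p by (auto simp: cqH_span_def)
  have c: "c i = (if i < d then a i * qpoch q i else 0)" for i
  proof -
    have "c i = f_N_integral q (\<lambda>x. \<Sum>j<d. a j * (cqH q i (sqrt (1 - q) * x) * cqH q j (sqrt (1 - q) * x)))"
      unfolding c_def a sum_distrib_left by (simp add: mult_ac)
    also have "\<dots> = (\<Sum>j<d. f_N_integral q (\<lambda>x. a j * (cqH q i (sqrt (1 - q) * x) * cqH q j (sqrt (1 - q) * x))))"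
      by (intro f_N_integral_sum q continuous_intros)
    also have "\<dots> = (\<Sum>j<d. if j = i then a i * qpoch q i else 0)"
      unfolding f_N_integral_scale cqH_orthogonal[OF q] by (rule sum.cong) auto
    finally show ?thesis by simp
  qed
  show "d \<le> i \<Longrightarrow> c i = 0"
    by (simp add: c)
  have "c i / qpoch q i = a i" if "i < d" for i
    using that qpoch_pos[OF q, of i] by (simp add: c)
  then show "p t = (\<Sum>i<d. c i / qpoch q i * cqH q i t)"
    by (simp add: a)
qed

text \<open>Since the functional annihilates the product of \<open>cqH q i\<close> with any combination of lower
  polynomials, the \<open>i\<close>-th coefficient of \<open>g\<close> is controlled by the distance of \<open>g\<close> to an
  approximant of degree below \<open>i\<close>; and the partial sums of the expansion of \<open>g\<close> differ
  from the approximants only by the expansion of the error.\<close>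

lemma cqH_expansion:
  fixes g :: "real \<Rightarrow> real" and P :: "nat \<Rightarrow> real \<Rightarrow> real"
  assumes q: "\<bar>q\<bar> < 1" and g: "continuous_on (S q) g"
    and P: "\<And>M. P M \<in> cqH_span q (2 * M)"
    and E: "\<And>M x. x \<in> S q \<Longrightarrow> \<bar>g x - P M (sqrt (1 - q) * x)\<bar> \<le> E * r ^ (2 * M)"
    and r: "0 < r" "\<sigma>\<^sup>2 * r < 1" and \<sigma>: "1 \<le> \<sigma>"
    and K: "\<And>n t. \<bar>t\<bar> \<le> 2 \<Longrightarrow> \<bar>cqH q n t\<bar> \<le> K * \<sigma> ^ n"
    and \<Lambda>: "\<And>F B. continuous_on (S q) F \<Longrightarrow> (\<And>x. x \<in> S q \<Longrightarrow> \<bar>F x\<bar> \<le> B) \<Longrightarrow> \<bar>f_N_integral q F\<bar> \<le> \<Lambda> * B"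
    and \<Lambda>0: "0 < \<Lambda>"
    and c0: "0 < c0" "\<And>n. c0 \<le> qpoch q n"
  defines "c \<equiv> \<lambda>i. f_N_integral q (\<lambda>x. cqH q i (sqrt (1 - q) * x) * g x)"
  defines "A \<equiv> \<Lambda> * E * K\<^sup>2 / c0"
  assumes x: "x \<in> S q"
  shows "\<bar>c i / qpoch q i * cqH q i (sqrt (1 - q) * x)\<bar> \<le> A / r * (\<sigma>\<^sup>2 * r) ^ i"
    and "(\<lambda>i. c i / qpoch q i * cqH q i (sqrt (1 - q) * x)) sums g x"
proof -
  let ?t = "\<lambda>x. sqrt (1 - q) * x"
  have K0: "0 < K"
    using K[of 0 0] by simp
  have E0: "0 \<le> E"
    using E[OF x, of 0] by simp
  have A0: "0 \<le> A"
    using \<Lambda>0 E0 c0 by (simp add: A_def)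
  have contP: "continuous_on (S q) (\<lambda>x. P M (?t x))" for M
  proof -
    obtain a where a: "\<And>t. P M t = (\<Sum>i<2*M. a i * cqH q i t)"
      using P[of M] by (auto simp: cqH_span_def)
    show ?thesis
      unfolding a by (intro continuous_intros)
  qed
  define p where "p M i = f_N_integral q (\<lambda>x. cqH q i (?t x) * P M (?t x))" for M i
  have diff: "\<bar>c i - p M i\<bar> \<le> \<Lambda> * (K * \<sigma> ^ i * (E * r ^ (2 * M)))" for M i
  proof -
    have "c i - p M i = f_N_integral q (\<lambda>x. cqH q i (?t x) * g x - cqH q i (?t x) * P M (?t x))"
      unfolding c_def p_def by (intro f_N_integral_diff[symmetric] q continuous_intros g contP)
    also have "\<dots> = f_N_integral q (\<lambda>x. cqH q i (?t x) * (g x - P M (?t x)))"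
      by (simp add: algebra_simps)
    also have "\<bar>\<dots>\<bar> \<le> \<Lambda> * (K * \<sigma> ^ i * (E * r ^ (2 * M)))"
    proof (rule \<Lambda>)
      show "continuous_on (S q) (\<lambda>x. cqH q i (?t x) * (g x - P M (?t x)))"
        by (intro continuous_intros g contP)
      fix x assume "x \<in> S q"
      then show "\<bar>cqH q i (?t x) * (g x - P M (?t x))\<bar> \<le> K * \<sigma> ^ i * (E * r ^ (2 * M))"
        unfolding abs_mult using K0 \<sigma> by (intro mult_mono K E scaled_mem_S q) auto
    qed
    finally show ?thesis .
  qed
  have term_diff: "\<bar>(c i - p M i) / qpoch q i * cqH q i (?t x)\<bar> \<le> A * (\<sigma>\<^sup>2) ^ i * r ^ (2 * M)" for M i
  proof -
    have "\<bar>(c i - p M i) / qpoch q i * cqH q i (?t x)\<bar> = \<bar>c i - p M i\<bar> / qpoch q i * \<bar>cqH q i (?t x)\<bar>"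
      using qpoch_pos[OF q, of i] by (simp add: abs_mult)
    also have "\<dots> \<le> \<Lambda> * (K * \<sigma> ^ i * (E * r ^ (2 * M))) / c0 * (K * \<sigma> ^ i)"
      using diff[of i M] c0 K0 \<sigma> qpoch_pos[OF q, of i] order_trans[OF abs_ge_zero diff[of i M]]
      by (intro mult_mono frac_le K scaled_mem_S q x) auto
    also have "\<dots> = A * (\<sigma>\<^sup>2) ^ i * r ^ (2 * M)"
      by (simp add: A_def power2_eq_square power_mult_distrib mult_ac)
    finally show ?thesis .
  qed
  \<comment> \<open>Taken with M = i div 2, for which \<open>P M\<close> is orthogonal to
    \<open>cqH q i\<close>. Rounding i down to an even number costs at most one power of r, hence
    the factor 1 / r.\<close>
  show bound: "\<bar>c i / qpoch q i * cqH q i (?t x)\<bar> \<le> A / r * (\<sigma>\<^sup>2 * r) ^ i" for i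
  proof -
    have "p (i div 2) i = 0"
      unfolding p_def by (rule f_N_integral_cqH_span(1)[OF q P]) simp
    then have "\<bar>c i / qpoch q i * cqH q i (?t x)\<bar> \<le> A * (\<sigma>\<^sup>2) ^ i * r ^ (2 * (i div 2))"
      using term_diff[of i "i div 2"] by simp
    also have "r ^ (2 * (i div 2)) \<le> r ^ i / r"
    proof -
      have "r \<le> 1"
      proof -
        have "1 * r \<le> \<sigma>\<^sup>2 * r"
          using \<sigma> r by (intro mult_right_mono) auto
        then show ?thesis using r by linarith
      qed
      then have "r ^ Suc (2 * (i div 2)) \<le> r ^ i"
        using r by (intro power_decreasing) auto
      then show ?thesis
        using r by (simp add: pos_le_divide_eq mult.commute)
    qed
    also have "A * (\<sigma>\<^sup>2) ^ i * (r ^ i / r) = A / r * (\<sigma>\<^sup>2 * r) ^ i"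
      by (simp add: power_mult_distrib)
    finally show ?thesis
      using A0 by (simp add: mult_left_mono)
  qed
  define s where "s = \<sigma>\<^sup>2 * r"
  have s: "0 < s" "s < 1"
    using r \<sigma> by (auto simp: s_def)
  have "summable (\<lambda>i. c i / qpoch q i * cqH q i (?t x))"
  proof (rule summable_comparison_test')
    show "summable (\<lambda>i. A / r * s ^ i)"
      using s by (intro summable_mult summable_geometric) simp
    show "norm (c i / qpoch q i * cqH q i (?t x)) \<le> A / r * s ^ i" for i
      using bound[of i] by (simp only: s_def real_norm_def)
  qed
  then have "(\<lambda>n. \<Sum>i<n. c i / qpoch q i * cqH q i (?t x)) \<longlonglongrightarrow> (\<Sum>i. c i / qpoch q i * cqH q i (?t x))"
    by (rule summable_LIMSEQ)
  from LIMSEQ_subseq_LIMSEQ[OF this, of "\<lambda>M. 2 * M"]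
  have "(\<lambda>M. \<Sum>i<2*M. c i / qpoch q i * cqH q i (?t x)) \<longlonglongrightarrow> (\<Sum>i. c i / qpoch q i * cqH q i (?t x))"
    by (simp add: strict_mono_def o_def)
  moreover have "(\<lambda>M. \<Sum>i<2*M. c i / qpoch q i * cqH q i (?t x)) \<longlonglongrightarrow> g x"
  proof -
    \<comment> \<open>There are 2 M error terms, each at most A s^(2 M) because i < 2 M; the factor
      2 M does not spoil the limit, as s < 1.\<close>
    have e: "\<bar>(\<Sum>i<2*M. c i / qpoch q i * cqH q i (?t x)) - g x\<bar> \<le> A * (2 * real M * s ^ (2 * M)) + E * r ^ (2 * M)" for M
    proof -
      have "P M (?t x) = (\<Sum>i<2*M. p M i / qpoch q i * cqH q i (?t x))"
        unfolding p_def by (rule f_N_integral_cqH_span(2)[OF q P])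
      then have "(\<Sum>i<2*M. c i / qpoch q i * cqH q i (?t x)) - P M (?t x) =
          (\<Sum>i<2*M. (c i - p M i) / qpoch q i * cqH q i (?t x))"
        by (simp add: sum_subtractf diff_divide_distrib left_diff_distrib)
      also have "\<bar>\<dots>\<bar> \<le> (\<Sum>i<2*M. A * (\<sigma>\<^sup>2) ^ (2 * M) * r ^ (2 * M))"
      proof (intro order_trans[OF sum_abs] sum_mono order_trans[OF term_diff])
        fix i assume "i \<in> {..<2*M}"
        then show "A * (\<sigma>\<^sup>2) ^ i * r ^ (2 * M) \<le> A * (\<sigma>\<^sup>2) ^ (2 * M) * r ^ (2 * M)"
          using A0 r \<sigma> by (intro mult_right_mono mult_left_mono power_increasing) auto
      qed
      also have "\<dots> = A * (2 * real M * s ^ (2 * M))"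
        by (simp add: s_def power_mult_distrib)
      finally show ?thesis
        using E[OF x, of M] by linarith
    qed
    have "(\<lambda>n. real n * s ^ n) \<longlonglongrightarrow> 0"
      using s by (intro powser_times_n_limit_0) simp
    from LIMSEQ_subseq_LIMSEQ[OF this, of "\<lambda>M. 2 * M"]
    have 1: "(\<lambda>M. 2 * real M * s ^ (2 * M)) \<longlonglongrightarrow> 0"
      by (simp add: strict_mono_def o_def)
    have "r < 1"
    proof -
      have "1 * r \<le> \<sigma>\<^sup>2 * r"
        using \<sigma> r by (intro mult_right_mono) auto
      then show ?thesis using r by linarith
    qed
    then have "(\<lambda>M. r ^ M) \<longlonglongrightarrow> 0"
      using r by (intro LIMSEQ_power_zero) simp
    from LIMSEQ_subseq_LIMSEQ[OF this, of "\<lambda>M. 2 * M"]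
    have 2: "(\<lambda>M. r ^ (2 * M)) \<longlonglongrightarrow> 0"
      by (simp add: strict_mono_def o_def)
    have "(\<lambda>M. A * (2 * real M * s ^ (2 * M)) + E * r ^ (2 * M)) \<longlonglongrightarrow> 0"
      using tendsto_add[OF tendsto_mult_right_zero[OF 1, of A] tendsto_mult_right_zero[OF 2, of E]] by simp
    then have "(\<lambda>M. (\<Sum>i<2*M. c i / qpoch q i * cqH q i (?t x)) - g x) \<longlonglongrightarrow> 0"
      by (rule Lim_null_comparison[rotated]) (use e in auto)
    then show ?thesis
      by (rule LIM_zero_cancel)
  qed
  ultimately have "(\<Sum>i. c i / qpoch q i * cqH q i (?t x)) = g x"
    by (rule LIMSEQ_unique)
  then show "(\<lambda>i. c i / qpoch q i * cqH q i (?t x)) sums g x"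
    using \<open>summable _\<close> by (simp add: sums_iff)
qed

text \<open>Comparison with the geometric series of ratio \<open>v\<close>. The bounds depend on K,
  \<tau> and \<rho> only, which makes the approximation uniform in the arguments.\<close>

lemma mehler_partial_sum_bounds:
  assumes q: "\<bar>q\<bar> < 1" and ts: "\<bar>t\<bar> \<le> 2" "\<bar>s\<bar> \<le> 2"
    and coeff: "\<And>n. \<bar>mehler_coeff q t s n\<bar> \<le> K * \<tau> ^ n"
    and r: "\<bar>r\<bar> \<le> \<rho>" "0 < \<rho>" "\<rho> < 1" and \<tau>: "0 < \<tau>" "\<tau> * \<rho> < 1"
  defines "v \<equiv> \<tau> * \<rho>"
  shows "\<bar>mehler q t s r - (\<Sum>n<M. mehler_coeff q t s n * r ^ n)\<bar> \<le> K / (1 - v) * v ^ M"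
    and "\<bar>\<Sum>n<M. mehler_coeff q t s n * r ^ n\<bar> \<le> K / (1 - v)"
    and "\<bar>mehler q t s r\<bar> \<le> K / (1 - v)"
proof -
  let ?a = "\<lambda>n. mehler_coeff q t s n * r ^ n"
  have K: "0 \<le> K"
    using coeff[of 0] by simp
  have v: "0 < v" "v < 1"
    using \<tau> r by (simp_all add: v_def)
  have sm: "summable ?a"
    using q ts r by (intro summable_mehler) auto
  have le: "\<bar>?a n\<bar> \<le> K * v ^ n" for n
  proof -
    have "\<bar>?a n\<bar> \<le> (K * \<tau> ^ n) * \<rho> ^ n"
      unfolding abs_mult power_abs using coeff[of n] r K \<tau> by (intro mult_mono power_mono) auto
    then show ?thesis
      by (simp add: v_def power_mult_distrib mult.assoc)
  qed
  have geo: "(\<lambda>n. K * v ^ n) sums (K / (1 - v))"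
    using sums_mult[OF geometric_sums[of v], of K] v by simp
  have smb: "summable (\<lambda>n. \<bar>?a n\<bar>)"
    by (rule summable_comparison_test'[OF sums_summable[OF geo], of 0]) (use le in simp)
  have tail: "\<bar>\<Sum>n. ?a (n + M)\<bar> \<le> K / (1 - v) * v ^ M" for M
  proof -
    have "\<bar>\<Sum>n. ?a (n + M)\<bar> \<le> (\<Sum>n. \<bar>?a (n + M)\<bar>)"
      using smb by (intro summable_rabs) (simp add: summable_iff_shift[of "\<lambda>n. \<bar>?a n\<bar>"])
    also have "\<dots> \<le> (\<Sum>n. v ^ M * (K * v ^ n))"
    proof (rule suminf_le)
      show "\<bar>?a (n + M)\<bar> \<le> v ^ M * (K * v ^ n)" for n
        using le[of "n + M"] by (simp add: power_add mult_ac)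
      show "summable (\<lambda>n. \<bar>?a (n + M)\<bar>)"
        using smb by (simp add: summable_iff_shift[of "\<lambda>n. \<bar>?a n\<bar>"])
      show "summable (\<lambda>n. v ^ M * (K * v ^ n))"
        using sums_summable[OF geo] by (rule summable_mult)
    qed
    also have "\<dots> = K / (1 - v) * v ^ M"
      using sums_unique[OF sums_mult[OF geo, of "v ^ M"]] by (simp add: mult.commute)
    finally show ?thesis .
  qed
  have split: "mehler q t s r = (\<Sum>n. ?a (n + M)) + (\<Sum>n<M. ?a n)" for M
    unfolding mehler_def by (rule suminf_split_initial_segment[OF sm])
  show "\<bar>mehler q t s r - (\<Sum>n<M. ?a n)\<bar> \<le> K / (1 - v) * v ^ M"
    using tail[of M] split[of M] by linarith
  show "\<bar>mehler q t s r\<bar> \<le> K / (1 - v)"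
    using tail[of 0] by (simp add: mehler_def)
  have "\<bar>\<Sum>n<M. ?a n\<bar> \<le> (\<Sum>n<M. K * v ^ n)"
    using le by (intro order_trans[OF sum_abs] sum_mono) 
  also have "\<dots> \<le> K / (1 - v)"
    unfolding sums_unique[OF geo] using K v by (intro sum_le_suminf sums_summable[OF geo]) auto
  finally show "\<bar>\<Sum>n<M. ?a n\<bar> \<le> K / (1 - v)" .
qed

lemma continuous_on_mehler:
  assumes q: "\<bar>q\<bar> < 1" and s: "\<bar>s\<bar> \<le> 2" and r: "\<bar>r\<bar> < 1"
  shows "continuous_on {-2..2} (\<lambda>t. mehler q t s r)"
proof -
  obtain \<rho> where \<rho>: "\<bar>r\<bar> < \<rho>" "\<rho> < 1"
    using r dense by blast
  then have "0 < \<rho>" by linarith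
  obtain \<tau> where \<tau>: "1 < \<tau>" "\<tau> < 1 / \<rho>"
    using dense[of 1 "1 / \<rho>"] \<rho> \<open>0 < \<rho>\<close> by auto
  define \<sigma> where "\<sigma> = sqrt \<tau>"
  have \<sigma>: "1 < \<sigma>" "\<sigma>\<^sup>2 = \<tau>"
    using \<tau> by (simp_all add: \<sigma>_def)
  obtain K where K: "\<And>n t s. \<bar>t\<bar> \<le> 2 \<Longrightarrow> \<bar>s\<bar> \<le> 2 \<Longrightarrow> \<bar>mehler_coeff q t s n\<bar> \<le> K * \<tau> ^ n"
    using mehler_coeff_bound[OF q \<sigma>(1)] unfolding \<sigma>(2) by metis
  have v: "\<tau> * \<rho> < 1" "0 < \<tau> * \<rho>"
    using \<tau> \<open>0 < \<rho>\<close> by (simp_all add: field_simps)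
  have lim: "uniform_limit {-2..2} (\<lambda>M t. \<Sum>n<M. mehler_coeff q t s n * r ^ n) (\<lambda>t. mehler q t s r) sequentially"
  proof (rule uniform_limitI)
    fix e :: real assume "e > 0"
    have "(\<lambda>M. K / (1 - \<tau> * \<rho>) * (\<tau> * \<rho>) ^ M) \<longlonglongrightarrow> 0"
      using v by (intro tendsto_mult_right_zero LIMSEQ_power_zero) simp
    then have "eventually (\<lambda>M. K / (1 - \<tau> * \<rho>) * (\<tau> * \<rho>) ^ M < e) sequentially"
      using \<open>e > 0\<close> by (rule order_tendstoD)
    then show "\<forall>\<^sub>F M in sequentially. \<forall>t\<in>{-2..2}. dist (\<Sum>n<M. mehler_coeff q t s n * r ^ n) (mehler q t s r) < e"
    proof eventually_elim
      case (elim M)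
      show ?case
      proof
        fix t :: real assume "t \<in> {-2..2}"
        then have t: "\<bar>t\<bar> \<le> 2" by auto
        have "\<bar>mehler q t s r - (\<Sum>n<M. mehler_coeff q t s n * r ^ n)\<bar> \<le> K / (1 - \<tau> * \<rho>) * (\<tau> * \<rho>) ^ M"
          using \<rho> \<open>0 < \<rho>\<close> \<tau> v by (intro mehler_partial_sum_bounds(1) K q t s) auto
        then show "dist (\<Sum>n<M. mehler_coeff q t s n * r ^ n) (mehler q t s r) < e"
          using elim by (simp add: dist_real_def abs_minus_commute)
      qed
    qed
  qed
  show ?thesis
    by (rule uniform_limit_theorem[OF _ lim])
       (auto simp: mehler_coeff_def divide_inverse intro!: always_eventually continuous_intros)
qed

section \<open>The density as a quotient of Mehler series, and its expansion for |q| < 1\<close>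

lemma w_eq_mehler_factor:
  assumes "q \<le> 1"
  shows "w q k x y r = mehler_factor (sqrt (1 - q) * x) (sqrt (1 - q) * y) (r * q ^ k)"
proof -
  define c where "c = sqrt (1 - q)"
  have c: "1 - q = c\<^sup>2"
    using assms by (simp add: c_def)
  define p where "p = q ^ k"
  have p: "q ^ (2 * k) = p\<^sup>2"
    by (simp add: p_def power_even_eq)
  show ?thesis
    unfolding w_def mehler_factor_def c_def[symmetric] p p_def[symmetric] unfolding c by algebra
qed

text \<open>All three limits of the product formula are nonzero, so the product of quotients is
  their quotient; the prefactors of \<open>\<phi>\<close> cancel exactly the shifted factorials that
  this brings in.\<close>

theorem phi_eq_mehler:
  assumes q: "\<bar>q\<bar> < 1" and r1: "\<bar>\<rho>1\<bar> < 1" and r2: "\<bar>\<rho>2\<bar> < 1" and xyz: "x \<in> S q" "y \<in> S q" "z \<in> S q"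
  defines "c \<equiv> sqrt (1 - q)"
  shows "\<phi> q x y \<rho>1 z \<rho>2 = f_N q x *
    (mehler q (c * x) (c * y) \<rho>1 * mehler q (c * x) (c * z) \<rho>2 / mehler q (c * y) (c * z) (\<rho>1 * \<rho>2))"
proof -
  have t: "\<bar>c * x\<bar> \<le> 2" "\<bar>c * y\<bar> \<le> 2" "\<bar>c * z\<bar> \<le> 2"
    unfolding c_def using xyz scaled_mem_S[OF q] by auto
  have r12: "\<bar>\<rho>1 * \<rho>2\<bar> < 1"
    using r1 r2 by (metis abs_mult abs_ge_zero mult_strict_mono' mult_1)
  let ?P = "\<lambda>a. q_pochhammer_inf a q"
  have P: "?P (\<rho>1\<^sup>2) \<noteq> 0" "?P (\<rho>2\<^sup>2) \<noteq> 0" "?P ((\<rho>1 * \<rho>2)\<^sup>2) \<noteq> 0"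
    using r1 r2 r12 by (intro q_pochhammer_tendsto(2)[OF q]; simp add: abs_square_less_1)+
  note M1 = q_Mehler[OF q t(1,2) r1] and M2 = q_Mehler[OF q t(1,3) r2] and M3 = q_Mehler[OF q t(2,3) r12]
  let ?m1 = "mehler q (c * x) (c * y) \<rho>1" and ?m2 = "mehler q (c * x) (c * z) \<rho>2"
    and ?m3 = "mehler q (c * y) (c * z) (\<rho>1 * \<rho>2)"
  let ?f1 = "\<lambda>k. mehler_factor (c * x) (c * y) (\<rho>1 * q ^ k)" and ?f2 = "\<lambda>k. mehler_factor (c * x) (c * z) (\<rho>2 * q ^ k)"
    and ?f3 = "\<lambda>k. mehler_factor (c * y) (c * z) (\<rho>1 * \<rho>2 * q ^ k)"
  have "(\<Prod>k. w q k y z (\<rho>1 * \<rho>2) / (w q k x y \<rho>1 * w q k x z \<rho>2)) = (\<Prod>k. ?f3 k / (?f1 k * ?f2 k))"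
    using q by (simp add: w_eq_mehler_factor c_def)
  also have "\<dots> = (?P ((\<rho>1 * \<rho>2)\<^sup>2) / ?m3) / ((?P (\<rho>1\<^sup>2) / ?m1) * (?P (\<rho>2\<^sup>2) / ?m2))"
  proof (rule prodinf_eqI)
    show "?f3 k / (?f1 k * ?f2 k) \<noteq> 0" for k
      using M1(3) M2(3) M3(3) by simp
    show "(\<lambda>n. \<Prod>k<n. ?f3 k / (?f1 k * ?f2 k)) \<longlonglongrightarrow> (?P ((\<rho>1 * \<rho>2)\<^sup>2) / ?m3) / ((?P (\<rho>1\<^sup>2) / ?m1) * (?P (\<rho>2\<^sup>2) / ?m2))"
      unfolding prod_dividef prod.distrib
      using P M1(1) M2(1) by (intro tendsto_divide tendsto_mult M1(2) M2(2) M3(2)) simp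
    show "(?P ((\<rho>1 * \<rho>2)\<^sup>2) / ?m3) / ((?P (\<rho>1\<^sup>2) / ?m1) * (?P (\<rho>2\<^sup>2) / ?m2)) \<noteq> 0"
      using P M1(1) M2(1) M3(1) by simp
  qed
  finally have prod: "(\<Prod>k. w q k y z (\<rho>1 * \<rho>2) / (w q k x y \<rho>1 * w q k x z \<rho>2)) =
    (?P ((\<rho>1 * \<rho>2)\<^sup>2) / ?m3) / ((?P (\<rho>1\<^sup>2) / ?m1) * (?P (\<rho>2\<^sup>2) / ?m2))" .
  have "\<phi> q x y \<rho>1 z \<rho>2 = f_N q x * (?P (\<rho>1\<^sup>2) * ?P (\<rho>2\<^sup>2) / ?P ((\<rho>1 * \<rho>2)\<^sup>2)) *
      (?P ((\<rho>1 * \<rho>2)\<^sup>2) / ?m3 / ((?P (\<rho>1\<^sup>2) / ?m1) * (?P (\<rho>2\<^sup>2) / ?m2)))"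
    using q unfolding \<phi>_def prod by (auto simp: power_mult_distrib)
  also have "\<dots> = f_N q x * (?m1 * ?m2 / ?m3)"
    using P by simp
  finally show ?thesis .
qed

text \<open>The polynomial outside and the one inside \<open>C\<close> each bring c^(-i) with c =
  sqrt (1 - q), and (1 - q)^i from \<open>q_fact\<close> cancels both. Continuity on a compact
  interval lets the Lebesgue integral be read as a gauge integral.\<close>

lemma C_eq_f_N_integral:
  assumes q: "\<bar>q\<bar> < 1" and g: "continuous_on (S q) g"
    and \<phi>: "\<And>x. x \<in> S q \<Longrightarrow> \<phi> q x y \<rho>1 z \<rho>2 = f_N q x * g x"
  shows "1 / q_fact q i * q_Hermite q i x * C q i y z \<rho>1 \<rho>2 =
    f_N_integral q (\<lambda>u. cqH q i (sqrt (1 - q) * u) * g u) / qpoch q i * cqH q i (sqrt (1 - q) * x)"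
proof -
  define c where "c = sqrt (1 - q)"
  have c: "c > 0" "1 - q = c\<^sup>2"
    using q by (simp_all add: c_def)
  have H: "q_Hermite q i u = cqH q i (c * u) / c ^ i" for u
    using cqH_scale[of q i u] q c(1) by (simp add: c_def)
  let ?F = "\<lambda>u. 1 / c ^ i * (cqH q i (c * u) * g u * f_N q u)"
  have "continuous_on (S q) ?F"
    using c by (intro continuous_intros g continuous_on_f_N q) auto
  then have si: "set_integrable lborel (S q) ?F"
    unfolding S_eq[OF q] by (rule borel_integrable_atLeastAtMost')
  have "C q i y z \<rho>1 \<rho>2 = (LINT u:S q|lborel. ?F u)"
    unfolding C_def
  proof (rule set_lebesgue_integral_cong)
    show "S q \<in> sets lborel"
      by (simp add: S_eq[OF q])
    show "\<forall>u. u \<in> S q \<longrightarrow> q_Hermite q i u * \<phi> q u y \<rho>1 z \<rho>2 = ?F u"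
      by (simp add: \<phi> H)
  qed
  also have "\<dots> = integral (S q) ?F"
    using si by (rule set_borel_integral_eq_integral)
  also have "\<dots> = 1 / c ^ i * f_N_integral q (\<lambda>u. cqH q i (c * u) * g u)"
    unfolding f_N_integral_def by (rule integral_mult_right)
  finally have C: "C q i y z \<rho>1 \<rho>2 = 1 / c ^ i * f_N_integral q (\<lambda>u. cqH q i (c * u) * g u)" .
  have "c ^ i * c ^ i = (1 - q) ^ i"
    unfolding c(2) by (simp add: power2_eq_square power_mult_distrib)
  moreover have "q_fact q i = qpoch q i / (1 - q) ^ i"
    using q by (intro q_fact_eq) auto
  ultimately show ?thesis
    unfolding C H c_def[symmetric] using c by (simp add: field_simps)
qed

lemma abs_mult_diff_le:
  fixes a b a' b' :: real
  assumes "\<bar>a - a'\<bar> \<le> e" "\<bar>b - b'\<bar> \<le> e" "\<bar>b\<bar> \<le> B" "\<bar>a'\<bar> \<le> B"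
  shows "\<bar>a * b - a' * b'\<bar> \<le> 2 * B * e"
proof -
  have "a * b - a' * b' = (a - a') * b + a' * (b - b')"
    by (simp add: algebra_simps)
  also have "\<bar>\<dots>\<bar> \<le> \<bar>a - a'\<bar> * \<bar>b\<bar> + \<bar>a'\<bar> * \<bar>b - b'\<bar>"
    by (metis abs_mult abs_triangle_ineq)
  also have "\<dots> \<le> e * B + B * e"
    using assms by (intro add_mono mult_mono) auto
  finally show ?thesis by simp
qed

theorem phi_expansion:
  assumes q: "\<bar>q\<bar> < 1" and r1: "\<bar>\<rho>1\<bar> < 1" and r2: "\<bar>\<rho>2\<bar> < 1"
  shows "\<exists>A s. 0 \<le> s \<and> s < 1 \<and> (\<forall>x\<in>S q. \<forall>y\<in>S q. \<forall>z\<in>S q.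
    (\<forall>i. \<bar>1 / q_fact q i * q_Hermite q i x * C q i y z \<rho>1 \<rho>2\<bar> \<le> A * s ^ i) \<and>
    \<phi> q x y \<rho>1 z \<rho>2 = f_N q x * (\<Sum>i. 1 / q_fact q i * q_Hermite q i x * C q i y z \<rho>1 \<rho>2))"
proof -
  \<comment> \<open>The value 1/2 keeps \<rho> positive when \<rho>1 = \<rho>2 = 0.\<close>
  define \<rho> where "\<rho> = max (1/2) (max \<bar>\<rho>1\<bar> \<bar>\<rho>2\<bar>)"
  have \<rho>: "0 < \<rho>" "\<rho> < 1" "\<bar>\<rho>1\<bar> \<le> \<rho>" "\<bar>\<rho>2\<bar> \<le> \<rho>"
    using r1 r2 by (auto simp: \<rho>_def)
  \<comment> \<open>The condition \<sigma>^2 r < 1 with r^2 = v = \<sigma>^2 \<rho> means \<sigma>^6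
    \<rho> < 1; the seventh root makes the left side equal to 1 / \<sigma>.\<close>
  define \<sigma> where "\<sigma> = root 7 (1 / \<rho>)"
  have \<sigma>: "1 < \<sigma>" "\<sigma> ^ 7 = 1 / \<rho>"
    using \<rho> by (simp_all add: \<sigma>_def)
  define v where "v = \<sigma>\<^sup>2 * \<rho>"
  define r where "r = sqrt v"
  have v0: "0 < v"
    using \<sigma> \<rho> by (simp add: v_def)
  have r0: "0 < r" and rv: "r\<^sup>2 = v"
    using v0 by (simp_all add: r_def)
  have \<sigma>v: "\<sigma> ^ 4 * v < 1"
  proof -
    have "\<sigma> * (\<sigma> ^ 4 * v) = \<sigma> ^ 7 * \<rho>"
      by (simp add: v_def eval_nat_numeral)
    also have "\<dots> = 1"
      using \<sigma>(2) \<rho> by simp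
    finally have "\<sigma> ^ 4 * v = 1 / \<sigma>"
      using \<sigma>(1) by (simp add: field_simps)
    then show ?thesis
      using \<sigma>(1) by simp
  qed
  have \<sigma>r: "\<sigma>\<^sup>2 * r < 1"
  proof -
    have "(\<sigma>\<^sup>2 * r)\<^sup>2 < 1\<^sup>2"
      using \<sigma>v by (simp add: power_mult_distrib rv flip: power_mult)
    then show ?thesis
      by (rule power_less_imp_less_base) simp
  qed
  have v1: "v < 1"
  proof -
    have "1 * v \<le> \<sigma> ^ 4 * v"
      using \<sigma>(1) v0 by (intro mult_right_mono one_le_power) auto
    then show ?thesis using \<sigma>v by linarith
  qed
  have r12: "\<bar>\<rho>1 * \<rho>2\<bar> < 1"
    using r1 r2 by (metis abs_mult abs_ge_zero mult_strict_mono' mult_1)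
  obtain K where K: "\<And>n t. \<bar>t\<bar> \<le> 2 \<Longrightarrow> \<bar>cqH q n t\<bar> \<le> K * \<sigma> ^ n"
    using cqH_geometric_bound[OF q \<sigma>(1)] by metis
  obtain K' where K': "0 < K'"
      "\<And>n t s. \<bar>t\<bar> \<le> 2 \<Longrightarrow> \<bar>s\<bar> \<le> 2 \<Longrightarrow> \<bar>mehler_coeff q t s n\<bar> \<le> K' * (\<sigma>\<^sup>2) ^ n"
    using mehler_coeff_bound[OF q \<sigma>(1)] by metis
  obtain \<Lambda> where \<Lambda>: "0 < \<Lambda>"
    "\<And>F B. continuous_on (S q) F \<Longrightarrow> (\<And>x. x \<in> S q \<Longrightarrow> \<bar>F x\<bar> \<le> B) \<Longrightarrow> \<bar>f_N_integral q F\<bar> \<le> \<Lambda> * B"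
    using f_N_integral_bound[OF q] by metis
  obtain c0 where c0: "0 < c0" "\<And>n. c0 \<le> qpoch q n"
    using qpoch_bounds[OF q] by metis
  obtain m0 where m0: "0 < m0" "\<And>t s. \<bar>t\<bar> \<le> 2 \<Longrightarrow> \<bar>s\<bar> \<le> 2 \<Longrightarrow> m0 \<le> \<bar>mehler q t s (\<rho>1 * \<rho>2)\<bar>"
    using mehler_lower_bound[OF q r12] by metis
  define B where "B = K' / (1 - v)"
  \<comment> \<open>Error constant for a product of two truncated series, each bounded by B with
    error at most B v^M, divided by the lower bound \<open>m0\<close> of the denominator.\<close>
  define E where "E = 2 * B * B / m0"
  define c where "c = sqrt (1 - q)"
  define G where "G y z x = mehler q (c * x) (c * y) \<rho>1 * mehler q (c * x) (c * z) \<rho>2 / mehler q (c * y) (c * z) (\<rho>1 * \<rho>2)" for y z x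
  define pm where "pm M s \<rho> t = (\<Sum>n<M. mehler_coeff q t s n * \<rho> ^ n)" for M s \<rho> t
  \<comment> \<open>Only the numerator is truncated; the denominator is constant in t and kept
    exact.\<close>
  define P where "P y z M t = 1 / mehler q (c * y) (c * z) (\<rho>1 * \<rho>2) * (pm M (c * y) \<rho>1 t * pm M (c * z) \<rho>2 t)" for y z M t
  have main: "\<bar>1 / q_fact q i * q_Hermite q i x * C q i y z \<rho>1 \<rho>2\<bar> \<le> \<Lambda> * E * K\<^sup>2 / c0 / r * (\<sigma>\<^sup>2 * r) ^ i \<and>
      (\<lambda>i. 1 / q_fact q i * q_Hermite q i x * C q i y z \<rho>1 \<rho>2) sums G y z x"
    if x: "x \<in> S q" and y: "y \<in> S q" and z: "z \<in> S q" for x y z i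
  proof -
    have sc: "\<bar>c * u\<bar> \<le> 2" if "u \<in> S q" for u
      unfolding c_def using q that by (rule scaled_mem_S)
    have contG: "continuous_on (S q) (G y z)"
    proof -
      have "c * u \<in> {-2..2}" if "u \<in> S q" for u
        using sc[OF that] unfolding abs_le_iff by simp
      then show ?thesis
        unfolding G_def using q_Mehler(1)[OF q sc[OF y] sc[OF z] r12]
        by (intro continuous_intros continuous_on_compose2[OF continuous_on_mehler[OF q sc[OF y] r1]]
             continuous_on_compose2[OF continuous_on_mehler[OF q sc[OF z] r2]]) auto
    qed
    have span_pm: "pm M s \<rho> \<in> cqH_span q M" for M s \<rho>
      by (rule cqH_spanI[where a = "\<lambda>n. cqH q n s / qpoch q n * \<rho> ^ n"]) (simp add: pm_def mehler_coeff_def mult_ac)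
    have span: "P y z M \<in> cqH_span q (2 * M)" for M
      unfolding P_def mult_2 by (intro cqH_span_scale cqH_span_mult span_pm)
    have err: "\<bar>G y z u - P y z M (sqrt (1 - q) * u)\<bar> \<le> E * r ^ (2 * M)" if u: "u \<in> S q" for M u
    proof -
      let ?m = "mehler q (c * y) (c * z) (\<rho>1 * \<rho>2)"
      have b1: "\<bar>mehler q (c * u) (c * y) \<rho>1 - pm M (c * y) \<rho>1 (c * u)\<bar> \<le> B * v ^ M"
          "\<bar>pm M (c * y) \<rho>1 (c * u)\<bar> \<le> B"
        unfolding B_def pm_def v_def using \<rho> \<sigma>(1) v1[unfolded v_def]
        by (intro mehler_partial_sum_bounds q sc u y K' order_refl; simp)+
      have b2: "\<bar>mehler q (c * u) (c * z) \<rho>2 - pm M (c * z) \<rho>2 (c * u)\<bar> \<le> B * v ^ M"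
          "\<bar>mehler q (c * u) (c * z) \<rho>2\<bar> \<le> B"
        unfolding B_def pm_def v_def using \<rho> \<sigma>(1) v1[unfolded v_def]
        by (intro mehler_partial_sum_bounds q sc u z K' order_refl; simp)+
      have "G y z u - P y z M (c * u) = (mehler q (c * u) (c * y) \<rho>1 * mehler q (c * u) (c * z) \<rho>2 -
          pm M (c * y) \<rho>1 (c * u) * pm M (c * z) \<rho>2 (c * u)) / ?m"
        by (simp add: G_def P_def diff_divide_distrib)
      also have "\<bar>\<dots>\<bar> \<le> (2 * B * (B * v ^ M)) / m0"
        unfolding abs_divide using m0 sc y z abs_mult_diff_le[OF b1(1) b2(1) b2(2) b1(2)]
        by (intro frac_le) (auto intro: order_trans[OF abs_ge_zero])
      also have "\<dots> = E * r ^ (2 * M)"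
        by (simp add: E_def power_mult rv)
      finally show ?thesis
        unfolding c_def .
    qed
    have phi: "\<phi> q u y \<rho>1 z \<rho>2 = f_N q u * G y z u" if "u \<in> S q" for u
      unfolding G_def c_def using that y z by (intro phi_eq_mehler q r1 r2)
    have C: "1 / q_fact q i * q_Hermite q i x * C q i y z \<rho>1 \<rho>2 =
        f_N_integral q (\<lambda>u. cqH q i (sqrt (1 - q) * u) * G y z u) / qpoch q i * cqH q i (sqrt (1 - q) * x)" for i
      by (rule C_eq_f_N_integral[OF q contG]) (rule phi)
    show ?thesis
      unfolding C
    proof (intro conjI cqH_expansion[where P = "P y z"])
      show "\<And>M x. x \<in> S q \<Longrightarrow> \<bar>G y z x - P y z M (sqrt (1 - q) * x)\<bar> \<le> E * r ^ (2 * M)"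
        by (rule err)
      then show "\<And>M x. x \<in> S q \<Longrightarrow> \<bar>G y z x - P y z M (sqrt (1 - q) * x)\<bar> \<le> E * r ^ (2 * M)" .
    qed (use \<sigma>(1) in \<open>auto intro: q contG span r0 \<sigma>r K \<Lambda> c0 x\<close>)
  qed
  show ?thesis
  proof (intro exI conjI ballI allI)
    show "0 \<le> \<sigma>\<^sup>2 * r" "\<sigma>\<^sup>2 * r < 1"
      using r0 \<sigma>r by simp_all
    fix x y z assume xyz: "x \<in> S q" "y \<in> S q" "z \<in> S q"
    show "\<bar>1 / q_fact q i * q_Hermite q i x * C q i y z \<rho>1 \<rho>2\<bar> \<le> \<Lambda> * E * K\<^sup>2 / c0 / r * (\<sigma>\<^sup>2 * r) ^ i" for i
      using main[OF xyz] by blast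
    have "(\<Sum>i. 1 / q_fact q i * q_Hermite q i x * C q i y z \<rho>1 \<rho>2) = G y z x"
      using main[OF xyz] sums_unique by metis
    then show "\<phi> q x y \<rho>1 z \<rho>2 = f_N q x * (\<Sum>i. 1 / q_fact q i * q_Hermite q i x * C q i y z \<rho>1 \<rho>2)"
      unfolding G_def c_def using xyz by (simp add: phi_eq_mehler q r1 r2)
  qed
qed

section \<open>The classical Hermite polynomials\<close>

lemma q_bracket_one [simp]: "q_bracket 1 n = real n"
  by (simp add: q_bracket_def)

lemma q_fact_one [simp]: "q_fact 1 n = fact n"
  by (simp add: q_fact_def fact_prod)

lemma continuous_on_q_Hermite [continuous_intros]:
  "continuous_on A f \<Longrightarrow> continuous_on A (\<lambda>x. q_Hermite q n (f x))"
  by (induction q n "0::real" rule: q_Hermite.induct) (auto intro!: continuous_intros)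

lemma Hermite_initial_bound:
  obtains K where "1 \<le> K" and "\<And>n x. n \<le> (N::nat) \<Longrightarrow> \<bar>x\<bar> \<le> R \<Longrightarrow> \<bar>q_Hermite 1 n x\<bar> \<le> K"
proof -
  have "\<exists>K\<ge>1. \<forall>n\<le>N. \<forall>x. \<bar>x\<bar> \<le> R \<longrightarrow> \<bar>q_Hermite 1 n x\<bar> \<le> K"
  proof (induction N)
    case 0
    show ?case by (intro exI[of _ 1]) simp
  next
    case (Suc N)
    then obtain K where K: "1 \<le> K" "\<And>n x. n \<le> N \<Longrightarrow> \<bar>x\<bar> \<le> R \<Longrightarrow> \<bar>q_Hermite 1 n x\<bar> \<le> K"
      by blast
    have "compact (q_Hermite 1 (Suc N) ` {-R..R})"
      by (intro compact_continuous_image continuous_intros) simp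
    then obtain B where B: "\<And>y. y \<in> q_Hermite 1 (Suc N) ` {-R..R} \<Longrightarrow> norm y \<le> B"
      using compact_imp_bounded bounded_iff by metis
    have "\<bar>q_Hermite 1 n x\<bar> \<le> max K B" if "n \<le> Suc N" "\<bar>x\<bar> \<le> R" for n x
    proof (cases "n = Suc N")
      case True
      have "x \<in> {-R..R}" using that by auto
      then show ?thesis using B True by fastforce
    next
      case False
      then show ?thesis using K(2)[of n x] that by (simp add: le_Suc_eq max.coboundedI1)
    qed
    then show ?case using K(1) by (intro exI[of _ "max K B"]) auto
  qed
  then show thesis using that by blast
qed

text \<open>After division by sqrt (n!) the term with x has relative size R / sqrt n, so for large n
  the recurrence grows by at most \<sigma> per step. The finitely many earlier indices are absorbed
  by \<open>K\<close>.\<close>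

lemma Hermite_bound:
  assumes \<sigma>: "1 < \<sigma>"
  obtains K where "0 < K" and "\<And>n x. \<bar>x\<bar> \<le> R \<Longrightarrow> \<bar>q_Hermite 1 n x\<bar> \<le> K * sqrt (fact n) * \<sigma> ^ n"
proof -
  \<comment> \<open>Chosen so that \<sigma> \<delta> = \<sigma>^2 - 1: then R \<sigma> \<le> sqrt (m
    + 2) (\<sigma>^2 - 1), which leaves a sqrt (m + 2) to dominate sqrt (m + 1).\<close>
  define \<delta> where "\<delta> = \<sigma> - 1 / \<sigma>"
  have \<delta>: "0 < \<delta>" "\<sigma> * \<delta> = \<sigma>\<^sup>2 - 1"
    using \<sigma> by (simp_all add: \<delta>_def field_simps power2_eq_square) (use mult_strict_mono[OF \<sigma> \<sigma>] in simp)
  obtain N where N: "(R / \<delta>)\<^sup>2 \<le> real N"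
    using real_arch_simple by blast
  obtain K where K: "1 \<le> K" "\<And>n x. n \<le> N + 1 \<Longrightarrow> \<bar>x\<bar> \<le> R \<Longrightarrow> \<bar>q_Hermite 1 n x\<bar> \<le> K"
    using Hermite_initial_bound[of "N + 1" R] by metis
  have "\<bar>q_Hermite 1 n x\<bar> \<le> K * sqrt (fact n) * \<sigma> ^ n" if x: "\<bar>x\<bar> \<le> R" for n x
  proof (induction n rule: less_induct)
    case (less n)
    show ?case
    proof (cases "n \<le> N + 1")
      case True
      have "1 \<le> sqrt (fact n)" "1 \<le> \<sigma> ^ n"
        using \<sigma> by (simp_all add: fact_ge_1 one_le_power)
      then have "K * 1 * 1 \<le> K * sqrt (fact n) * \<sigma> ^ n"
        using K(1) by (intro mult_mono) auto
      then show ?thesis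
        using K(2)[OF True x] by simp
    next
      case False
      then obtain m where n: "n = Suc (Suc m)" and m: "N \<le> m"
        by (metis Suc_eq_plus1 Suc_leI not_le not_less_eq_eq nat.exhaust le0)
      let ?a = "sqrt (real (m + 1))" and ?b = "sqrt (real (m + 2))" and ?c = "sqrt (fact m)"
      have f: "sqrt (fact (Suc m)) = ?a * ?c" "sqrt (fact n) = ?b * (?a * ?c)" "real (Suc m) = ?a * ?a"
        unfolding n by (simp_all add: real_sqrt_mult fact_Suc del: of_nat_Suc)
      have R: "R \<le> ?b * \<delta>"
      proof -
        have "(R / \<delta>)\<^sup>2 \<le> real (m + 2)"
          using N m by simp
        then have "R / \<delta> \<le> ?b"
          by (rule real_le_rsqrt)
        then show ?thesis
          using \<delta>(1) by (simp add: pos_divide_le_eq)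
      qed
      have R0: "0 \<le> R" using x by linarith
      have "\<bar>q_Hermite 1 n x\<bar> \<le> \<bar>x\<bar> * \<bar>q_Hermite 1 (Suc m) x\<bar> + real (Suc m) * \<bar>q_Hermite 1 m x\<bar>"
        unfolding n by (simp add: abs_mult[symmetric]) (metis abs_mult abs_of_nat abs_triangle_ineq4 of_nat_Suc)
      also have "\<dots> \<le> R * (K * (?a * ?c) * \<sigma> ^ Suc m) + ?a * ?a * (K * ?c * \<sigma> ^ m)"
        using less[of "Suc m"] less[of m] x R0 unfolding n f by (intro add_mono mult_mono) auto
      also have "\<dots> = K * ?a * ?c * \<sigma> ^ m * (R * \<sigma> + ?a)"
        by (simp add: algebra_simps)
      also have "\<dots> \<le> K * ?a * ?c * \<sigma> ^ m * (?b * \<sigma>\<^sup>2)"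
      proof (rule mult_left_mono)
        have "R * \<sigma> \<le> ?b * \<delta> * \<sigma>"
          using R \<sigma> by (intro mult_right_mono) auto
        also have "\<dots> = ?b * (\<sigma>\<^sup>2 - 1)"
          using \<delta>(2) by (simp add: mult_ac)
        also have "\<dots> = ?b * \<sigma>\<^sup>2 - ?b"
          by (simp add: right_diff_distrib)
        finally show "R * \<sigma> + ?a \<le> ?b * \<sigma>\<^sup>2"
          using real_sqrt_le_mono[of "real (m + 1)" "real (m + 2)"] by linarith
        show "0 \<le> K * ?a * ?c * \<sigma> ^ m"
          using K(1) \<sigma> by simp
      qed
      also have "\<dots> = K * sqrt (fact n) * \<sigma> ^ n"
        unfolding f(2) by (simp add: n power2_eq_square mult_ac)
      finally show ?thesis .
    qed
  qed
  then show thesis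
    using that[of K] K(1) by simp
qed

section \<open>Mehler's formula at q = 1\<close>

definition Hermite_coeff :: "real \<Rightarrow> real \<Rightarrow> nat \<Rightarrow> real" where
  "Hermite_coeff x y n = q_Hermite 1 n x * q_Hermite 1 n y / fact n"

lemma Hermite_coeff_bound:
  assumes \<sigma>: "1 < \<sigma>"
  obtains K where "0 < K"
    and "\<And>n x y. \<bar>x\<bar> \<le> R \<Longrightarrow> \<bar>y\<bar> \<le> R \<Longrightarrow> \<bar>Hermite_coeff x y n\<bar> \<le> K * (\<sigma>\<^sup>2) ^ n"
proof -
  obtain K where K: "0 < K" "\<And>n x. \<bar>x\<bar> \<le> R \<Longrightarrow> \<bar>q_Hermite 1 n x\<bar> \<le> K * sqrt (fact n) * \<sigma> ^ n"
    using Hermite_bound[OF \<sigma>] by metis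
  show thesis
  proof (rule that[of "K\<^sup>2"])
    fix n and x y :: real assume xy: "\<bar>x\<bar> \<le> R" "\<bar>y\<bar> \<le> R"
    have "\<bar>Hermite_coeff x y n\<bar> = \<bar>q_Hermite 1 n x\<bar> * \<bar>q_Hermite 1 n y\<bar> / fact n"
      by (simp add: Hermite_coeff_def abs_mult)
    also have "\<dots> \<le> (K * sqrt (fact n) * \<sigma> ^ n) * (K * sqrt (fact n) * \<sigma> ^ n) / fact n"
      using K \<sigma> xy by (intro divide_right_mono mult_mono) auto
    also have "\<dots> = K * K * (sqrt (fact n) * sqrt (fact n)) * (\<sigma> ^ n * \<sigma> ^ n) / fact n"
      by (simp only: mult_ac)
    also have "\<dots> = K\<^sup>2 * (\<sigma>\<^sup>2) ^ n"
      by (simp add: power2_eq_square power_mult_distrib)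
    finally show "\<bar>Hermite_coeff x y n\<bar> \<le> K\<^sup>2 * (\<sigma>\<^sup>2) ^ n" .
  qed (use K in simp)
qed

lemma Hermite_coeff_geometric_bound:
  assumes "\<bar>r\<bar> < 1"
  obtains A s where "0 \<le> s" and "s < 1"
    and "\<And>n x y. \<bar>x\<bar> \<le> R \<Longrightarrow> \<bar>y\<bar> \<le> R \<Longrightarrow> \<bar>Hermite_coeff x y n * r ^ n\<bar> \<le> A * s ^ n"
proof -
  obtain \<rho> where \<rho>: "\<bar>r\<bar> < \<rho>" "\<rho> < 1"
    using assms dense by blast
  then have "0 < \<rho>" by linarith
  define \<sigma> where "\<sigma> = sqrt (1 / \<rho>)"
  have \<sigma>: "1 < \<sigma>" "\<sigma>\<^sup>2 = 1 / \<rho>"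
    using \<rho> \<open>0 < \<rho>\<close> by (auto simp: \<sigma>_def)
  obtain K where K: "0 < K" "\<And>n x y. \<bar>x\<bar> \<le> R \<Longrightarrow> \<bar>y\<bar> \<le> R \<Longrightarrow> \<bar>Hermite_coeff x y n\<bar> \<le> K * (\<sigma>\<^sup>2) ^ n"
    using Hermite_coeff_bound[OF \<sigma>(1), of R] by metis
  show thesis
  proof (rule that[of "\<bar>r\<bar> / \<rho>" K])
    fix n and x y :: real assume xy: "\<bar>x\<bar> \<le> R" "\<bar>y\<bar> \<le> R"
    have "\<bar>Hermite_coeff x y n * r ^ n\<bar> = \<bar>Hermite_coeff x y n\<bar> * \<bar>r\<bar> ^ n"
      by (simp only: abs_mult power_abs)
    also have "\<dots> \<le> (K * (\<sigma>\<^sup>2) ^ n) * \<bar>r\<bar> ^ n"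
      using K(2)[OF xy] by (rule mult_right_mono) simp
    also have "\<dots> = K * (\<bar>r\<bar> / \<rho>) ^ n"
      unfolding \<sigma>(2) by (simp only: power_divide power_one mult.assoc times_divide_eq_left mult_1_left)
    finally show "\<bar>Hermite_coeff x y n * r ^ n\<bar> \<le> K * (\<bar>r\<bar> / \<rho>) ^ n" .
  qed (use \<rho> \<open>0 < \<rho>\<close> in auto)
qed

lemma summable_Hermite_coeff:
  assumes "\<bar>r\<bar> < 1"
  shows "summable (\<lambda>n. Hermite_coeff x y n * r ^ n)"
proof -
  obtain A s where s: "0 \<le> s" "s < 1"
    "\<And>n x' y'. \<bar>x'\<bar> \<le> max \<bar>x\<bar> \<bar>y\<bar> \<Longrightarrow> \<bar>y'\<bar> \<le> max \<bar>x\<bar> \<bar>y\<bar> \<Longrightarrow> \<bar>Hermite_coeff x' y' n * r ^ n\<bar> \<le> A * s ^ n"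
    using Hermite_coeff_geometric_bound[OF assms, of "max \<bar>x\<bar> \<bar>y\<bar>"] by metis
  show ?thesis
  proof (rule summable_comparison_test')
    show "summable (\<lambda>n. A * s ^ n)"
      using s by (intro summable_mult summable_geometric) simp
    show "norm (Hermite_coeff x y n * r ^ n) \<le> A * s ^ n" for n
      using s(3)[of x y n] by simp
  qed
qed

text \<open>Mehler's formula: both sides satisfy the same first order differential equation in \<open>r\<close>,
  which for the series amounts to the recurrence of order four of its coefficients.\<close>

lemma Hermite_series_ODE:
  fixes x y :: real
  defines "a \<equiv> Hermite_coeff x y"
  defines "F \<equiv> \<lambda>r. \<Sum>n. a n * r ^ n" and "D \<equiv> \<lambda>r. \<Sum>n. diffs a n * r ^ n"
  assumes r: "\<bar>r\<bar> < 1"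
  shows "(1 - r\<^sup>2)\<^sup>2 * (r * D r) = r * (r * (1 - r\<^sup>2) + x * y * (1 + r\<^sup>2) - r * (x\<^sup>2 + y\<^sup>2)) * F r"
proof -
  have sm: "summable (\<lambda>n. a n * r ^ n)" if "\<bar>r\<bar> < 1" for r
    unfolding a_def using that by (rule summable_Hermite_coeff)
  have aF: "(\<lambda>n. a n * r ^ n) sums F r"
    unfolding F_def using sm[OF r] by (rule summable_sums)
  have aD: "(\<lambda>n. (real n * a n) * r ^ n) sums (r * D r)"
  proof -
    have "summable (\<lambda>n. diffs a n * r ^ n)"
      by (rule termdiff_converges[of _ 1]) (use r sm in auto)
    then have "(\<lambda>n. r * (diffs a n * r ^ n)) sums (r * D r)"
      unfolding D_def by (intro sums_mult summable_sums)
    then have "(\<lambda>n. (real (Suc n) * a (Suc n)) * r ^ Suc n) sums (r * D r)"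
      by (simp add: diffs_def mult_ac)
    then show ?thesis
      using sums_Suc_iff[of "\<lambda>n. (real n * a n) * r ^ n" "r * D r"] by simp
  qed
  \<comment> \<open>\<open>b k\<close> and \<open>c k\<close> are the coefficients of r^k F(r) and
    r^k (r D(r)). The extra r turns the derivative's coefficients into n a_n, which fits the
    recurrence with d n = n.\<close>
  define b where "b k n = (if n < k then 0 else a (n - k))" for k n :: nat
  define c where "c k n = (if n < k then 0 else real (n - k) * a (n - k))" for k n :: nat
  have b: "(\<lambda>n. b k n * r ^ n) sums (r ^ k * F r)" for k
    unfolding b_def by (rule sums_shift_powser[OF aF])
  have c: "(\<lambda>n. c k n * r ^ n) sums (r ^ k * (r * D r))" for k
    unfolding c_def by (rule sums_shift_powser[OF aD])
  have lhs: "(\<lambda>n. c 0 n * r ^ n - 2 * (c 2 n * r ^ n) + c 4 n * r ^ n) sums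
      (r ^ 0 * (r * D r) - 2 * (r ^ 2 * (r * D r)) + r ^ 4 * (r * D r))"
    by (intro sums_add sums_diff sums_mult c)
  have rhs: "(\<lambda>n. x * y * (b 1 n * r ^ n) + (1 - x\<^sup>2 - y\<^sup>2) * (b 2 n * r ^ n) + x * y * (b 3 n * r ^ n) - b 4 n * r ^ n) sums
      (x * y * (r ^ 1 * F r) + (1 - x\<^sup>2 - y\<^sup>2) * (r ^ 2 * F r) + x * y * (r ^ 3 * F r) - r ^ 4 * F r)"
    by (intro sums_add sums_diff sums_mult b)
  have HS: "q_Hermite 1 (Suc (Suc n)) u = u * q_Hermite 1 (Suc n) u - real (Suc n) * q_Hermite 1 n u" for n u
    by simp
  have d: "real (Suc n) \<noteq> 0" for n
    by simp
  note rec = three_term_product_recurrence[where d = real and p = fact and h = "\<lambda>n. q_Hermite 1 n x"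
      and k = "\<lambda>n. q_Hermite 1 n y", OF HS HS fact_Suc _ d, folded Hermite_coeff_def, folded a_def]
  note init = three_term_product_recurrence_init[where d = real and p = fact and h = "\<lambda>n. q_Hermite 1 n x"
      and k = "\<lambda>n. q_Hermite 1 n y", OF HS q_Hermite.simps(1,2) HS q_Hermite.simps(1,2) fact_Suc fact_0 d,
      folded Hermite_coeff_def, folded a_def]
  have eq: "c 0 n - 2 * c 2 n + c 4 n = x * y * b 1 n + (1 - x\<^sup>2 - y\<^sup>2) * b 2 n + x * y * b 3 n - b 4 n" for n
  proof -
    consider "n = 0" | "n = 1" | "n = 2" | "n = 3" | "4 \<le> n"
      by linarith
    then show ?thesis
    proof cases
      case 1 then show ?thesis by (simp add: b_def c_def)
    next
      case 2 then show ?thesis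
        using init(1) by (simp add: b_def c_def)
    next
      case 3 then show ?thesis
        using init(2) by (simp add: b_def c_def algebra_simps)
    next
      case 4 then show ?thesis
        using init(3) by (simp add: b_def c_def algebra_simps)
    next
      case 5
      define m where "m = n - 4"
      have n: "n = m + 4" using 5 by (simp add: m_def)
      have "b 1 n = a (m + 3)" "b 2 n = a (m + 2)" "b 3 n = a (m + 1)" "b 4 n = a m"
        "c 0 n = real (m + 4) * a (m + 4)" "c 2 n = real (m + 2) * a (m + 2)" "c 4 n = real m * a m"
        unfolding n b_def c_def by (simp_all add: eval_nat_numeral)
      then show ?thesis
        using rec[of m] by (simp add: algebra_simps)
    qed
  qed
  have eqf: "(\<lambda>n. c 0 n * r ^ n - 2 * (c 2 n * r ^ n) + c 4 n * r ^ n) =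
     (\<lambda>n. x * y * (b 1 n * r ^ n) + (1 - x\<^sup>2 - y\<^sup>2) * (b 2 n * r ^ n) + x * y * (b 3 n * r ^ n) - b 4 n * r ^ n)"
  proof
    fix n
    have "c 0 n * r ^ n - 2 * (c 2 n * r ^ n) + c 4 n * r ^ n = (c 0 n - 2 * c 2 n + c 4 n) * r ^ n"
      by (simp add: algebra_simps)
    then show "c 0 n * r ^ n - 2 * (c 2 n * r ^ n) + c 4 n * r ^ n =
       x * y * (b 1 n * r ^ n) + (1 - x\<^sup>2 - y\<^sup>2) * (b 2 n * r ^ n) + x * y * (b 3 n * r ^ n) - b 4 n * r ^ n"
      unfolding eq by (simp add: algebra_simps)
  qed
  have "r ^ 0 * (r * D r) - 2 * (r ^ 2 * (r * D r)) + r ^ 4 * (r * D r) =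
      x * y * (r ^ 1 * F r) + (1 - x\<^sup>2 - y\<^sup>2) * (r ^ 2 * F r) + x * y * (r ^ 3 * F r) - r ^ 4 * F r"
    by (rule sums_unique2[OF lhs[unfolded eqf] rhs])
  moreover have "r ^ 0 * M - 2 * (r ^ 2 * M) + r ^ 4 * M = (1 - r\<^sup>2)\<^sup>2 * M" for M
    by algebra
  moreover have "x * y * (r ^ 1 * M) + (1 - x\<^sup>2 - y\<^sup>2) * (r ^ 2 * M) + x * y * (r ^ 3 * M) - r ^ 4 * M
      = r * (r * (1 - r\<^sup>2) + x * y * (1 + r\<^sup>2) - r * (x\<^sup>2 + y\<^sup>2)) * M" for M
    by algebra
  ultimately show ?thesis
    by simp
qed

text \<open>\<open>W\<close> is the quotient of the two sides; its derivative vanishes and its value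
  at 0 is 1. The differential equation comes multiplied by its variable, so the derivative is
  computed for 0 < u < 1 and continuity covers 0.\<close>

theorem Mehler:
  fixes x y r :: real
  assumes r: "0 \<le> r" "r < 1"
  shows "(\<Sum>n. Hermite_coeff x y n * r ^ n) =
    exp ((2 * r * x * y - r\<^sup>2 * (x\<^sup>2 + y\<^sup>2)) / (2 * (1 - r\<^sup>2))) / sqrt (1 - r\<^sup>2)"
proof -
  define F where "F r = (\<Sum>n. Hermite_coeff x y n * r ^ n)" for r
  define D where "D r = (\<Sum>n. diffs (Hermite_coeff x y) n * r ^ n)" for r
  define E where "E u = (2 * u * x * y - u\<^sup>2 * (x\<^sup>2 + y\<^sup>2)) / (2 * (1 - u\<^sup>2))" for u
  define W where "W u = F u * sqrt (1 - u\<^sup>2) * exp (- E u)" for u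
  have F0: "F 0 = 1"
    using powser_zero[of "Hermite_coeff x y"] by (simp add: F_def Hermite_coeff_def)
  have F': "(F has_real_derivative D u) (at u)" if "\<bar>u\<bar> < 1" for u
    unfolding F_def[abs_def] D_def using that
    by (intro termdiffs_strong'[of 1]) (auto intro: summable_Hermite_coeff)
  have lt1: "u\<^sup>2 < 1" if "\<bar>u\<bar> < 1" for u :: real
    using that by (simp add: abs_square_less_1)
  have W': "(W has_real_derivative 
      (D u * sqrt (1 - u\<^sup>2) * exp (- E u) + F u * (- u / sqrt (1 - u\<^sup>2)) * exp (- E u)
        - F u * sqrt (1 - u\<^sup>2) * exp (- E u) * ((x * y * (1 + u\<^sup>2) - u * (x\<^sup>2 + y\<^sup>2)) / (1 - u\<^sup>2)\<^sup>2))) (at u)"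
    if u: "\<bar>u\<bar> < 1" for u
  proof -
    have nz: "1 - u\<^sup>2 \<noteq> 0" "0 < 1 - u\<^sup>2"
      using lt1[OF u] by auto
    have E': "(E has_real_derivative ((x * y * (1 + u\<^sup>2) - u * (x\<^sup>2 + y\<^sup>2)) / (1 - u\<^sup>2)\<^sup>2)) (at u)"
    proof -
      have "(E has_real_derivative (((2 * x * y - 2 * u * (x\<^sup>2 + y\<^sup>2)) * (2 * (1 - u\<^sup>2))
          - (2 * u * x * y - u\<^sup>2 * (x\<^sup>2 + y\<^sup>2)) * (- 4 * u)) / ((2 * (1 - u\<^sup>2)) * (2 * (1 - u\<^sup>2))))) (at u)"
        unfolding E_def[abs_def] using nz by (auto intro!: derivative_eq_intros)
      moreover have "((2 * x * y - 2 * u * (x\<^sup>2 + y\<^sup>2)) * (2 * (1 - u\<^sup>2))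
          - (2 * u * x * y - u\<^sup>2 * (x\<^sup>2 + y\<^sup>2)) * (- 4 * u)) / ((2 * (1 - u\<^sup>2)) * (2 * (1 - u\<^sup>2)))
         = (4 * (x * y * (1 + u\<^sup>2) - u * (x\<^sup>2 + y\<^sup>2))) / (4 * (1 - u\<^sup>2)\<^sup>2)"
        by (rule arg_cong2[of _ _ _ _ "(/)"]) algebra+
      moreover have "4 * p / (4 * d) = p / d" for p d :: real
        by simp
      ultimately show ?thesis
        by (simp only:)
    qed
    have s': "((\<lambda>u. sqrt (1 - u\<^sup>2)) has_real_derivative (- u / sqrt (1 - u\<^sup>2))) (at u)"
      using nz by (auto intro!: derivative_eq_intros simp: divide_simps)
    show ?thesis
      unfolding W_def[abs_def]
      by (rule derivative_eq_intros F'[OF u] s' E' refl)+ (simp add: algebra_simps)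
  qed
  have W0: "(W has_real_derivative 0) (at u)" if u: "0 < u" "u < 1" for u
  proof -
    define S where "S = sqrt (1 - u\<^sup>2)"
    have S: "S > 0" "1 - u\<^sup>2 = S * S"
      using lt1[of u] u by (auto simp: S_def)
    define p where "p = x * y * (1 + u\<^sup>2) - u * (x\<^sup>2 + y\<^sup>2)"
    have "(1 - u\<^sup>2)\<^sup>2 * (u * D u) = u * (u * (1 - u\<^sup>2) + x * y * (1 + u\<^sup>2) - u * (x\<^sup>2 + y\<^sup>2)) * F u"
      unfolding D_def F_def using u by (intro Hermite_series_ODE) simp
    then have "u * ((1 - u\<^sup>2)\<^sup>2 * D u) = u * ((u * (1 - u\<^sup>2) + p) * F u)"
      by (simp add: p_def algebra_simps)
    then have ode: "(1 - u\<^sup>2)\<^sup>2 * D u = (u * (1 - u\<^sup>2) + p) * F u"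
      using u by simp
    have "D u * S + F u * (- u / S) - F u * S * (p / (1 - u\<^sup>2)\<^sup>2) =
       ((1 - u\<^sup>2)\<^sup>2 * D u - (u * (1 - u\<^sup>2) + p) * F u) / (S * S * S)"
      unfolding S(2) using S(1) by (simp add: field_simps power2_eq_square)
    also have "\<dots> = 0"
      unfolding ode by simp
    finally have z: "D u * S + F u * (- u / S) - F u * S * (p / (1 - u\<^sup>2)\<^sup>2) = 0" .
    have "D u * S * exp (- E u) + F u * (- u / S) * exp (- E u) - F u * S * exp (- E u) * (p / (1 - u\<^sup>2)\<^sup>2)
      = (D u * S + F u * (- u / S) - F u * S * (p / (1 - u\<^sup>2)\<^sup>2)) * exp (- E u)"
      by (simp add: algebra_simps)
    also have "\<dots> = 0" unfolding z by simp
    finally show ?thesis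
      using W'[of u] u unfolding S_def p_def by simp
  qed
  have "W r = 1"
  proof (cases "r = 0")
    case True
    then show ?thesis by (simp add: W_def F0 E_def)
  next
    case False
    have "continuous_on {0..r} W"
      using r by (intro continuous_at_imp_continuous_on ballI DERIV_isCont[OF W']) auto
    then have "W r = W 0"
      using False r W0 by (intro DERIV_isconst_end) auto
    then show ?thesis by (simp add: W_def F0 E_def)
  qed
  moreover have "0 < sqrt (1 - r\<^sup>2)"
    using lt1[of r] r by simp
  ultimately show ?thesis
    unfolding F_def[symmetric] E_def[symmetric] W_def by (simp add: exp_minus field_simps)
qed

section \<open>Hermite moments of a normal distribution\<close>

text \<open>Integration by parts for centred powers, read off from the explicit even and odd
  moments. At k = 0 the factor k disposes of the truncated k - 1.\<close>

lemma normal_moment_Suc: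
  fixes m \<sigma> :: real
  assumes \<sigma>: "0 < \<sigma>"
  defines "\<mu> \<equiv> \<lambda>k. LINT x|lborel. normal_density m \<sigma> x * (x - m) ^ k"
  shows "\<mu> (Suc k) = \<sigma>\<^sup>2 * real k * \<mu> (k - 1)"
proof (cases "even k")
  case True
  then obtain j where k: "k = 2 * j" by (rule evenE)
  have odd: "\<mu> (2 * i + 1) = 0" for i
    unfolding \<mu>_def by (rule integral_normal_moment_odd[OF \<sigma>])
  have "\<mu> (Suc k) = 0"
    using odd[of j] k by simp
  moreover have "real k * \<mu> (k - 1) = 0"
  proof (cases j)
    case (Suc i)
    then show ?thesis using odd[of i] k by simp
  qed (simp add: k)
  ultimately show ?thesis by simp
next
  case False
  then obtain j where k: "k = 2 * j + 1" by (rule oddE)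
  have ev: "\<mu> (2 * i) = fact (2 * i) / ((2 / \<sigma>\<^sup>2) ^ i * fact i)" for i
    unfolding \<mu>_def by (rule integral_normal_moment_even[OF \<sigma>])
  have "fact (2 * Suc j) / ((2 / \<sigma>\<^sup>2) ^ Suc j * fact (Suc j)) =
      ((2 * real j + 2) * (2 * real j + 1) * fact (2 * j)) / ((2 / \<sigma>\<^sup>2) * (2 / \<sigma>\<^sup>2) ^ j * ((real j + 1) * fact j))"
    by (simp add: algebra_simps)
  also have "\<dots> = ((2 * (real j + 1)) * ((2 * real j + 1) * fact (2 * j))) / ((2 * (real j + 1)) * ((2 / \<sigma>\<^sup>2) ^ j * fact j / \<sigma>\<^sup>2))"
    by (rule arg_cong2[of _ _ _ _ "(/)"]) (simp_all add: algebra_simps)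
  also have "\<dots> = ((2 * real j + 1) * fact (2 * j)) / ((2 / \<sigma>\<^sup>2) ^ j * fact j / \<sigma>\<^sup>2)"
    by (rule mult_divide_mult_cancel_left) (simp add: add_eq_0_iff_both_eq_0)
  finally have "\<mu> (2 * Suc j) = \<sigma>\<^sup>2 * (2 * real j + 1) * \<mu> (2 * j)"
    unfolding ev by simp
  then show ?thesis
    using k by simp
qed

context
  fixes m \<sigma> :: real
  assumes \<sigma>: "0 < \<sigma>"
begin

text \<open>The second index is needed to close the recurrence: multiplication by x = (x - m) + m
  raises the centred power, so inductions on n must run for all k at once.\<close>

definition hermite_moment :: "nat \<Rightarrow> nat \<Rightarrow> real" where
  "hermite_moment n k = (LINT x|lborel. normal_density m \<sigma> x * (q_Hermite 1 n x * (x - m) ^ k))"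

lemma Hermite_Suc_Suc_shift:
  "q_Hermite 1 (Suc (Suc n)) x * (x - m) ^ k = q_Hermite 1 (Suc n) x * (x - m) ^ Suc k
     + m * (q_Hermite 1 (Suc n) x * (x - m) ^ k) - real (Suc n) * (q_Hermite 1 n x * (x - m) ^ k)"
  by (simp add: algebra_simps)

lemma integrable_hermite_moment:
  "integrable lborel (\<lambda>x. normal_density m \<sigma> x * (q_Hermite 1 n x * (x - m) ^ k))"
proof (induction n arbitrary: k rule: induct_nat_012)
  case 0
  then show ?case using integrable_normal_moment[OF \<sigma>, of m k] by simp
next
  case 1
  have "integrable lborel (\<lambda>x. normal_density m \<sigma> x * (x - m) ^ Suc k + m * (normal_density m \<sigma> x * (x - m) ^ k))"
    by (intro Bochner_Integration.integrable_add integrable_mult_right integrable_normal_moment \<sigma>)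
  then show ?case by (simp add: algebra_simps)
next
  case (ge2 n)
  have "integrable lborel (\<lambda>x. normal_density m \<sigma> x * (q_Hermite 1 (Suc n) x * (x - m) ^ Suc k)
     + m * (normal_density m \<sigma> x * (q_Hermite 1 (Suc n) x * (x - m) ^ k))
     - real (Suc n) * (normal_density m \<sigma> x * (q_Hermite 1 n x * (x - m) ^ k)))"
    by (intro Bochner_Integration.integrable_add Bochner_Integration.integrable_diff integrable_mult_right ge2)
  then show ?case
    unfolding Hermite_Suc_Suc_shift by (simp only: distrib_left right_diff_distrib mult.left_commute[of "normal_density m \<sigma> _"])
qed

lemma hermite_moment_0_Suc: "hermite_moment 0 (Suc k) = \<sigma>\<^sup>2 * real k * hermite_moment 0 (k - 1)"
  using normal_moment_Suc[OF \<sigma>, of m k] by (simp add: hermite_moment_def)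

lemma hermite_moment_1: "hermite_moment (Suc 0) k = hermite_moment 0 (Suc k) + m * hermite_moment 0 k"
proof -
  have "hermite_moment (Suc 0) k = (LINT x|lborel. normal_density m \<sigma> x * (q_Hermite 1 0 x * (x - m) ^ Suc k)
     + m * (normal_density m \<sigma> x * (q_Hermite 1 0 x * (x - m) ^ k)))"
    unfolding hermite_moment_def by (rule Bochner_Integration.integral_cong) (simp_all add: algebra_simps)
  then show ?thesis
    unfolding hermite_moment_def
    by (simp only: Bochner_Integration.integral_add integrable_mult_right integrable_hermite_moment integral_mult_right_zero)
qed

lemma hermite_moment_Suc_Suc:
  "hermite_moment (Suc (Suc n)) k = hermite_moment (Suc n) (Suc k) + m * hermite_moment (Suc n) k
     - real (Suc n) * hermite_moment n k"
proof -
  have "hermite_moment (Suc (Suc n)) k = (LINT x|lborel. normal_density m \<sigma> x * (q_Hermite 1 (Suc n) x * (x - m) ^ Suc k)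
     + m * (normal_density m \<sigma> x * (q_Hermite 1 (Suc n) x * (x - m) ^ k))
     - real (Suc n) * (normal_density m \<sigma> x * (q_Hermite 1 n x * (x - m) ^ k)))"
    unfolding hermite_moment_def Hermite_Suc_Suc_shift
    by (simp only: distrib_left right_diff_distrib mult.left_commute[of "normal_density m \<sigma> _"])
  then show ?thesis
    unfolding hermite_moment_def
    by (simp only: Bochner_Integration.integral_add Bochner_Integration.integral_diff integrable_mult_right
        integrable_hermite_moment integral_mult_right_zero Bochner_Integration.integrable_add)
qed

text \<open>Gaussian integration by parts for the function \<open>q_Hermite 1 n x * (x - m) ^ k\<close>.\<close>

lemma hermite_moment_Suc_right:
  "hermite_moment n (Suc k) = \<sigma>\<^sup>2 * (real k * hermite_moment n (k - 1) + real n * hermite_moment (n - 1) k)"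
proof (induction n arbitrary: k rule: induct_nat_012)
  case 0
  then show ?case by (simp add: hermite_moment_0_Suc)
next
  case 1
  show ?case
    by (cases k) (simp_all add: hermite_moment_1 hermite_moment_0_Suc algebra_simps)
next
  case (ge2 n)
  have n: "hermite_moment (Suc n) k = hermite_moment n (Suc k) + m * hermite_moment n k - real n * hermite_moment (n - 1) k"
    by (cases n) (simp_all add: hermite_moment_1 hermite_moment_Suc_Suc)
  have k: "real k * hermite_moment (Suc (Suc n)) (k - 1) = real k * (hermite_moment (Suc n) k
     + m * hermite_moment (Suc n) (k - 1) - real (Suc n) * hermite_moment n (k - 1))"
    by (cases k) (simp_all add: hermite_moment_Suc_Suc)
  have "hermite_moment (Suc (Suc n)) (Suc k) =
      \<sigma>\<^sup>2 * (real (Suc k) * hermite_moment (Suc n) k + real (Suc n) * hermite_moment n (Suc k))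
      + m * (\<sigma>\<^sup>2 * (real k * hermite_moment (Suc n) (k - 1) + real (Suc n) * hermite_moment n k))
      - real (Suc n) * (\<sigma>\<^sup>2 * (real k * hermite_moment n (k - 1) + real n * hermite_moment (n - 1) k))"
    unfolding hermite_moment_Suc_Suc ge2(2)[of "Suc k"] ge2(2)[of k] by (subst ge2(1)[of k]) simp
  also have "\<dots> = \<sigma>\<^sup>2 * (real k * (hermite_moment (Suc n) k
     + m * hermite_moment (Suc n) (k - 1) - real (Suc n) * hermite_moment n (k - 1)) +
     (hermite_moment (Suc n) k + real (Suc n) * (hermite_moment n (Suc k) + m * hermite_moment n k - real n * hermite_moment (n - 1) k)))"
    by (simp add: algebra_simps)
  also have "\<dots> = \<sigma>\<^sup>2 * (real k * hermite_moment (Suc (Suc n)) (k - 1) + real (Suc (Suc n)) * hermite_moment (Suc n) k)"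
    unfolding n[symmetric] k by (simp add: algebra_simps)
  finally show ?case by simp
qed

text \<open>At k = 0 the integration by parts gives E_(n+2) = m E_(n+1) - (n + 1)(1 - \<sigma>^2)
  E_n, the recurrence of s^n H_n(Y). The hypothesis \<open>s * Y = m\<close> stands for Y = m / s
  and admits s = 0.\<close>

lemma normal_Hermite_expectation:
  assumes s: "s\<^sup>2 = 1 - \<sigma>\<^sup>2" "s * Y = m"
  shows "(LINT x|lborel. normal_density m \<sigma> x * q_Hermite 1 n x) = s ^ n * q_Hermite 1 n Y"
proof -
  have "hermite_moment n 0 = s ^ n * q_Hermite 1 n Y"
  proof (induction n rule: induct_nat_012)
    case 0
    then show ?case using \<sigma> by (simp add: hermite_moment_def)
  next
    case 1
    have "hermite_moment 0 0 = 1"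
      using \<sigma> by (simp add: hermite_moment_def)
    then show ?case by (simp add: hermite_moment_1 hermite_moment_0_Suc s(2))
  next
    case (ge2 n)
    have "hermite_moment (Suc (Suc n)) 0 = m * hermite_moment (Suc n) 0 - real (Suc n) * (1 - \<sigma>\<^sup>2) * hermite_moment n 0"
      unfolding hermite_moment_Suc_Suc hermite_moment_Suc_right[of "Suc n" 0] by (simp add: algebra_simps)
    also have "\<dots> = s ^ Suc (Suc n) * q_Hermite 1 (Suc (Suc n)) Y"
      unfolding ge2 unfolding s(1)[symmetric] unfolding s(2)[symmetric] by (simp add: power2_eq_square algebra_simps)
    finally show ?case .
  qed
  then show ?thesis
    by (simp add: hermite_moment_def)
qed

end

text \<open>A normal density with mean m and variance 1 - s^2 is that of a standard normal variable
  given the value Y = m / s of another one with correlation s. So Mehler's formula with parameter s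
  applies, whatever the two original conditions are.\<close>

theorem phi_one_expansion:
  assumes r1: "\<bar>\<rho>1\<bar> < 1" and r2: "\<bar>\<rho>2\<bar> < 1"
  obtains Y :: "real \<Rightarrow> real \<Rightarrow> real" and s where "0 \<le> s" and "s < 1"
    and "\<And>R. \<exists>R'. \<forall>y z. \<bar>y\<bar> \<le> R \<longrightarrow> \<bar>z\<bar> \<le> R \<longrightarrow> \<bar>Y y z\<bar> \<le> R'"
    and "\<And>x y z i. 1 / q_fact 1 i * q_Hermite 1 i x * C 1 i y z \<rho>1 \<rho>2 = Hermite_coeff x (Y y z) i * s ^ i"
    and "\<And>x y z. \<phi> 1 x y \<rho>1 z \<rho>2 = f_N 1 x * (\<Sum>i. Hermite_coeff x (Y y z) i * s ^ i)"
proof -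
  define a b where "a = \<rho>1\<^sup>2" and "b = \<rho>2\<^sup>2"
  have ab: "0 \<le> a" "a < 1" "0 \<le> b" "b < 1"
    using r1 r2 by (simp_all add: a_def b_def abs_square_less_1)
  have ab1: "a * b < 1"
    using mult_strict_mono'[of a 1 b 1] ab by simp
  define v where "v = (1 - a) * (1 - b) / (1 - a * b)"
  have v: "0 < v"
    using ab ab1 by (simp add: v_def)
  have v1: "1 - v = (a * (1 - b) + b * (1 - a)) / (1 - a * b)"
    using ab1 by (simp add: v_def field_simps)
  then have v1': "0 \<le> 1 - v"
    using ab ab1 by simp
  define \<sigma> s where "\<sigma> = sqrt v" and "s = sqrt (1 - v)"
  have \<sigma>: "0 < \<sigma>" "\<sigma>\<^sup>2 = v"
    using v by (simp_all add: \<sigma>_def)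
  have s: "0 \<le> s" "s < 1" "s\<^sup>2 = 1 - \<sigma>\<^sup>2"
    using v v1' \<sigma> by (simp_all add: s_def)
  define m where "m y z = (y * \<rho>1 * (1 - b) + z * \<rho>2 * (1 - a)) / (1 - a * b)" for y z
  define Y where "Y y z = m y z / s" for y z
  \<comment> \<open>If s = 0 then \<rho>1 = \<rho>2 = 0, hence m = 0 as well.\<close>
  have sY: "s * Y y z = m y z" for y z
  proof (cases "s = 0")
    case True
    then have "(a * (1 - b) + b * (1 - a)) / (1 - a * b) = 0"
      using v1 by (simp add: s_def)
    then have "a * (1 - b) + b * (1 - a) = 0"
      using ab1 by simp
    then have "a = 0" "b = 0"
      using ab by (simp_all add: add_nonneg_eq_0_iff)
    then show ?thesis
      using True by (simp add: a_def b_def m_def)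
  qed (simp add: Y_def)
  have \<phi>: "\<phi> 1 x y \<rho>1 z \<rho>2 = normal_density (m y z) \<sigma> x" for x y z
    by (simp add: \<phi>_def m_def \<sigma>_def v_def a_def b_def)
  show thesis
  proof (rule that[of s Y])
    show "0 \<le> s" "s < 1" by (rule s)+
    show "\<exists>R'. \<forall>y z. \<bar>y\<bar> \<le> R \<longrightarrow> \<bar>z\<bar> \<le> R \<longrightarrow> \<bar>Y y z\<bar> \<le> R'" for R
    proof (intro exI allI impI)
      fix y z :: real assume yz: "\<bar>y\<bar> \<le> R" "\<bar>z\<bar> \<le> R"
      have "\<bar>y * \<rho>1 * (1 - b) + z * \<rho>2 * (1 - a)\<bar> \<le> \<bar>y\<bar> * \<bar>\<rho>1\<bar> * \<bar>1 - b\<bar> + \<bar>z\<bar> * \<bar>\<rho>2\<bar> * \<bar>1 - a\<bar>"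
        using abs_triangle_ineq[of "y * \<rho>1 * (1 - b)" "z * \<rho>2 * (1 - a)"] by (simp only: abs_mult)
      also have "\<dots> \<le> R * \<bar>\<rho>1\<bar> * \<bar>1 - b\<bar> + R * \<bar>\<rho>2\<bar> * \<bar>1 - a\<bar>"
        using yz by (intro add_mono mult_right_mono) auto
      finally show "\<bar>Y y z\<bar> \<le> (R * \<bar>\<rho>1\<bar> * \<bar>1 - b\<bar> + R * \<bar>\<rho>2\<bar> * \<bar>1 - a\<bar>) / \<bar>1 - a * b\<bar> / \<bar>s\<bar>"
        unfolding Y_def m_def abs_divide by (intro divide_right_mono) auto
    qed
    show "1 / q_fact 1 i * q_Hermite 1 i x * C 1 i y z \<rho>1 \<rho>2 = Hermite_coeff x (Y y z) i * s ^ i" for x y z i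
    proof -
      have "C 1 i y z \<rho>1 \<rho>2 = (LINT x|lborel. normal_density (m y z) \<sigma> x * q_Hermite 1 i x)"
        by (simp add: C_def S_def \<phi> set_lebesgue_integral_def mult.commute)
      also have "\<dots> = s ^ i * q_Hermite 1 i (Y y z)"
        by (rule normal_Hermite_expectation[OF \<sigma>(1) s(3) sY])
      finally show ?thesis
        by (simp add: Hermite_coeff_def)
    qed
    show "\<phi> 1 x y \<rho>1 z \<rho>2 = f_N 1 x * (\<Sum>i. Hermite_coeff x (Y y z) i * s ^ i)" for x y z
    proof -
      let ?m = "m y z" and ?Y = "Y y z"
      have "2 * s * x * ?Y - s\<^sup>2 * (x\<^sup>2 + ?Y\<^sup>2) = 2 * x * (s * ?Y) - s\<^sup>2 * x\<^sup>2 - (s * ?Y)\<^sup>2"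
        by (simp add: power2_eq_square algebra_simps)
      then have e: "2 * s * x * ?Y - s\<^sup>2 * (x\<^sup>2 + ?Y\<^sup>2) = 2 * x * ?m - (1 - v) * x\<^sup>2 - ?m\<^sup>2"
        by (simp add: sY s(3) \<sigma>(2))
      have v': "1 - s\<^sup>2 = v"
        by (simp add: s(3) \<sigma>(2))
      have ex: "- x\<^sup>2 / 2 + (2 * x * ?m - (1 - v) * x\<^sup>2 - ?m\<^sup>2) / (2 * v) = - (x - ?m)\<^sup>2 / (2 * v)"
        using v by (simp add: field_simps power2_eq_square)
      have "f_N 1 x * (\<Sum>i. Hermite_coeff x ?Y i * s ^ i) =
         exp (- x\<^sup>2 / 2) / sqrt (2 * pi) * (exp ((2 * x * ?m - (1 - v) * x\<^sup>2 - ?m\<^sup>2) / (2 * v)) / sqrt v)"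
        unfolding Mehler[OF s(1,2)] e v' by (simp add: f_N_def)
      also have "\<dots> = exp (- x\<^sup>2 / 2) * exp ((2 * x * ?m - (1 - v) * x\<^sup>2 - ?m\<^sup>2) / (2 * v)) / sqrt (2 * pi * v)"
        by (simp add: real_sqrt_mult)
      also have "\<dots> = normal_density ?m \<sigma> x"
        unfolding exp_add[symmetric] ex normal_density_def \<sigma>(2) by simp
      finally show ?thesis
        by (simp add: \<phi>)
    qed
  qed
qed

text \<open>Almost uniform convergence on compact sets is rendered as uniform convergence of the
  partial sums on each compact set of triples (x, y, z) in the domain.\<close>

theorem theorem3:
  fixes q \<rho>1 \<rho>2 :: real
  assumes "-1 < q" and "q \<le> 1" and "\<bar>\<rho>1\<bar> < 1" and "\<bar>\<rho>2\<bar> < 1"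
  shows "(\<forall>x\<in>S q. \<forall>y\<in>S q. \<forall>z\<in>S q.
            summable (\<lambda>i. \<bar>1 / q_fact q i * q_Hermite q i x * C q i y z \<rho>1 \<rho>2\<bar>) \<and>
            \<phi> q x y \<rho>1 z \<rho>2 =
              f_N q x * (\<Sum>i. 1 / q_fact q i * q_Hermite q i x * C q i y z \<rho>1 \<rho>2)) \<and>
         (\<forall>K. compact K \<and> K \<subseteq> S q \<times> S q \<times> S q \<longrightarrow>
            uniform_limit K
              (\<lambda>n (x, y, z). \<Sum>i<n. 1 / q_fact q i * q_Hermite q i x * C q i y z \<rho>1 \<rho>2)
              (\<lambda>(x, y, z). \<Sum>i. 1 / q_fact q i * q_Hermite q i x * C q i y z \<rho>1 \<rho>2)
              sequentially)"
proof -
  let ?T = "\<lambda>i x y z. 1 / q_fact q i * q_Hermite q i x * C q i y z \<rho>1 \<rho>2"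
  \<comment> \<open>One geometric majorant per compact set serves twice: on singletons it gives
    absolute convergence, on K the Weierstrass test.\<close>
  have geometric: "\<exists>A s. 0 \<le> s \<and> s < 1 \<and> (\<forall>x y z i. (x, y, z) \<in> K \<longrightarrow> \<bar>?T i x y z\<bar> \<le> A * s ^ i)"
    if K: "compact K" "K \<subseteq> S q \<times> S q \<times> S q" for K
  proof (cases "q = 1")
    case False
    then have "\<bar>q\<bar> < 1" using assms by simp
    from phi_expansion[OF this assms(3,4)] obtain A s where s: "0 \<le> s" "s < 1"
      and A: "\<forall>x\<in>S q. \<forall>y\<in>S q. \<forall>z\<in>S q. (\<forall>i. \<bar>?T i x y z\<bar> \<le> A * s ^ i) \<and>
        \<phi> q x y \<rho>1 z \<rho>2 = f_N q x * (\<Sum>i. ?T i x y z)"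
      by (elim exE conjE) (rule that)
    have "\<bar>?T i x y z\<bar> \<le> A * s ^ i" if "(x, y, z) \<in> K" for x y z i
    proof -
      have "x \<in> S q" "y \<in> S q" "z \<in> S q"
        using subsetD[OF K(2) that] by simp_all
      then show ?thesis
        using A[THEN bspec, THEN bspec, THEN bspec, THEN conjunct1, THEN spec] by simp
    qed
    then show ?thesis
      using s by (intro exI[of _ A] exI[of _ s]) simp
  next
    case True
    obtain Y :: "real \<Rightarrow> real \<Rightarrow> real" and s where s: "0 \<le> s" "s < 1"
      and Y: "\<And>R. \<exists>R'. \<forall>y z. \<bar>y\<bar> \<le> R \<longrightarrow> \<bar>z\<bar> \<le> R \<longrightarrow> \<bar>Y y z\<bar> \<le> R'"
      and T: "\<And>x y z i. 1 / q_fact 1 i * q_Hermite 1 i x * C 1 i y z \<rho>1 \<rho>2 = Hermite_coeff x (Y y z) i * s ^ i"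
      and "\<And>x y z. \<phi> 1 x y \<rho>1 z \<rho>2 = f_N 1 x * (\<Sum>i. Hermite_coeff x (Y y z) i * s ^ i)"
      using assms(3,4) by (rule phi_one_expansion) (rule that)
    \<comment> \<open>At q = 1 the majorant at hand holds on bounded sets of x and Y, so K is first
      enclosed in a box, on which Y is bounded.\<close>
    obtain R where R: "\<And>x y z. (x, y, z) \<in> K \<Longrightarrow> \<bar>x\<bar> \<le> R \<and> \<bar>y\<bar> \<le> R \<and> \<bar>z\<bar> \<le> R"
    proof -
      obtain R where R: "\<And>p. p \<in> K \<Longrightarrow> norm p \<le> R"
        using compact_imp_bounded[OF K(1)] unfolding bounded_iff by blast
      show thesis
      proof (rule that)
        fix x y z assume "(x, y, z) \<in> K"
        then have "norm (x, (y, z)) \<le> R"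
          by (rule R)
        moreover have "norm x \<le> norm (x, (y, z))" "norm y \<le> norm (y, z)" "norm z \<le> norm (y, z)"
            "norm (y, z) \<le> norm (x, (y, z))"
          using norm_fst_le[of x "(y, z)"] norm_fst_le[of y z] norm_snd_le[of z y] norm_snd_le[of "(y, z)" x] by auto
        ultimately show "\<bar>x\<bar> \<le> R \<and> \<bar>y\<bar> \<le> R \<and> \<bar>z\<bar> \<le> R"
          unfolding real_norm_def by linarith
      qed
    qed
    obtain R' where R': "\<And>y z. \<bar>y\<bar> \<le> R \<Longrightarrow> \<bar>z\<bar> \<le> R \<Longrightarrow> \<bar>Y y z\<bar> \<le> R'"
      using Y[of R] by blast
    have "\<bar>s\<bar> < 1" using s by simp
    then obtain A u where u: "0 \<le> u" "u < 1"
      "\<And>n x y. \<bar>x\<bar> \<le> max R R' \<Longrightarrow> \<bar>y\<bar> \<le> max R R' \<Longrightarrow> \<bar>Hermite_coeff x y n * s ^ n\<bar> \<le> A * u ^ n"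
      using Hermite_coeff_geometric_bound[of s "max R R'"] by metis
    have "\<bar>?T i x y z\<bar> \<le> A * u ^ i" if "(x, y, z) \<in> K" for x y z i
      unfolding True T using R[OF that] R'[of y z] by (intro u(3)) auto
    then show ?thesis
      using u(1,2) by (intro exI[of _ A] exI[of _ u]) simp
  qed
  have expansion: "\<phi> q x y \<rho>1 z \<rho>2 = f_N q x * (\<Sum>i. ?T i x y z)" if "x \<in> S q" "y \<in> S q" "z \<in> S q" for x y z
  proof (cases "q = 1")
    case True
    show ?thesis
      unfolding True using assms(3,4) by (rule phi_one_expansion) simp
  next
    case False
    then have "\<bar>q\<bar> < 1" using assms by simp
    from phi_expansion[OF this assms(3,4)] obtain A s where
      A: "\<forall>x\<in>S q. \<forall>y\<in>S q. \<forall>z\<in>S q. (\<forall>i. \<bar>?T i x y z\<bar> \<le> A * s ^ i) \<and>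
        \<phi> q x y \<rho>1 z \<rho>2 = f_N q x * (\<Sum>i. ?T i x y z)"
      by (elim exE conjE) (rule that)
    show ?thesis
      by (rule A[THEN bspec, THEN bspec, THEN bspec, THEN conjunct2]) (rule that)+
  qed
  have "summable (\<lambda>i. \<bar>?T i x y z\<bar>)" if xyz: "x \<in> S q" "y \<in> S q" "z \<in> S q" for x y z
  proof -
    obtain A s where s: "0 \<le> s" "s < 1" "\<And>i. \<bar>?T i x y z\<bar> \<le> A * s ^ i"
    proof -
      have "\<exists>A s. 0 \<le> s \<and> s < 1 \<and> (\<forall>x' y' z' i. (x', y', z') \<in> {(x, y, z)} \<longrightarrow> \<bar>?T i x' y' z'\<bar> \<le> A * s ^ i)"
        using xyz by (intro geometric) simp_all
      then show thesis
        using that by blast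
    qed
    show ?thesis
    proof (rule summable_comparison_test')
      show "summable (\<lambda>i. A * s ^ i)"
        using s by (intro summable_mult summable_geometric) simp
      show "norm \<bar>?T i x y z\<bar> \<le> A * s ^ i" for i
        using s(3)[of i] by simp
    qed
  qed
  moreover have "uniform_limit K (\<lambda>n (x, y, z). \<Sum>i<n. ?T i x y z) (\<lambda>(x, y, z). \<Sum>i. ?T i x y z) sequentially"
    if K: "compact K" "K \<subseteq> S q \<times> S q \<times> S q" for K
  proof -
    obtain A s where s: "0 \<le> s" "s < 1" "\<And>x y z i. (x, y, z) \<in> K \<Longrightarrow> \<bar>?T i x y z\<bar> \<le> A * s ^ i"
      using geometric[OF K] by blast
    have "uniform_limit K (\<lambda>n p. \<Sum>i<n. case p of (x, y, z) \<Rightarrow> ?T i x y z)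
        (\<lambda>p. \<Sum>i. case p of (x, y, z) \<Rightarrow> ?T i x y z) sequentially"
    proof (rule Weierstrass_m_test)
      show "norm (case p of (x, y, z) \<Rightarrow> ?T i x y z) \<le> A * s ^ i" if "p \<in> K" for i p
        using s(3) that by (cases p) simp
      show "summable (\<lambda>i. A * s ^ i)"
        using s by (intro summable_mult summable_geometric) simp
    qed
    moreover have "(\<lambda>n p. \<Sum>i<n. case p of (x, y, z) \<Rightarrow> ?T i x y z) = (\<lambda>n (x, y, z). \<Sum>i<n. ?T i x y z)"
      "(\<lambda>p. \<Sum>i. case p of (x, y, z) \<Rightarrow> ?T i x y z) = (\<lambda>(x, y, z). \<Sum>i. ?T i x y z)"
      by (auto simp: fun_eq_iff)
    ultimately show ?thesis by simp
  qed
  ultimately show ?thesis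
    using expansion by (intro conjI ballI allI impI) simp_all
qed

end
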